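(* Let $n\ge 6$ be an integer, $\alpha>0$, $k=-1$, and set $$r_0^2=2\alpha(n-4)(n-5),\qquad \Lambda=-\frac{n^2-5n-2}{8\alpha(n-4)(n-5)}.$$ Let $\tilde M(v)$ and $\tilde q(v)$ be arbitrary smooth real functions, and, for either choice of sign, let $$\tilde f(v,r)=1+\frac{r^2}{2(n-4)\alpha}\left[1\mp\left\{1-\frac{2(n-5)(2n-11)}{6(n-5)^2}+\frac{4(n-4)^2\alpha^{3/2}\tilde M(v)}{r^3}-\frac{4(n-4)^2\alpha^2\tilde q(v)}{r^4}\right\}^{1/2}\right]$$ on the set of $(v,r)$ with $r>0$ where the expression in braces is positive. Consider on $\mathcal{M}^4\times\mathcal{K}^{n-4}$ the metric $g_{\mu\nu}=\mathrm{diag}(g_{AB},r_0^2\gamma_{ab})$, where $\gamma_{ab}$ is the metric of an $(n-4)$-dimensional space $\mathcal{K}^{n-4}$ of constant sectional curvature $-1$ and $$g_{AB}dx^Adx^B=-\tilde f(v,r)\,dv^2+2\,dv\,dr+r^2d\Sigma^2,$$ with $d\Sigma^2$ the metric of the unit two-sphere. Then this metric satisfies the scalar constraint equation $\mathcal{G}^a{}_b=0$.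
   Context: On an $n$-dimensional pseudo-Riemannian manifold with metric $g_{\mu\nu}$, define $$\mathcal{G}^\mu{}_\nu = G^\mu{}_\nu+\alpha H^\mu{}_\nu+\Lambda\,\delta^\mu{}_\nu,$$ where $G_{\mu\nu}=R_{\mu\nu}-\frac12 g_{\mu\nu}R$, $$H_{\mu\nu}=2\left[RR_{\mu\nu}-2R_{\mu\alpha}R^\alpha{}_\nu-2R^{\alpha\beta}R_{\mu\alpha\nu\beta}+R_\mu{}^{\alpha\beta\gamma}R_{\nu\alpha\beta\gamma}\right]-\frac12 g_{\mu\nu}L_{GB},$$ $$L_{GB}=R^2-4R_{\mu\nu}R^{\mu\nu}+R_{\mu\nu\rho\sigma}R^{\mu\nu\rho\sigma},$$ and $R_{\mu\nu\rho\sigma}$, $R_{\mu\nu}=R^\alpha{}_{\mu\alpha\nu}$, $R$ are the Riemann tensor, Ricci tensor and Ricci scalar of the $n$-dimensional metric (with signs such that round spheres have positive Ricci scalar). Indices $A,B\in\{0,1,2,3\}$ refer to $\mathcal{M}^4$; indices $a,b\in\{4,\dots,n-1\}$ refer to $\mathcal{K}^{n-4}$. For a product metric $\mathrm{diag}(g_{AB},r_0^2\gamma_{ab})$ with $\gamma_{ab}$ of constant curvature $k$, the components along $\mathcal{K}^{n-4}$ are $$\mathcal{G}^a{}_b=\delta^a{}_b\Big[-\tfrac12 R^{(4)}+\Lambda-\tfrac{(n-5)(n-6)k}{2r_0^2}-\alpha\Big\{\tfrac{k(n-5)(n-6)}{r_0^2}R^{(4)}+\tfrac12 L^{(4)}_{GB}+\tfrac{(n-5)(n-6)(n-7)(n-8)k^2}{2r_0^4}\Big\}\Big],$$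 where $R^{(4)}$ and $L^{(4)}_{GB}$ are the Ricci scalar and Gauss-Bonnet scalar of $g_{AB}$; so $\mathcal{G}^a{}_b=0$ is a single scalar equation on $\mathcal{M}^4$. *)

theory Defs
  imports "HOL-Analysis.Analysis"
begin

text \<open>
  Everything is written in local coordinates: a (pseudo-Riemannian) metric on a coordinate patch is
  a matrix-valued function \<open>g :: real^'n \<Rightarrow> real^'n^'n\<close>, with components \<open>g x $ i $ j\<close>.  Tensors
  are given by their coordinate components.
\<close>

section \<open>Smooth functions\<close>

primrec Ck_on :: "nat \<Rightarrow> 'a::euclidean_space set \<Rightarrow> ('a \<Rightarrow> 'b::real_normed_vector) \<Rightarrow> bool" where
  "Ck_on 0 U f \<longleftrightarrow> continuous_on U f"
| "Ck_on (Suc k) U f \<longleftrightarrow>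
     (\<forall>x\<in>U. f differentiable (at x)) \<and>
     (\<forall>b\<in>Basis. Ck_on k U (\<lambda>x. frechet_derivative f (at x) b))"

text \<open>Only used for open \<open>U\<close>.\<close>

definition smooth_on :: "'a::euclidean_space set \<Rightarrow> ('a \<Rightarrow> 'b::real_normed_vector) \<Rightarrow> bool" where
  "smooth_on U f \<longleftrightarrow> (\<forall>k. Ck_on k U f)"

definition partial ::
  "'n::finite \<Rightarrow> (real^'n \<Rightarrow> 'b::real_normed_vector) \<Rightarrow> real^'n \<Rightarrow> 'b" where
  "partial i f x = frechet_derivative f (at x) (axis i 1)"

section \<open>Curvature of a metric\<close>

definition pseudo_riemannian_on :: "(real^'n::finite) set \<Rightarrow> (real^'n \<Rightarrow> real^'n^'n) \<Rightarrow> bool" where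
  "pseudo_riemannian_on U g \<longleftrightarrow>
     smooth_on U g \<and> (\<forall>x\<in>U. transpose (g x) = g x \<and> invertible (g x))"

definition ginv :: "(real^'n::finite \<Rightarrow> real^'n^'n) \<Rightarrow> real^'n \<Rightarrow> 'n \<Rightarrow> 'n \<Rightarrow> real" where
  "ginv g x i j = matrix_inv (g x) $ i $ j"

text \<open>\<open>christoffel g l i j x\<close> is $\Gamma^l{}_{ij}$.\<close>

definition christoffel ::
  "(real^'n::finite \<Rightarrow> real^'n^'n) \<Rightarrow> 'n \<Rightarrow> 'n \<Rightarrow> 'n \<Rightarrow> real^'n \<Rightarrow> real" where
  "christoffel g l i j x =
     (1/2) * (\<Sum>m\<in>UNIV. ginv g x l m *
       (partial i (\<lambda>y. g y $ m $ j) x + partial j (\<lambda>y. g y $ m $ i) x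
          - partial m (\<lambda>y. g y $ i $ j) x))"

text \<open>
  \<open>riemann_up g x r s m n\<close> is
  $R^r{}_{smn} = \partial_m \Gamma^r{}_{ns} - \partial_n \Gamma^r{}_{ms}
     + \Gamma^r{}_{ml}\Gamma^l{}_{ns} - \Gamma^r{}_{nl}\Gamma^l{}_{ms}$.
  With $R_{sn} = R^m{}_{smn}$ this makes the Ricci scalar of round spheres positive.
\<close>

definition riemann_up ::
  "(real^'n::finite \<Rightarrow> real^'n^'n) \<Rightarrow> real^'n \<Rightarrow> 'n \<Rightarrow> 'n \<Rightarrow> 'n \<Rightarrow> 'n \<Rightarrow> real" where
  "riemann_up g x r s m n =
     partial m (christoffel g r n s) x - partial n (christoffel g r m s) x
     + (\<Sum>l\<in>UNIV. christoffel g r m l x * christoffel g l n s x)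
     - (\<Sum>l\<in>UNIV. christoffel g r n l x * christoffel g l m s x)"

definition riemann ::
  "(real^'n::finite \<Rightarrow> real^'n^'n) \<Rightarrow> real^'n \<Rightarrow> 'n \<Rightarrow> 'n \<Rightarrow> 'n \<Rightarrow> 'n \<Rightarrow> real" where
  "riemann g x r s m n = (\<Sum>l\<in>UNIV. g x $ r $ l * riemann_up g x l s m n)"

definition ricci :: "(real^'n::finite \<Rightarrow> real^'n^'n) \<Rightarrow> real^'n \<Rightarrow> 'n \<Rightarrow> 'n \<Rightarrow> real" where
  "ricci g x s n = (\<Sum>m\<in>UNIV. riemann_up g x m s m n)"

definition ricci_scalar :: "(real^'n::finite \<Rightarrow> real^'n^'n) \<Rightarrow> real^'n \<Rightarrow> real" where
  "ricci_scalar g x = (\<Sum>i\<in>UNIV. \<Sum>j\<in>UNIV. ginv g x i j * ricci g x i j)"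

text \<open>The raised versions $R^a{}_n$, $R^{ab}$ and $R_m{}^{abc}$.\<close>

definition ricci_up1 :: "(real^'n::finite \<Rightarrow> real^'n^'n) \<Rightarrow> real^'n \<Rightarrow> 'n \<Rightarrow> 'n \<Rightarrow> real" where
  "ricci_up1 g x a n = (\<Sum>i\<in>UNIV. ginv g x a i * ricci g x i n)"

definition ricci_up2 :: "(real^'n::finite \<Rightarrow> real^'n^'n) \<Rightarrow> real^'n \<Rightarrow> 'n \<Rightarrow> 'n \<Rightarrow> real" where
  "ricci_up2 g x a b = (\<Sum>i\<in>UNIV. \<Sum>j\<in>UNIV. ginv g x a i * ginv g x b j * ricci g x i j)"

definition riemann_up3 ::
  "(real^'n::finite \<Rightarrow> real^'n^'n) \<Rightarrow> real^'n \<Rightarrow> 'n \<Rightarrow> 'n \<Rightarrow> 'n \<Rightarrow> 'n \<Rightarrow> real" where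
  "riemann_up3 g x m a b c =
     (\<Sum>i\<in>UNIV. \<Sum>j\<in>UNIV. \<Sum>k\<in>UNIV.
        ginv g x a i * ginv g x b j * ginv g x c k * riemann g x m i j k)"

text \<open>$R_{mnrs}R^{mnrs}$ is computed as $g^{ml}R_m{}^{abc}R_{labc}$.\<close>

definition gauss_bonnet :: "(real^'n::finite \<Rightarrow> real^'n^'n) \<Rightarrow> real^'n \<Rightarrow> real" where
  "gauss_bonnet g x =
     (ricci_scalar g x)\<^sup>2
     - 4 * (\<Sum>i\<in>UNIV. \<Sum>j\<in>UNIV. ricci g x i j * ricci_up2 g x i j)
     + (\<Sum>m\<in>UNIV. \<Sum>l\<in>UNIV. \<Sum>a\<in>UNIV. \<Sum>b\<in>UNIV. \<Sum>c\<in>UNIV.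
          ginv g x m l * riemann_up3 g x m a b c * riemann g x l a b c)"

definition einstein :: "(real^'n::finite \<Rightarrow> real^'n^'n) \<Rightarrow> real^'n \<Rightarrow> 'n \<Rightarrow> 'n \<Rightarrow> real" where
  "einstein g x m n = ricci g x m n - (1/2) * g x $ m $ n * ricci_scalar g x"

definition H_tensor :: "(real^'n::finite \<Rightarrow> real^'n^'n) \<Rightarrow> real^'n \<Rightarrow> 'n \<Rightarrow> 'n \<Rightarrow> real" where
  "H_tensor g x m n =
     2 * (ricci_scalar g x * ricci g x m n
          - 2 * (\<Sum>a\<in>UNIV. ricci g x m a * ricci_up1 g x a n)
          - 2 * (\<Sum>a\<in>UNIV. \<Sum>b\<in>UNIV. ricci_up2 g x a b * riemann g x m a n b)
          + (\<Sum>a\<in>UNIV. \<Sum>b\<in>UNIV. \<Sum>c\<in>UNIV. riemann_up3 g x m a b c * riemann g x n a b c))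
     - (1/2) * g x $ m $ n * gauss_bonnet g x"

text \<open>
  \<open>EGB \<alpha> \<Lambda> g x m n\<close> is the mixed component
  $\mathcal{G}^m{}_n = G^m{}_n + \alpha H^m{}_n + \Lambda\,\delta^m{}_n$ at \<open>x\<close>.
\<close>

definition EGB ::
  "real \<Rightarrow> real \<Rightarrow> (real^'n::finite \<Rightarrow> real^'n^'n) \<Rightarrow> real^'n \<Rightarrow> 'n \<Rightarrow> 'n \<Rightarrow> real" where
  "EGB \<alpha> \<Lambda> g x m n =
     (\<Sum>l\<in>UNIV. ginv g x m l * einstein g x l n)
     + \<alpha> * (\<Sum>l\<in>UNIV. ginv g x m l * H_tensor g x l n)
     + \<Lambda> * (if m = n then 1 else 0)"

text \<open>
  Sectional curvature of the plane spanned by \<open>u\<close>, \<open>v\<close>; meaningful when \<open>plane_form g x u v \<noteq> 0\<close>,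
  i.e. when the plane is nondegenerate (for a Riemannian metric: when \<open>u\<close>, \<open>v\<close> are linearly
  independent).
\<close>

definition plane_form ::
  "(real^'n::finite \<Rightarrow> real^'n^'n) \<Rightarrow> real^'n \<Rightarrow> real^'n \<Rightarrow> real^'n \<Rightarrow> real" where
  "plane_form g x u v =
     (u \<bullet> (g x *v u)) * (v \<bullet> (g x *v v)) - (u \<bullet> (g x *v v))\<^sup>2"

definition sectional_curvature ::
  "(real^'n::finite \<Rightarrow> real^'n^'n) \<Rightarrow> real^'n \<Rightarrow> real^'n \<Rightarrow> real^'n \<Rightarrow> real" where
  "sectional_curvature g x u v =
     (\<Sum>a\<in>UNIV. \<Sum>b\<in>UNIV. \<Sum>c\<in>UNIV. \<Sum>d\<in>UNIV.
        riemann g x a b c d * u $ a * v $ b * u $ c * v $ d) / plane_form g x u v"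

definition constant_sectional_curvature_on ::
  "(real^'n::finite) set \<Rightarrow> (real^'n \<Rightarrow> real^'n^'n) \<Rightarrow> real \<Rightarrow> bool" where
  "constant_sectional_curvature_on U g k \<longleftrightarrow>
     (\<forall>x\<in>U. \<forall>u v. plane_form g x u v \<noteq> 0 \<longrightarrow> sectional_curvature g x u v = k)"

section \<open>Product coordinates and block-diagonal matrices\<close>

text \<open>
  A coordinate vector of a product is indexed by a sum type; for instance the index type
  \<open>(2 + 2) + 'k\<close> has \<open>4 + CARD('k)\<close> elements.
\<close>

definition lpart :: "real^('a::finite + 'b::finite) \<Rightarrow> real^'a" where
  "lpart x = (\<chi> i. x $ Inl i)"

definition rpart :: "real^('a::finite + 'b::finite) \<Rightarrow> real^'b" where
  "rpart x = (\<chi> i. x $ Inr i)"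

definition block_diag ::
  "real^'a::finite^'a \<Rightarrow> real^'b::finite^'b \<Rightarrow> real^('a + 'b)^('a + 'b)" where
  "block_diag A B = (\<chi> i j. case (i, j) of
      (Inl a, Inl a') \<Rightarrow> A $ a $ a'
    | (Inr b, Inr b') \<Rightarrow> B $ b $ b'
    | _ \<Rightarrow> 0)"

section \<open>The unit two-sphere\<close>

text \<open>
  A local parametrization of the unit sphere of \<open>real^3\<close> (the inverse of a chart), and the induced
  metric in the corresponding coordinates.  The usual
  \<open>(\<theta>, \<phi>) \<mapsto> (sin \<theta> cos \<phi>, sin \<theta> sin \<phi>, cos \<theta>)\<close> is an instance and gives
  $d\theta^2 + \sin^2\theta\, d\phi^2$.
\<close>

definition sphere_parametrization :: "(real^2) set \<Rightarrow> (real^2 \<Rightarrow> real^3) \<Rightarrow> bool" where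
  "sphere_parametrization V X \<longleftrightarrow>
     open V \<and> smooth_on V X \<and> inj_on X V \<and> (\<forall>z\<in>V. norm (X z) = 1) \<and>
     (\<forall>z\<in>V. \<forall>c::real^2. (\<Sum>i\<in>UNIV. c $ i *\<^sub>R partial i X z) = 0 \<longrightarrow> c = 0)"

definition induced_metric :: "(real^2 \<Rightarrow> real^3) \<Rightarrow> real^2 \<Rightarrow> real^2^2" where
  "induced_metric X z = (\<chi> i j. partial i X z \<bullet> partial j X z)"

section \<open>The metric under consideration\<close>

text \<open>
  \<open>braces\<close> is the expression under the root in $\tilde f$; in \<open>ftilde\<close>, the parameter
  \<open>s\<close> is \<open>1\<close> for the upper sign of $\mp$ and \<open>-1\<close> for the lower one.
\<close>

definition braces ::
  "real \<Rightarrow> real \<Rightarrow> (real \<Rightarrow> real) \<Rightarrow> (real \<Rightarrow> real) \<Rightarrow> real \<Rightarrow> real \<Rightarrow> real" where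
  "braces n \<alpha> M q v r =
     1 - 2 * (n - 5) * (2 * n - 11) / (6 * (n - 5)\<^sup>2)
       + 4 * (n - 4)\<^sup>2 * \<alpha> powr (3/2) * M v / r ^ 3
       - 4 * (n - 4)\<^sup>2 * \<alpha>\<^sup>2 * q v / r ^ 4"

definition ftilde ::
  "real \<Rightarrow> real \<Rightarrow> real \<Rightarrow> (real \<Rightarrow> real) \<Rightarrow> (real \<Rightarrow> real) \<Rightarrow> real \<Rightarrow> real \<Rightarrow> real" where
  "ftilde s n \<alpha> M q v r =
     1 + r\<^sup>2 / (2 * (n - 4) * \<alpha>) * (1 - s * sqrt (braces n \<alpha> M q v r))"

text \<open>
  Coordinates \<open>(v, r)\<close> are \<open>lpart y $ 1\<close>, \<open>lpart y $ 2\<close>; the sphere coordinates are \<open>rpart y\<close>.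
\<close>

definition metric4 ::
  "(real \<Rightarrow> real \<Rightarrow> real) \<Rightarrow> (real^2 \<Rightarrow> real^2^2) \<Rightarrow> real^(2 + 2) \<Rightarrow> real^(2 + 2)^(2 + 2)" where
  "metric4 f \<sigma> y =
     (let v = lpart y $ 1; r = lpart y $ 2 in
        block_diag (vector [vector [- f v r, 1], vector [1, 0]]) (r\<^sup>2 *\<^sub>R \<sigma> (rpart y)))"

definition product_metric ::
  "real \<Rightarrow> (real^'a::finite \<Rightarrow> real^'a^'a) \<Rightarrow> (real^'b::finite \<Rightarrow> real^'b^'b) \<Rightarrow>
    real^('a + 'b) \<Rightarrow> real^('a + 'b)^('a + 'b)" where
  "product_metric r0 g \<gamma> x = block_diag (g (lpart x)) (r0\<^sup>2 *\<^sub>R \<gamma> (rpart x))"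

end

theory Submission
  imports Defs
begin

text \<open>
  Both the product metric and its four-dimensional factor are warped products
  $h_{ab}\,dx^a dx^b + u(x)\,\gamma_{ij}\,dz^i dz^j$ with a fibre of constant curvature: $u = r_0^2$ over
  the four-dimensional factor in the first case, and $u = r^2$ over the $(v,r)$-plane with a unit
  sphere as fibre in the second.  The curvature of a warped product reduces $\mathcal{G}^a{}_b$ to
  $\delta^a{}_b$ times a scalar, and with the given $r_0$ and $\Lambda$ its vanishing becomes
  \[ \tfrac12\alpha L^{(4)}_{GB} + \frac{R^{(4)}}{n-4} = - \frac{2n-11}{\alpha (n-4)^2 (n-5)}. \]
  With $h = \tilde f - 1$ one has $r^2 R^{(4)} = -\partial_r^2 (r^2 h)$ and
  $r^2 L^{(4)}_{GB} = 2\,\partial_r^2 (h^2)$, so the equation integrates to a quadratic equation for $h$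
  whose two integration constants are $\tilde M(v)$ and $\tilde q(v)$; its roots are the two choices
  of $\tilde f$.
\<close>

section \<open>Partial derivatives up to second order\<close>

text \<open>The value of \<open>EGB\<close> at \<open>x\<close> depends on the metric near
  \<open>x\<close> up to second order, and the root in \<open>ftilde\<close> is controlled only
  where \<open>braces\<close> is positive. Regularity is therefore stated at one point:
  \<open>twice_diff\<close> passes through arithmetic, roots and projections and carries the
  symmetry of mixed partials along, so that Schwarz's theorem is applied only to smooth functions.

  The definition of the Riemann tensor differentiates \<open>matrix_inv\<close>. With all indices
  lowered it becomes second partials of the metric plus products of first-kind Christoffel symbols
  contracted with the inverse metric, and in this form block structure and symmetries are
  accessible.

  With a = 2 (n - 4) \<alpha> the quadratic equation is a^2 h^2 - 2 a r^2 h = r^4 (braces - 1). The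
  powers r^-3 and r^-4 in \<open>braces\<close> turn the right side into m(v) r - k(v) - c r^4. The
  first two terms are the kernel of the second r-derivative, and c = (2n - 11) / (3 (n - 5))
  produces the constant on the right of the displayed equation.\<close>

definition twice_diff :: "(real^'n::finite \<Rightarrow> real) \<Rightarrow> real^'n \<Rightarrow> bool" where
  "twice_diff f x \<longleftrightarrow>
     (\<forall>\<^sub>F y in nhds x. f differentiable (at y)) \<and>
     (\<forall>i. partial i f differentiable (at x)) \<and>
     (\<forall>i j. partial i (partial j f) x = partial j (partial i f) x)"

lemma partial_has_derivative:
  "(f has_derivative D) (at x) \<Longrightarrow> partial i f x = D (axis i 1)"
  by (metis partial_def frechet_derivative_at)

text \<open>\<open>frechet_derivative\<close> is a choice among all derivatives at the point.
  Functions that agree near \<open>x\<close> have the same candidates, so the choices coincide even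
  where neither function is differentiable.\<close>

lemma frechet_derivative_cong_ev:
  assumes "\<forall>\<^sub>F y in nhds x. f y = g y"
  shows "frechet_derivative f (at x) = frechet_derivative g (at x)"
proof -
  have fx: "f x = g x"
    using eventually_nhds_x_imp_x[OF assms] .
  have "(f has_derivative D) (at x) \<longleftrightarrow> (g has_derivative D) (at x)" for D
    using assms fx
    by (intro iffI; elim has_derivative_transform_eventually)
       (auto simp: eventually_at_filter elim: eventually_mono)
  then show ?thesis by (simp add: frechet_derivative_def)
qed

lemma partial_cong_ev:
  "\<forall>\<^sub>F y in nhds x. f y = g y \<Longrightarrow> partial i f x = partial i g x"
  unfolding partial_def using frechet_derivative_cong_ev by metis

lemma partial_cong_eventually:
  assumes "\<forall>\<^sub>F y in nhds x. f y = g y"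
  shows "\<forall>\<^sub>F y in nhds x. partial i f y = partial i g y"
proof -
  have "\<forall>\<^sub>F y in nhds x. \<forall>\<^sub>F z in nhds y. f z = g z"
    using assms by (simp add: eventually_eventually)
  then show ?thesis by eventually_elim (rule partial_cong_ev)
qed

lemma differentiable_cong_ev:
  assumes "\<forall>\<^sub>F y in nhds x. f y = g y" "f differentiable (at x)"
  shows "g differentiable (at x)"
proof -
  have fx: "f x = g x"
    using eventually_nhds_x_imp_x[OF assms(1)] .
  have "\<forall>\<^sub>F y in at x. f y = g y"
    using assms(1) by (auto simp: eventually_at_filter elim: eventually_mono)
  then show ?thesis
    using assms(2) fx unfolding differentiable_def
    by (blast intro: has_derivative_transform_eventually)
qed

lemma partial_const [simp]: "partial i (\<lambda>y. c) x = 0"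
  by (simp add: partial_def)

lemma partial_add:
  assumes "f differentiable (at x)" "g differentiable (at x)"
  shows "partial i (\<lambda>y. f y + g y) x = partial i f x + partial i g x"
proof -
  note d = assms[unfolded frechet_derivative_works]
  show ?thesis
    by (subst partial_has_derivative[OF has_derivative_add[OF d]]) (simp add: partial_def)
qed

lemma partial_diff:
  assumes "f differentiable (at x)" "g differentiable (at x)"
  shows "partial i (\<lambda>y. f y - g y) x = partial i f x - partial i g x"
proof -
  note d = assms[unfolded frechet_derivative_works]
  show ?thesis
    by (subst partial_has_derivative[OF has_derivative_diff[OF d]]) (simp add: partial_def)
qed

lemma partial_mult:
  fixes f g :: "real^'n::finite \<Rightarrow> real"
  assumes "f differentiable (at x)" "g differentiable (at x)"
  shows "partial i (\<lambda>y. f y * g y) x = partial i f x * g x + f x * partial i g x"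
proof -
  note d = assms[unfolded frechet_derivative_works]
  show ?thesis
    by (subst partial_has_derivative[OF has_derivative_mult[OF d]]) (simp add: partial_def)
qed

lemma partial_sum:
  assumes "\<And>k. k \<in> K \<Longrightarrow> f k differentiable (at x)"
  shows "partial i (\<lambda>y. \<Sum>k\<in>K. f k y) x = (\<Sum>k\<in>K. partial i (f k) x)"
proof -
  note d = assms[unfolded frechet_derivative_works]
  show ?thesis
    by (subst partial_has_derivative[OF has_derivative_sum[OF d]]) (simp_all add: partial_def)
qed

lemma partial_linear:
  assumes "bounded_linear L" "f differentiable (at x)"
  shows "partial i (\<lambda>y. L (f y)) x = L (partial i f x)"
proof -
  note d = assms(2)[unfolded frechet_derivative_works]
  show ?thesis
    by (subst partial_has_derivative[OF bounded_linear.has_derivative[OF assms(1) d]])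
       (simp add: partial_def)
qed

lemma partial_chain:
  fixes f :: "real^'n::finite \<Rightarrow> real"
  assumes "f differentiable (at x)" "(\<phi> has_real_derivative d) (at (f x))"
  shows "partial i (\<lambda>y. \<phi> (f y)) x = d * partial i f x"
proof -
  note e = assms(1)[unfolded frechet_derivative_works]
  show ?thesis
    by (subst partial_has_derivative[OF has_derivative_compose[OF e
          assms(2)[unfolded has_field_derivative_def]]]) (simp add: partial_def)
qed

lemma differentiable_chain_real:
  fixes f :: "real^'n::finite \<Rightarrow> real"
  assumes "f differentiable (at x)" "(\<phi> has_real_derivative d) (at (f x))"
  shows "(\<lambda>y. \<phi> (f y)) differentiable (at x)"
proof -
  note e = assms(1)[unfolded frechet_derivative_works]
  show ?thesis
    using has_derivative_compose[OF e assms(2)[unfolded has_field_derivative_def]]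
    unfolding differentiable_def by blast
qed

lemma partial_coord: "partial i (\<lambda>y. y $ j) x = (if i = j then 1 else 0)"
  by (subst partial_has_derivative[OF bounded_linear_imp_has_derivative[OF bounded_linear_vec_nth]])
     (simp add: axis_def)

section \<open>Coordinates of a product and functions of one factor\<close>

lemma bounded_linear_lpart: "bounded_linear (lpart :: real^('a::finite+'b::finite) \<Rightarrow> real^'a)"
  by (rule linear_conv_bounded_linear[THEN iffD1], rule linearI)
     (simp_all add: lpart_def vec_eq_iff)

lemma bounded_linear_rpart: "bounded_linear (rpart :: real^('a::finite+'b::finite) \<Rightarrow> real^'b)"
  by (rule linear_conv_bounded_linear[THEN iffD1], rule linearI)
     (simp_all add: rpart_def vec_eq_iff)

lemma lpart_axis: "lpart (axis (Inl i) 1) = axis i (1::real)" "lpart (axis (Inr j) (1::real)) = 0"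
  by (simp_all add: lpart_def axis_def vec_eq_iff)

lemma rpart_axis: "rpart (axis (Inr i) 1) = axis i (1::real)" "rpart (axis (Inl j) (1::real)) = 0"
  by (simp_all add: rpart_def axis_def vec_eq_iff)

lemma tendsto_lpart: "filterlim lpart (nhds (lpart x)) (nhds x)"
  using linear_continuous_at[OF bounded_linear_lpart] by (simp add: isCont_def continuous_at tendsto_at_iff_tendsto_nhds)

lemma tendsto_rpart: "filterlim rpart (nhds (rpart x)) (nhds x)"
  using linear_continuous_at[OF bounded_linear_rpart] by (simp add: isCont_def continuous_at tendsto_at_iff_tendsto_nhds)

lemma differentiable_lpart:
  "f differentiable (at (lpart x)) \<Longrightarrow> (\<lambda>y. f (lpart y)) differentiable (at x)"
  using differentiable_compose[OF _ bounded_linear_imp_differentiable[OF bounded_linear_lpart]] .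

lemma differentiable_rpart:
  "f differentiable (at (rpart x)) \<Longrightarrow> (\<lambda>y. f (rpart y)) differentiable (at x)"
  using differentiable_compose[OF _ bounded_linear_imp_differentiable[OF bounded_linear_rpart]] .

lemma partial_lpart:
  assumes "f differentiable (at (lpart x))"
  shows "partial (Inl i) (\<lambda>y. f (lpart y)) x = partial i f (lpart x)"
    and "partial (Inr j) (\<lambda>y. f (lpart y)) x = 0"
proof -
  note d = assms[unfolded frechet_derivative_works]
  note e = has_derivative_compose[OF bounded_linear_imp_has_derivative[OF bounded_linear_lpart] d]
  show "partial (Inl i) (\<lambda>y. f (lpart y)) x = partial i f (lpart x)"
    by (subst partial_has_derivative[OF e]) (simp add: partial_def lpart_axis)
  show "partial (Inr j) (\<lambda>y. f (lpart y)) x = 0"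
    by (subst partial_has_derivative[OF e])
       (simp add: lpart_axis linear_0 linear_frechet_derivative[OF assms])
qed

lemma partial_rpart:
  assumes "f differentiable (at (rpart x))"
  shows "partial (Inr i) (\<lambda>y. f (rpart y)) x = partial i f (rpart x)"
    and "partial (Inl j) (\<lambda>y. f (rpart y)) x = 0"
proof -
  note d = assms[unfolded frechet_derivative_works]
  note e = has_derivative_compose[OF bounded_linear_imp_has_derivative[OF bounded_linear_rpart] d]
  show "partial (Inr i) (\<lambda>y. f (rpart y)) x = partial i f (rpart x)"
    by (subst partial_has_derivative[OF e]) (simp add: partial_def rpart_axis)
  show "partial (Inl j) (\<lambda>y. f (rpart y)) x = 0"
    by (subst partial_has_derivative[OF e])
       (simp add: rpart_axis linear_0 linear_frechet_derivative[OF assms])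
qed

section \<open>Closure properties of \<open>twice_diff\<close>\<close>

lemma twice_diff_at: "twice_diff f x \<Longrightarrow> f differentiable (at x)"
  unfolding twice_diff_def using eventually_nhds_x_imp_x by blast

lemma twice_diff_ev: "twice_diff f x \<Longrightarrow> \<forall>\<^sub>F y in nhds x. f differentiable (at y)"
  by (simp add: twice_diff_def)

lemma twice_diff_partial: "twice_diff f x \<Longrightarrow> partial i f differentiable (at x)"
  by (simp add: twice_diff_def)

lemma twice_diff_sym:
  "twice_diff f x \<Longrightarrow> partial i (partial j f) x = partial j (partial i f) x"
  by (simp add: twice_diff_def)

text \<open>First partials are usually known near \<open>x\<close> as some explicit
  \<open>F i\<close>. Partials of functions that agree near \<open>x\<close> are equal, so
  differentiability and second partials at \<open>x\<close> may be checked on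
  \<open>F\<close>.\<close>

lemma twice_diff_intro:
  assumes "\<forall>\<^sub>F y in nhds x. f differentiable (at y)"
    and "\<And>i. \<forall>\<^sub>F y in nhds x. partial i f y = F i y"
    and "\<And>i. F i differentiable (at x)"
    and "\<And>i j. partial i (F j) x = partial j (F i) x"
  shows "twice_diff f x"
proof -
  have "partial i (partial j f) x = partial i (F j) x" for i j
    by (rule partial_cong_ev[OF assms(2)])
  moreover have "partial i f differentiable (at x)" for i
    by (rule differentiable_cong_ev[OF _ assms(3)])
       (use assms(2)[of i] in \<open>auto elim: eventually_mono\<close>)
  ultimately show ?thesis
    using assms unfolding twice_diff_def by simp
qed

lemma twice_diff_const: "twice_diff (\<lambda>y. c) x"
  by (rule twice_diff_intro[where F="\<lambda>i y. 0"]) auto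

lemma twice_diff_coord: "twice_diff (\<lambda>y. y $ j) x"
  by (rule twice_diff_intro[where F="\<lambda>i y. if i = j then 1 else 0"])
     (auto simp: partial_coord bounded_linear_imp_differentiable[OF bounded_linear_vec_nth])

lemma partial_add_ev:
  assumes "twice_diff f x" "twice_diff g x"
  shows "\<forall>\<^sub>F y in nhds x. partial i (\<lambda>y. f y + g y) y = partial i f y + partial i g y"
  using twice_diff_ev[OF assms(1)] twice_diff_ev[OF assms(2)]
  by eventually_elim (rule partial_add)

lemma partial_diff_ev:
  assumes "twice_diff f x" "twice_diff g x"
  shows "\<forall>\<^sub>F y in nhds x. partial i (\<lambda>y. f y - g y) y = partial i f y - partial i g y"
  using twice_diff_ev[OF assms(1)] twice_diff_ev[OF assms(2)]
  by eventually_elim (rule partial_diff)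

lemma partial_mult_ev:
  assumes "twice_diff f x" "twice_diff g x"
  shows "\<forall>\<^sub>F y in nhds x. partial i (\<lambda>y. f y * g y) y = partial i f y * g y + f y * partial i g y"
  using twice_diff_ev[OF assms(1)] twice_diff_ev[OF assms(2)]
  by eventually_elim (rule partial_mult)

lemma partial2_diff:
  assumes "twice_diff f x" "twice_diff g x"
  shows "partial j (partial i (\<lambda>y. f y - g y)) x = partial j (partial i f) x - partial j (partial i g) x"
  using assms
  by (subst partial_cong_ev[OF partial_diff_ev[OF assms]], subst partial_diff)
     (auto intro: twice_diff_partial)

lemma partial2_mult:
  assumes "twice_diff f x" "twice_diff g x"
  shows "partial j (partial i (\<lambda>y. f y * g y)) x =
    partial j (partial i f) x * g x + partial i f x * partial j g x
    + partial j f x * partial i g x + f x * partial j (partial i g) x"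
proof -
  note d = twice_diff_at[OF assms(1)] twice_diff_at[OF assms(2)]
    twice_diff_partial[OF assms(1)] twice_diff_partial[OF assms(2)]
  show ?thesis
    by (subst partial_cong_ev[OF partial_mult_ev[OF assms]], subst partial_add)
       (auto intro!: differentiable_mult d simp: partial_mult d)
qed

lemma twice_diff_add:
  assumes "twice_diff f x" "twice_diff g x"
  shows "twice_diff (\<lambda>y. f y + g y) x"
proof (rule twice_diff_intro[OF _ partial_add_ev[OF assms]])
  show "\<forall>\<^sub>F y in nhds x. (\<lambda>y. f y + g y) differentiable at y"
    using twice_diff_ev[OF assms(1)] twice_diff_ev[OF assms(2)] by eventually_elim simp
qed (auto simp: partial_add twice_diff_partial[OF assms(1)] twice_diff_partial[OF assms(2)]
    twice_diff_sym[OF assms(1)] twice_diff_sym[OF assms(2)])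

lemma twice_diff_diff:
  assumes "twice_diff f x" "twice_diff g x"
  shows "twice_diff (\<lambda>y. f y - g y) x"
proof (rule twice_diff_intro[OF _ partial_diff_ev[OF assms]])
  show "\<forall>\<^sub>F y in nhds x. (\<lambda>y. f y - g y) differentiable at y"
    using twice_diff_ev[OF assms(1)] twice_diff_ev[OF assms(2)] by eventually_elim simp
qed (auto simp: partial_diff twice_diff_partial[OF assms(1)] twice_diff_partial[OF assms(2)]
    twice_diff_sym[OF assms(1)] twice_diff_sym[OF assms(2)])

lemma twice_diff_mult:
  assumes "twice_diff f x" "twice_diff g x"
  shows "twice_diff (\<lambda>y. f y * g y) x"
proof (rule twice_diff_intro[OF _ partial_mult_ev[OF assms]])
  note d = twice_diff_at[OF assms(1)] twice_diff_at[OF assms(2)]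
    twice_diff_partial[OF assms(1)] twice_diff_partial[OF assms(2)]
  show "\<forall>\<^sub>F y in nhds x. (\<lambda>y. f y * g y) differentiable at y"
    using twice_diff_ev[OF assms(1)] twice_diff_ev[OF assms(2)] by eventually_elim simp
  show "(\<lambda>y. partial i f y * g y + f y * partial i g y) differentiable at x" for i
    using d by simp
  show "partial i (\<lambda>y. partial j f y * g y + f y * partial j g y) x
      = partial j (\<lambda>y. partial i f y * g y + f y * partial i g y) x" for i j
    using twice_diff_sym[OF assms(1), of i j] twice_diff_sym[OF assms(2), of i j]
    by (simp add: d partial_add partial_mult)
qed

lemma twice_diff_sum:
  assumes "finite K" "\<And>k. k \<in> K \<Longrightarrow> twice_diff (f k) x"
  shows "twice_diff (\<lambda>y. \<Sum>k\<in>K. f k y) x"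
  using assms by (induction K rule: finite_induct) (auto intro: twice_diff_const twice_diff_add)

lemma twice_diff_power: "twice_diff f x \<Longrightarrow> twice_diff (\<lambda>y. f y ^ k) x"
  by (induction k) (auto intro: twice_diff_const twice_diff_mult)

text \<open>The conditions on \<open>\<phi>\<close> are local at \<open>f x\<close>, which admits
  the reciprocal and the square root.\<close>

lemma twice_diff_compose:
  assumes f: "twice_diff f x"
    and d1: "\<forall>\<^sub>F t in nhds (f x). (\<phi> has_real_derivative \<phi>1 t) (at t)"
    and d2: "(\<phi>1 has_real_derivative d) (at (f x))"
  shows "twice_diff (\<lambda>y. \<phi> (f y)) x"
proof -
  have "filterlim f (nhds (f x)) (nhds x)"
    using differentiable_imp_continuous_within[OF twice_diff_at[OF f]]
    by (simp add: continuous_within tendsto_at_iff_tendsto_nhds)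
  then have ev: "\<forall>\<^sub>F y in nhds x. (\<phi> has_real_derivative \<phi>1 (f y)) (at (f y))"
    using d1 unfolding filterlim_iff by blast
  show ?thesis
  proof (rule twice_diff_intro[where F="\<lambda>i y. \<phi>1 (f y) * partial i f y"])
    show "\<forall>\<^sub>F y in nhds x. (\<lambda>y. \<phi> (f y)) differentiable at y"
      using ev twice_diff_ev[OF f] by eventually_elim (rule differentiable_chain_real)
    show "\<forall>\<^sub>F y in nhds x. partial i (\<lambda>y. \<phi> (f y)) y = \<phi>1 (f y) * partial i f y" for i
      using ev twice_diff_ev[OF f] by eventually_elim (rule partial_chain)
    note c = differentiable_chain_real[OF twice_diff_at[OF f] d2]
    show "(\<lambda>y. \<phi>1 (f y) * partial i f y) differentiable at x" for i
      by (intro differentiable_mult c twice_diff_partial[OF f])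
    show "partial i (\<lambda>y. \<phi>1 (f y) * partial j f y) x = partial j (\<lambda>y. \<phi>1 (f y) * partial i f y) x"
      for i j
      by (simp add: partial_mult c twice_diff_partial[OF f] partial_chain[OF twice_diff_at[OF f] d2]
          twice_diff_sym[OF f, of i j])
  qed
qed

lemma partial_lpart_ev:
  assumes "\<forall>\<^sub>F y in nhds (lpart x). f differentiable (at y)"
  shows "\<forall>\<^sub>F y in nhds x. partial (Inl i) (\<lambda>y. f (lpart y)) y = partial i f (lpart y)"
    and "\<forall>\<^sub>F y in nhds x. partial (Inr j) (\<lambda>y. f (lpart y)) y = 0"
proof -
  have "\<forall>\<^sub>F y in nhds x. f differentiable (at (lpart y))"
    using assms tendsto_lpart unfolding filterlim_iff by blast
  then show "\<forall>\<^sub>F y in nhds x. partial (Inl i) (\<lambda>y. f (lpart y)) y = partial i f (lpart y)"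
    "\<forall>\<^sub>F y in nhds x. partial (Inr j) (\<lambda>y. f (lpart y)) y = 0"
    by (eventually_elim, simp add: partial_lpart)+
qed

lemma partial_rpart_ev:
  assumes "\<forall>\<^sub>F y in nhds (rpart x). f differentiable (at y)"
  shows "\<forall>\<^sub>F y in nhds x. partial (Inr i) (\<lambda>y. f (rpart y)) y = partial i f (rpart y)"
    and "\<forall>\<^sub>F y in nhds x. partial (Inl j) (\<lambda>y. f (rpart y)) y = 0"
proof -
  have "\<forall>\<^sub>F y in nhds x. f differentiable (at (rpart y))"
    using assms tendsto_rpart unfolding filterlim_iff by blast
  then show "\<forall>\<^sub>F y in nhds x. partial (Inr i) (\<lambda>y. f (rpart y)) y = partial i f (rpart y)"
    "\<forall>\<^sub>F y in nhds x. partial (Inl j) (\<lambda>y. f (rpart y)) y = 0"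
    by (eventually_elim, simp add: partial_rpart)+
qed

lemma twice_diff_lpart:
  fixes x :: "real^('a::finite + 'b::finite)"
  assumes f: "twice_diff f (lpart x)"
  shows "twice_diff (\<lambda>y. f (lpart y)) x"
    and "partial (Inl a) (partial (Inl b) (\<lambda>y. f (lpart y))) x = partial a (partial b f) (lpart x)"
    and "partial i (partial (Inr c) (\<lambda>y. f (lpart y))) x = 0"
    and "partial (Inr c) (partial i (\<lambda>y. f (lpart y))) x = 0"
proof -
  note ev = partial_lpart_ev[OF twice_diff_ev[OF f]]
  note p = differentiable_lpart[OF twice_diff_partial[OF f]]
  define F where "F i y = (case i of Inl a \<Rightarrow> partial a f (lpart y) | Inr b \<Rightarrow> 0)"
    for i :: "'a + 'b" and y :: "real^('a + 'b)"
  have *: "partial (Inl a) (partial (Inl b) (\<lambda>y. f (lpart y))) x = partial a (partial b f) (lpart x)"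
    for a b
    by (subst partial_cong_ev[OF ev(1)]) (rule partial_lpart(1)[OF twice_diff_partial[OF f]])
  have **: "partial i (partial (Inr c) (\<lambda>y. f (lpart y))) x = 0" for i c
    by (subst partial_cong_ev[OF ev(2)]) simp
  have evF: "\<forall>\<^sub>F y in nhds x. partial i (\<lambda>y. f (lpart y)) y = F i y" for i
    using ev by (cases i) (simp_all add: F_def)
  have pF: "partial i (F j) x = (case (i, j) of (Inl a, Inl b) \<Rightarrow> partial a (partial b f) (lpart x) | _ \<Rightarrow> 0)"
    for i j
    by (cases i; cases j)
       (simp_all add: F_def[abs_def] partial_lpart twice_diff_partial[OF f])
  show "twice_diff (\<lambda>y. f (lpart y)) x"
  proof (rule twice_diff_intro[OF _ evF])
    have "\<forall>\<^sub>F y in nhds x. f differentiable (at (lpart y))"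
      using twice_diff_ev[OF f] tendsto_lpart unfolding filterlim_iff by blast
    then show "\<forall>\<^sub>F y in nhds x. (\<lambda>y. f (lpart y)) differentiable at y"
      by eventually_elim (rule differentiable_lpart)
    show "F i differentiable at x" for i
      using p by (cases i) (simp_all add: F_def[abs_def])
    show "partial i (F j) x = partial j (F i) x" for i j
      unfolding pF by (cases i; cases j) (simp_all add: twice_diff_sym[OF f])
  qed
  from twice_diff_sym[OF this] **
  show "partial (Inr c) (partial i (\<lambda>y. f (lpart y))) x = 0" by metis
  show "partial (Inl a) (partial (Inl b) (\<lambda>y. f (lpart y))) x = partial a (partial b f) (lpart x)"
    by (rule * )
  show "partial i (partial (Inr c) (\<lambda>y. f (lpart y))) x = 0" by (rule ** )
qed

lemma twice_diff_rpart:
  fixes x :: "real^('a::finite + 'b::finite)"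
  assumes f: "twice_diff f (rpart x)"
  shows "twice_diff (\<lambda>y. f (rpart y)) x"
    and "partial (Inr a) (partial (Inr b) (\<lambda>y. f (rpart y))) x = partial a (partial b f) (rpart x)"
    and "partial i (partial (Inl c) (\<lambda>y. f (rpart y))) x = 0"
    and "partial (Inl c) (partial i (\<lambda>y. f (rpart y))) x = 0"
proof -
  note ev = partial_rpart_ev[OF twice_diff_ev[OF f]]
  note p = differentiable_rpart[OF twice_diff_partial[OF f]]
  define F where "F i y = (case i of Inr a \<Rightarrow> partial a f (rpart y) | Inl b \<Rightarrow> 0)"
    for i :: "'a + 'b" and y :: "real^('a + 'b)"
  have *: "partial (Inr a) (partial (Inr b) (\<lambda>y. f (rpart y))) x = partial a (partial b f) (rpart x)"
    for a b
    by (subst partial_cong_ev[OF ev(1)]) (rule partial_rpart(1)[OF twice_diff_partial[OF f]])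
  have **: "partial i (partial (Inl c) (\<lambda>y. f (rpart y))) x = 0" for i c
    by (subst partial_cong_ev[OF ev(2)]) simp
  have evF: "\<forall>\<^sub>F y in nhds x. partial i (\<lambda>y. f (rpart y)) y = F i y" for i
    using ev by (cases i) (simp_all add: F_def)
  have pF: "partial i (F j) x = (case (i, j) of (Inr a, Inr b) \<Rightarrow> partial a (partial b f) (rpart x) | _ \<Rightarrow> 0)"
    for i j
    by (cases i; cases j)
       (simp_all add: F_def[abs_def] partial_rpart twice_diff_partial[OF f])
  show "twice_diff (\<lambda>y. f (rpart y)) x"
  proof (rule twice_diff_intro[OF _ evF])
    have "\<forall>\<^sub>F y in nhds x. f differentiable (at (rpart y))"
      using twice_diff_ev[OF f] tendsto_rpart unfolding filterlim_iff by blast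
    then show "\<forall>\<^sub>F y in nhds x. (\<lambda>y. f (rpart y)) differentiable at y"
      by eventually_elim (rule differentiable_rpart)
    show "F i differentiable at x" for i
      using p by (cases i) (simp_all add: F_def[abs_def])
    show "partial i (F j) x = partial j (F i) x" for i j
      unfolding pF by (cases i; cases j) (simp_all add: twice_diff_sym[OF f])
  qed
  from twice_diff_sym[OF this] **
  show "partial (Inl c) (partial i (\<lambda>y. f (rpart y))) x = 0" by metis
  show "partial (Inr a) (partial (Inr b) (\<lambda>y. f (rpart y))) x = partial a (partial b f) (rpart x)"
    by (rule * )
  show "partial i (partial (Inl c) (\<lambda>y. f (rpart y))) x = 0" by (rule ** )
qed

section \<open>Smooth functions and the symmetry of second partials\<close>

lemma smooth_on_partial: "smooth_on U f \<Longrightarrow> smooth_on U (partial i f)"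
proof -
  assume "smooth_on U f"
  then have "Ck_on (Suc k) U f" for k by (simp add: smooth_on_def)
  then show ?thesis
    by (auto simp: smooth_on_def partial_def[abs_def] axis_in_Basis_iff)
qed

lemma smooth_on_differentiable: "smooth_on U f \<Longrightarrow> x \<in> U \<Longrightarrow> f differentiable (at x)"
proof -
  assume "smooth_on U f" "x \<in> U"
  then have "Ck_on (Suc 0) U f" by (simp only: smooth_on_def)
  then show ?thesis using \<open>x \<in> U\<close> by simp
qed

lemma smooth_on_continuous_on: "smooth_on U f \<Longrightarrow> continuous_on U f"
  by (metis smooth_on_def Ck_on.simps(1))

lemma partial_line_derivative:
  fixes f :: "real^'n::finite \<Rightarrow> real"
  assumes "f differentiable (at (p + t *\<^sub>R axis i 1))"
  shows "((\<lambda>t. f (p + t *\<^sub>R axis i 1)) has_real_derivative partial i f (p + t *\<^sub>R axis i 1)) (at t)"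
proof -
  note d = assms[unfolded frechet_derivative_works]
  have e: "((\<lambda>t. p + t *\<^sub>R axis i 1) has_derivative (\<lambda>h. h *\<^sub>R axis i 1)) (at t)"
    by (auto intro!: derivative_eq_intros)
  have "frechet_derivative f (at (p + t *\<^sub>R axis i 1)) (h *\<^sub>R axis i 1)
      = partial i f (p + t *\<^sub>R axis i 1) * h" for h
    using linear_cmul[OF linear_frechet_derivative[OF assms]] by (simp add: partial_def)
  with has_derivative_compose[OF e d] show ?thesis
    by (simp add: has_field_derivative_def)
qed

text \<open>The second difference over a square of side \<open>h\<close> does not change when
  \<open>i\<close> and \<open>j\<close> are exchanged. Two applications of the mean value theorem
  turn it into a mixed partial, and their order decides which one; \<open>partial_commute\<close>
  compares the two.\<close>

lemma second_difference_mvt: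
  fixes f :: "real^'n::finite \<Rightarrow> real"
  assumes d1: "\<And>y. y \<in> ball x d \<Longrightarrow> f differentiable (at y)"
    and d2: "\<And>y. y \<in> ball x d \<Longrightarrow> partial i f differentiable (at y)"
    and h: "0 < h" "2 * h < d"
  shows "\<exists>y\<in>ball x (2 * h). f (x + h *\<^sub>R axis i 1 + h *\<^sub>R axis j 1) - f (x + h *\<^sub>R axis i 1)
      - f (x + h *\<^sub>R axis j 1) + f x = h\<^sup>2 * partial j (partial i f) y"
proof -
  have near: "x + s *\<^sub>R axis i 1 + t *\<^sub>R axis j 1 \<in> ball x d"
    if "0 \<le> s" "s \<le> h" "0 \<le> t" "t \<le> h" for s t
  proof -
    have "norm (s *\<^sub>R axis i (1::real) + t *\<^sub>R axis j 1) \<le> s + t"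
      using that by (intro order_trans[OF norm_triangle_ineq]) simp
    also have "\<dots> < d" using that h by simp
    finally show ?thesis
      unfolding mem_ball dist_norm add.assoc by (subst norm_minus_commute) simp
  qed
  have near2: "x + s *\<^sub>R axis i 1 + t *\<^sub>R axis j 1 \<in> ball x (2*h)"
    if "0 < s" "s < h" "0 < t" "t < h" for s t
  proof -
    have "norm (s *\<^sub>R axis i (1::real) + t *\<^sub>R axis j 1) \<le> s + t"
      using that by (intro order_trans[OF norm_triangle_ineq]) simp
    also have "\<dots> < 2 * h" using that by simp
    finally show ?thesis
      unfolding mem_ball dist_norm add.assoc by (subst norm_minus_commute) simp
  qed
  \<comment> \<open>\<open>\<phi>\<close> is the increment of \<open>f\<close> over a step
    \<open>h\<close> along \<open>axis j\<close>; its own increment from 0 to \<open>h\<close> is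
    the second difference.\<close>
  define \<phi> where "\<phi> s = f (x + h *\<^sub>R axis j 1 + s *\<^sub>R axis i 1) - f (x + s *\<^sub>R axis i 1)" for s
  define \<phi>' where "\<phi>' s = partial i f (x + h *\<^sub>R axis j 1 + s *\<^sub>R axis i 1) - partial i f (x + s *\<^sub>R axis i 1)" for s
  have D: "(\<phi> has_real_derivative \<phi>' s) (at s)" if "0 \<le> s" "s \<le> h" for s
    unfolding \<phi>_def \<phi>'_def
    by (intro DERIV_diff partial_line_derivative d1)
       (use near[of s h] near[of s 0] that h in \<open>simp_all add: algebra_simps\<close>)
  obtain s where s: "0 < s" "s < h" "\<phi> h - \<phi> 0 = (h - 0) * \<phi>' s"
    using MVT2[OF h(1) D] by auto
  have "((\<lambda>t. partial i f (x + s *\<^sub>R axis i 1 + t *\<^sub>R axis j 1)) has_real_derivative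
      partial j (partial i f) (x + s *\<^sub>R axis i 1 + t *\<^sub>R axis j 1)) (at t)"
    if "0 \<le> t" "t \<le> h" for t
    by (intro partial_line_derivative d2) (use near[of s t] that s in simp)
  from MVT2[OF h(1) this]
  obtain t where t: "0 < t" "t < h"
    "partial i f (x + s *\<^sub>R axis i 1 + h *\<^sub>R axis j 1) - partial i f (x + s *\<^sub>R axis i 1 + 0 *\<^sub>R axis j 1)
      = (h - 0) * partial j (partial i f) (x + s *\<^sub>R axis i 1 + t *\<^sub>R axis j 1)" by blast
  have "\<phi>' s = h * partial j (partial i f) (x + s *\<^sub>R axis i 1 + t *\<^sub>R axis j 1)"
    using t(3) by (simp add: \<phi>'_def algebra_simps)
  with s(3) have "\<phi> h - \<phi> 0 = h\<^sup>2 * partial j (partial i f) (x + s *\<^sub>R axis i 1 + t *\<^sub>R axis j 1)"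
    by (simp add: power2_eq_square)
  then show ?thesis
    using near2[OF s(1,2) t(1,2)] unfolding \<phi>_def by (intro bexI) (simp_all add: algebra_simps)
qed

text \<open>By \<open>second_difference_mvt\<close> the two mixed partials take a common value, at
  possibly different points close to \<open>x\<close>. Each is there within half the supposed gap of
  its value at \<open>x\<close>, which contradicts the gap.\<close>

lemma partial_commute:
  fixes f :: "real^'n::finite \<Rightarrow> real"
  assumes "open U" "x \<in> U"
    and d1: "\<And>y. y \<in> U \<Longrightarrow> f differentiable (at y)"
    and d2: "\<And>y i. y \<in> U \<Longrightarrow> partial i f differentiable (at y)"
    and c: "\<And>i j. continuous_on U (partial j (partial i f))"
  shows "partial j (partial i f) x = partial i (partial j f) x"
proof (rule ccontr)
  let ?A = "partial j (partial i f)" and ?B = "partial i (partial j f)"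
  assume "?A x \<noteq> ?B x"
  define e where "e = \<bar>?A x - ?B x\<bar> / 2"
  have e: "e > 0" using \<open>?A x \<noteq> ?B x\<close> by (simp add: e_def)
  have "isCont ?A x" "isCont ?B x"
    using c assms(1,2) by (simp_all add: continuous_on_eq_continuous_at)
  then obtain d1' d2' where d': "d1' > 0" "d2' > 0"
    "\<And>y. dist y x < d1' \<Longrightarrow> dist (?A y) (?A x) < e"
    "\<And>y. dist y x < d2' \<Longrightarrow> dist (?B y) (?B x) < e"
    using e unfolding continuous_at_eps_delta by metis
  obtain d where d: "d > 0" "ball x d \<subseteq> U"
    using assms(1,2) open_contains_ball by blast
  \<comment> \<open>Division by 3 keeps \<open>2 * h\<close>, the radius in
    \<open>second_difference_mvt\<close>, strictly below all three radii.\<close>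
  define h where "h = min d (min d1' d2') / 3"
  have h: "h > 0" "2 * h < d" "2 * h < d1'" "2 * h < d2'"
    using d(1) d'(1,2) by (auto simp: h_def)
  obtain y where y: "y \<in> ball x (2 * h)" "f (x + h *\<^sub>R axis i 1 + h *\<^sub>R axis j 1) - f (x + h *\<^sub>R axis i 1)
      - f (x + h *\<^sub>R axis j 1) + f x = h\<^sup>2 * ?A y"
    using second_difference_mvt[of x d f i h j] d1 d2 d(2) h by blast
  obtain z where z: "z \<in> ball x (2 * h)" "f (x + h *\<^sub>R axis j 1 + h *\<^sub>R axis i 1) - f (x + h *\<^sub>R axis j 1)
      - f (x + h *\<^sub>R axis i 1) + f x = h\<^sup>2 * ?B z"
    using second_difference_mvt[of x d f j h i] d1 d2 d(2) h by blast
  have "h\<^sup>2 * ?A y = h\<^sup>2 * ?B z"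
    using y(2) z(2) by (simp add: algebra_simps)
  then have "?A y = ?B z" using h by simp
  moreover have "dist (?A y) (?A x) < e" "dist (?B z) (?B x) < e"
    using d'(3)[of y] d'(4)[of z] y(1) z(1) h by (auto simp: dist_commute)
  moreover have "2 * e \<le> dist (?A y) (?A x) + dist (?B z) (?B x)"
    using \<open>?A y = ?B z\<close> by (simp add: e_def dist_real_def)
  ultimately show False by linarith
qed

text \<open>\<open>L\<close> will be a coordinate projection: metrics and parametrizations have
  vector values, while \<open>twice_diff\<close> concerns real functions. The second claim brings
  the symmetry of second partials back to vectors, coordinate by coordinate.\<close>

lemma smooth_on_linear_twice_diff:
  fixes f :: "real^'n::finite \<Rightarrow> 'b::real_normed_vector" and L :: "'b \<Rightarrow> real"
  assumes "open U" "x \<in> U" "smooth_on U f" "bounded_linear L"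
  shows "twice_diff (\<lambda>y. L (f y)) x"
    and "partial i (partial j (\<lambda>y. L (f y))) x = L (partial i (partial j f) x)"
proof -
  have s1: "smooth_on U (partial i f)" for i by (rule smooth_on_partial[OF assms(3)])
  have s2: "smooth_on U (partial j (partial i f))" for i j by (rule smooth_on_partial[OF s1])
  note D = smooth_on_differentiable
  have evU: "\<forall>\<^sub>F z in nhds y. z \<in> U" if "y \<in> U" for y
    using assms(1) that by (simp add: eventually_nhds_in_open)
  have bl: "(\<lambda>y. L (g y)) differentiable (at y)"
    if "g differentiable (at y)" for g :: "real^'n \<Rightarrow> 'b" and y
    using differentiable_compose[OF bounded_linear_imp_differentiable[OF assms(4)] that] .
  have p1: "partial i (\<lambda>y. L (f y)) y = L (partial i f y)" if "y \<in> U" for i y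
    by (rule partial_linear[OF assms(4) D[OF assms(3) that]])
  have ev1: "\<forall>\<^sub>F z in nhds y. partial i (\<lambda>y. L (f y)) z = L (partial i f z)" if "y \<in> U" for i y
    using evU[OF that] by eventually_elim (rule p1)
  have p2: "partial j (partial i (\<lambda>y. L (f y))) y = L (partial j (partial i f) y)" if "y \<in> U" for i j y
    by (subst partial_cong_ev[OF ev1[OF that]]) (rule partial_linear[OF assms(4) D[OF s1 that]])
  show "partial i (partial j (\<lambda>y. L (f y))) x = L (partial i (partial j f) x)"
    by (rule p2[OF assms(2)])
  have dd: "partial i (\<lambda>y. L (f y)) differentiable (at y)" if "y \<in> U" for i y
  proof (rule differentiable_cong_ev[OF _ bl[OF D[OF s1 that]]])
    show "\<forall>\<^sub>F z in nhds y. L (partial i f z) = partial i (\<lambda>y. L (f y)) z"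
      using ev1[OF that, of i] by eventually_elim simp
  qed
  have "partial j (partial i (\<lambda>y. L (f y))) x = partial i (partial j (\<lambda>y. L (f y))) x" for i j
  proof (rule partial_commute[OF assms(1,2)])
    show "(\<lambda>y. L (f y)) differentiable at y" if "y \<in> U" for y
      by (rule bl[OF D[OF assms(3) that]])
    show "continuous_on U (partial j (partial i (\<lambda>y. L (f y))))" for i j
      by (rule continuous_on_eq[OF bounded_linear.continuous_on[OF assms(4)
          smooth_on_continuous_on[OF s2[of j i]]]]) (simp add: p2)
  qed (rule dd)
  moreover have "\<forall>\<^sub>F y in nhds x. (\<lambda>y. L (f y)) differentiable at y"
    using evU[OF assms(2)] by eventually_elim (rule bl[OF D[OF assms(3)]])
  ultimately show "twice_diff (\<lambda>y. L (f y)) x"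
    using dd[OF assms(2)] unfolding twice_diff_def by blast
qed

section \<open>The Riemann tensor with all indices lowered\<close>

lemma symmetric_nth: "transpose A = A \<Longrightarrow> A $ i $ j = A $ j $ i"
  by (drule arg_cong[of _ _ "\<lambda>M. M $ i $ j"]) (simp add: transpose_def)

lemma matrix_inv_invertible:
  fixes A :: "real^'n::finite^'n"
  assumes "invertible A"
  shows "A ** matrix_inv A = mat 1" "matrix_inv A ** A = mat 1"
  using someI_ex[OF assms[unfolded invertible_def]] unfolding matrix_inv_def by auto

lemma ginv_right:
  assumes "invertible (g x)"
  shows "(\<Sum>m\<in>UNIV. g x $ i $ m * ginv g x m j) = (if i = j then 1 else 0)"
  using matrix_inv_invertible(1)[OF assms]
  unfolding ginv_def by (auto simp: vec_eq_iff matrix_matrix_mult_def mat_def)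

lemma ginv_left:
  assumes "invertible (g x)"
  shows "(\<Sum>m\<in>UNIV. ginv g x i m * g x $ m $ j) = (if i = j then 1 else 0)"
  using matrix_inv_invertible(2)[OF assms]
  unfolding ginv_def by (auto simp: vec_eq_iff matrix_matrix_mult_def mat_def)

text \<open>A one-sided inverse of a square matrix is two-sided, so a guessed formula for the
  inverse metric is verified by a single product. \<open>ginv_W\<close> and \<open>vr_ginv\<close>
  are obtained in this way.\<close>

lemma ginv_unique:
  assumes "\<And>i j. (\<Sum>m\<in>UNIV. B i m * g x $ m $ j) = (if i = j then 1 else 0)"
  shows "invertible (g x)" "ginv g x i j = B i j"
proof -
  define C :: "real^'a^'a" where "C = (\<chi> i j. B i j)"
  have 1: "C ** g x = mat 1"
    using assms by (simp add: vec_eq_iff matrix_matrix_mult_def mat_def C_def)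
  then show inv: "invertible (g x)"
    using invertible_left_inverse by blast
  have "C = C ** (g x ** matrix_inv (g x))"
    by (simp add: matrix_inv_invertible[OF inv])
  also have "\<dots> = matrix_inv (g x)"
    by (simp add: matrix_mul_assoc 1)
  finally have "matrix_inv (g x) = C" by (rule sym)
  then show "ginv g x i j = B i j"
    by (simp add: ginv_def C_def)
qed

lemma ginv_sym:
  assumes "invertible (g x)" "transpose (g x) = g x"
  shows "ginv g x i j = ginv g x j i"
proof -
  have "g x $ m $ j = g x $ j $ m" for m j
    using assms(2) by (rule symmetric_nth)
  then have "(\<Sum>m\<in>UNIV. ginv g x m i * g x $ m $ j) = (if i = j then 1 else 0)" for i j
    using ginv_right[of g x, OF assms(1), of j i] by (simp add: mult.commute eq_commute)
  from ginv_unique(2)[of "\<lambda>i j. ginv g x j i" g x, OF this] show ?thesis .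
qed

lemma det_differentiable:
  fixes A :: "'a::real_normed_vector \<Rightarrow> real^'n::finite^'n"
  assumes "\<And>i j. (\<lambda>y. A y $ i $ j) differentiable (at x)"
  shows "(\<lambda>y. det (A y)) differentiable (at x)"
proof -
  have "(\<lambda>y. \<Prod>i\<in>UNIV. A y $ i $ p i) differentiable (at x)" for p
    unfolding differentiable_def
    by (rule exI, rule has_derivative_prod, rule assms[unfolded frechet_derivative_works])
  then show ?thesis unfolding det_def by simp
qed

lemma invertible_eventually:
  fixes g :: "real^'n::finite \<Rightarrow> real^'n^'n"
  assumes "\<And>i j. (\<lambda>y. g y $ i $ j) differentiable (at x)" "invertible (g x)"
  shows "\<forall>\<^sub>F y in nhds x. invertible (g y)"
proof -
  have "isCont (\<lambda>y. det (g y)) x"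
    using det_differentiable[OF assms(1)] by (rule differentiable_imp_continuous_within)
  moreover have "det (g x) \<noteq> 0" using assms(2) by (simp add: invertible_det_nz)
  ultimately have "\<forall>\<^sub>F y in at x. det (g y) \<noteq> 0"
    unfolding isCont_def by (rule tendsto_imp_eventually_ne)
  then show ?thesis using assms(2)
    by (auto simp: eventually_nhds_conv_at invertible_det_nz)
qed

text \<open>Cramer's rule: \<open>N y\<close> is \<open>g y\<close> with column \<open>k\<close>
  replaced by \<open>axis j\<close>, and both determinants are polynomials in differentiable
  entries.\<close>

lemma ginv_differentiable:
  fixes g :: "real^'n::finite \<Rightarrow> real^'n^'n"
  assumes d: "\<And>i j. (\<lambda>y. g y $ i $ j) differentiable (at x)" and inv: "invertible (g x)"
  shows "(\<lambda>y. ginv g y k j) differentiable (at x)"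
proof -
  define N where "N y = (\<chi> i l. if l = k then axis j 1 $ i else g y $ i $ l)" for y
  have "ginv g y k j = det (N y) / det (g y)" if "invertible (g y)" for y
  proof -
    have "g y *v column j (matrix_inv (g y)) = axis j 1"
      using ginv_right[of g y, OF that]
      by (auto simp: vec_eq_iff matrix_vector_mult_def column_def ginv_def axis_def)
    then have "column j (matrix_inv (g y)) =
        (\<chi> k. det (\<chi> i l. if l = k then axis j 1 $ i else g y $ i $ l) / det (g y))"
      using that cramer invertible_det_nz by blast
    then show ?thesis
      by (metis (no_types, lifting) N_def column_def ginv_def vec_lambda_beta)
  qed
  then have ev: "\<forall>\<^sub>F y in nhds x. det (N y) / det (g y) = ginv g y k j"
    using invertible_eventually[OF assms] by (auto elim: eventually_mono)
  have "(\<lambda>y. N y $ i $ l) differentiable (at x)" for i l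
    unfolding N_def using d by (cases "l = k") simp_all
  then have "(\<lambda>y. det (N y) / det (g y)) differentiable (at x)"
    using det_differentiable d inv by (intro differentiable_divide) (auto simp: invertible_det_nz)
  then show ?thesis by (rule differentiable_cong_ev[OF ev])
qed

text \<open>Symmetry is asked for near \<open>x\<close> because it gets differentiated twice;
  invertibility spreads from \<open>x\<close> to a neighbourhood by continuity of the determinant
  (\<open>invertible_eventually\<close>).\<close>

definition metric_germ :: "(real^'n::finite \<Rightarrow> real^'n^'n) \<Rightarrow> real^'n \<Rightarrow> bool" where
  "metric_germ g x \<longleftrightarrow> (\<forall>i j. twice_diff (\<lambda>y. g y $ i $ j) x) \<and>
     (\<forall>\<^sub>F y in nhds x. transpose (g y) = g y) \<and> invertible (g x)"

text \<open>Christoffel symbols of the first kind.\<close>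

definition chris_low ::
  "(real^'n::finite \<Rightarrow> real^'n^'n) \<Rightarrow> 'n \<Rightarrow> 'n \<Rightarrow> 'n \<Rightarrow> real^'n \<Rightarrow> real" where
  "chris_low g r i j y = (1/2) * (partial i (\<lambda>y. g y $ r $ j) y + partial j (\<lambda>y. g y $ r $ i) y
     - partial r (\<lambda>y. g y $ i $ j) y)"

lemma christoffel_eq: "christoffel g l i j y = (\<Sum>m\<in>UNIV. ginv g y l m * chris_low g m i j y)"
  by (simp add: christoffel_def chris_low_def sum_distrib_left algebra_simps)

lemma metric_germ_symE:
  assumes "metric_germ g x"
  shows "g x $ i $ j = g x $ j $ i"
    and "\<forall>\<^sub>F y in nhds x. g y $ i $ j = g y $ j $ i"
    and "partial k (\<lambda>y. g y $ i $ j) x = partial k (\<lambda>y. g y $ j $ i) x"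
    and "partial l (partial k (\<lambda>y. g y $ i $ j)) x = partial l (partial k (\<lambda>y. g y $ j $ i)) x"
    and "ginv g x i j = ginv g x j i"
proof -
  have t: "\<forall>\<^sub>F y in nhds x. transpose (g y) = g y" using assms by (simp add: metric_germ_def)
  then show ev: "\<forall>\<^sub>F y in nhds x. g y $ i $ j = g y $ j $ i"
    by eventually_elim (rule symmetric_nth)
  then show "g x $ i $ j = g x $ j $ i" by (rule eventually_nhds_x_imp_x)
  show "partial k (\<lambda>y. g y $ i $ j) x = partial k (\<lambda>y. g y $ j $ i) x"
    by (rule partial_cong_ev[OF ev])
  show "partial l (partial k (\<lambda>y. g y $ i $ j)) x = partial l (partial k (\<lambda>y. g y $ j $ i)) x"
    by (rule partial_cong_ev[OF partial_cong_eventually[OF ev]])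
  show "ginv g x i j = ginv g x j i"
    using eventually_nhds_x_imp_x[OF t] assms by (intro ginv_sym) (simp_all add: metric_germ_def)
qed

lemma chris_low_sym: "metric_germ g x \<Longrightarrow> chris_low g r i j x = chris_low g r j i x"
  by (simp add: chris_low_def metric_germ_symE(3)[of g x r i j])

text \<open>This is the compatibility of the Levi-Civita connection with the metric, written with
  first-kind symbols.\<close>

lemma partial_metric_eq:
  assumes "metric_germ g x"
  shows "partial m (\<lambda>y. g y $ r $ p) x = chris_low g r m p x + chris_low g p m r x"
  using metric_germ_symE(3)[OF assms, of _ r p] metric_germ_symE(3)[OF assms, of _ m r]
    metric_germ_symE(3)[OF assms, of _ m p]
  by (simp add: chris_low_def field_simps)

lemma partial_chris_low:
  assumes "metric_germ g x"
  shows "chris_low g r i j differentiable (at x)"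
    and "partial k (chris_low g r i j) x = (1/2) * (partial k (partial i (\<lambda>y. g y $ r $ j)) x
      + partial k (partial j (\<lambda>y. g y $ r $ i)) x - partial k (partial r (\<lambda>y. g y $ i $ j)) x)"
proof -
  have d: "partial i (\<lambda>y. g y $ k $ j) differentiable (at x)" for i j k
    using assms by (auto simp: metric_germ_def intro: twice_diff_partial)
  show "chris_low g r i j differentiable (at x)"
    unfolding chris_low_def[abs_def] by (intro derivative_intros d)
  show "partial k (chris_low g r i j) x = (1/2) * (partial k (partial i (\<lambda>y. g y $ r $ j)) x
      + partial k (partial j (\<lambda>y. g y $ r $ i)) x - partial k (partial r (\<lambda>y. g y $ i $ j)) x)"
    unfolding chris_low_def[abs_def]
    by (subst partial_mult) (simp_all add: partial_add partial_diff d)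
qed

lemma sum_mult_delta:
  fixes f :: "'n::finite \<Rightarrow> real"
  shows "(\<Sum>p\<in>UNIV. (if i = p then 1 else 0) * f p) = f i"
    "(\<Sum>p\<in>UNIV. (if p = i then 1 else 0) * f p) = f i"
    "(\<Sum>p\<in>UNIV. f p * (if i = p then 1 else 0)) = f i"
    "(\<Sum>p\<in>UNIV. f p * (if p = i then 1 else 0)) = f i"
  by (simp_all add: if_distrib[where f="\<lambda>c. c * _"] if_distrib[where f="\<lambda>c. _ * c"] cong: if_cong)

lemma lower_raised:
  assumes "invertible (g x)"
  shows "(\<Sum>l\<in>UNIV. g x $ r $ l * (\<Sum>m\<in>UNIV. ginv g x l m * f m)) = f r"
proof -
  have "(\<Sum>l\<in>UNIV. g x $ r $ l * (\<Sum>m\<in>UNIV. ginv g x l m * f m))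
      = (\<Sum>m\<in>UNIV. (\<Sum>l\<in>UNIV. g x $ r $ l * ginv g x l m) * f m)"
    unfolding sum_distrib_left sum_distrib_right by (subst sum.swap) (simp add: mult.assoc)
  then show ?thesis by (simp only: ginv_right[of g x, OF assms] sum_mult_delta)
qed

lemma raise_lowered:
  assumes "invertible (g x)"
  shows "(\<Sum>l\<in>UNIV. ginv g x r l * (\<Sum>m\<in>UNIV. g x $ l $ m * f m)) = f r"
proof -
  have "(\<Sum>l\<in>UNIV. ginv g x r l * (\<Sum>m\<in>UNIV. g x $ l $ m * f m))
      = (\<Sum>m\<in>UNIV. (\<Sum>l\<in>UNIV. ginv g x r l * g x $ l $ m) * f m)"
    unfolding sum_distrib_left sum_distrib_right by (subst sum.swap) (simp add: mult.assoc)
  then show ?thesis by (simp only: ginv_left[of g x, OF assms] sum_mult_delta)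
qed

text \<open>Differentiating $g_{rl}\Gamma^l{}_{ns} = \Gamma_{r,ns}$ avoids the derivative of the inverse metric.\<close>

lemma lower_partial_christoffel:
  assumes G: "metric_germ g x"
  shows "(\<Sum>l\<in>UNIV. g x $ r $ l * partial m (christoffel g l n s) x)
    = partial m (chris_low g r n s) x
      - (\<Sum>l\<in>UNIV. partial m (\<lambda>y. g y $ r $ l) x * christoffel g l n s x)"
proof -
  have inv: "invertible (g x)" and td: "\<And>i j. twice_diff (\<lambda>y. g y $ i $ j) x"
    using G by (auto simp: metric_germ_def)
  note dg = twice_diff_at[OF td]
  have dC: "christoffel g l n s differentiable (at x)" for l
    unfolding christoffel_eq[abs_def]
    by (intro derivative_intros ballI finite partial_chris_low[OF G] ginv_differentiable dg inv)
  have "\<forall>\<^sub>F y in nhds x. (\<Sum>l\<in>UNIV. g y $ r $ l * christoffel g l n s y) = chris_low g r n s y"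
    using invertible_eventually[OF dg inv]
    by eventually_elim (simp add: christoffel_eq lower_raised[where g = g])
  from partial_cong_ev[OF this, of m]
  have "partial m (chris_low g r n s) x
      = partial m (\<lambda>y. \<Sum>l\<in>UNIV. g y $ r $ l * christoffel g l n s y) x" by simp
  also have "\<dots> = (\<Sum>l\<in>UNIV. partial m (\<lambda>y. g y $ r $ l) x * christoffel g l n s x
      + g x $ r $ l * partial m (christoffel g l n s) x)"
    by (subst partial_sum) (auto simp: dg dC partial_mult)
  finally show ?thesis by (simp add: sum.distrib)
qed

lemma lower_christoffel_product:
  assumes "invertible (g x)"
  shows "(\<Sum>k\<in>UNIV. g x $ r $ k * (\<Sum>l\<in>UNIV. christoffel g k m l x * c l))
    = (\<Sum>l\<in>UNIV. chris_low g r m l x * c l)"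
proof -
  have "(\<Sum>k\<in>UNIV. g x $ r $ k * (\<Sum>l\<in>UNIV. christoffel g k m l x * c l))
      = (\<Sum>l\<in>UNIV. (\<Sum>k\<in>UNIV. g x $ r $ k * christoffel g k m l x) * c l)"
    unfolding sum_distrib_left sum_distrib_right by (subst sum.swap) (simp add: mult.assoc)
  then show ?thesis by (simp add: christoffel_eq lower_raised[of g x, OF assms])
qed

text \<open>The inverse metric enters the fully lowered Riemann tensor only through this
  contraction.\<close>

definition christoffel_square ::
  "(real^'n::finite \<Rightarrow> real^'n^'n) \<Rightarrow> real^'n \<Rightarrow> 'n \<Rightarrow> 'n \<Rightarrow> 'n \<Rightarrow> 'n \<Rightarrow> real" where
  "christoffel_square g x i j k l =
     (\<Sum>p\<in>UNIV. \<Sum>q\<in>UNIV. ginv g x p q * chris_low g p i j x * chris_low g q k l x)"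

lemma riemann_lowered:
  assumes G: "metric_germ g x"
  shows "riemann g x r s m n = partial m (chris_low g r n s) x - partial n (chris_low g r m s) x
    - christoffel_square g x m r n s + christoffel_square g x n r m s"
proof -
  have inv: "invertible (g x)" using G by (auto simp: metric_germ_def)
  \<comment> \<open>Lowering the index leaves a term with a first partial of \<open>g\<close>.
    \<open>partial_metric_eq\<close> splits it in two: one half cancels the lowered quadratic term,
    the other is a \<open>christoffel_square\<close>.\<close>
  have sq: "(\<Sum>l\<in>UNIV. chris_low g r m l x * christoffel g l n s x)
      - (\<Sum>l\<in>UNIV. partial m (\<lambda>y. g y $ r $ l) x * christoffel g l n s x)
      = - christoffel_square g x m r n s" for m n
  proof -
    have "(\<Sum>l\<in>UNIV. chris_low g r m l x * christoffel g l n s x)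
      - (\<Sum>l\<in>UNIV. partial m (\<lambda>y. g y $ r $ l) x * christoffel g l n s x)
      = - (\<Sum>l\<in>UNIV. chris_low g l m r x * christoffel g l n s x)"
      by (simp add: partial_metric_eq[OF G] algebra_simps sum.distrib)
    also have "\<dots> = - christoffel_square g x m r n s"
      by (simp add: christoffel_square_def christoffel_eq sum_distrib_left algebra_simps)
    finally show ?thesis .
  qed
  have "riemann g x r s m n
      = (\<Sum>l\<in>UNIV. g x $ r $ l * partial m (christoffel g l n s) x)
      - (\<Sum>l\<in>UNIV. g x $ r $ l * partial n (christoffel g l m s) x)
      + (\<Sum>l\<in>UNIV. g x $ r $ l * (\<Sum>k\<in>UNIV. christoffel g l m k x * christoffel g k n s x))
      - (\<Sum>l\<in>UNIV. g x $ r $ l * (\<Sum>k\<in>UNIV. christoffel g l n k x * christoffel g k m s x))"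
    unfolding riemann_def riemann_up_def
    by (simp add: sum.distrib sum_subtractf ring_distribs)
  also have "\<dots> = partial m (chris_low g r n s) x - partial n (chris_low g r m s) x
    - christoffel_square g x m r n s + christoffel_square g x n r m s"
    using sq[of m n] sq[of n m]
    unfolding lower_partial_christoffel[OF G] lower_christoffel_product[of g x, OF inv] by simp
  finally show ?thesis .
qed

section \<open>Symmetries of the lowered Riemann tensor\<close>

lemma christoffel_square_sym:
  assumes G: "metric_germ g x"
  shows "christoffel_square g x i j k l = christoffel_square g x j i k l"
    and "christoffel_square g x i j k l = christoffel_square g x i j l k"
    and "christoffel_square g x i j k l = christoffel_square g x k l i j"
proof -
  show "christoffel_square g x i j k l = christoffel_square g x j i k l"
    and "christoffel_square g x i j k l = christoffel_square g x i j l k"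
    using chris_low_sym[OF G] by (simp_all add: christoffel_square_def)
  show "christoffel_square g x i j k l = christoffel_square g x k l i j"
    unfolding christoffel_square_def
    by (subst sum.swap) (simp add: metric_germ_symE(5)[OF G] mult.assoc mult.left_commute mult.commute)
qed

text \<open>The second partials of the \<open>r\<close>, \<open>s\<close> component cancel because
  mixed partials commute. The symmetries and the blocks of a warped product follow from this form by
  substitution.\<close>

lemma riemann_second_order:
  assumes G: "metric_germ g x"
  shows "riemann g x r s m n =
    (1/2) * (partial m (partial s (\<lambda>y. g y $ r $ n)) x - partial m (partial r (\<lambda>y. g y $ n $ s)) x
      - partial n (partial s (\<lambda>y. g y $ r $ m)) x + partial n (partial r (\<lambda>y. g y $ m $ s)) x)
    - christoffel_square g x m r n s + christoffel_square g x n r m s"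
proof -
  have "partial m (partial n (\<lambda>y. g y $ r $ s)) x = partial n (partial m (\<lambda>y. g y $ r $ s)) x"
    using G by (auto simp: metric_germ_def intro: twice_diff_sym)
  then show ?thesis
    unfolding riemann_lowered[OF G] partial_chris_low[OF G] by (simp add: field_simps)
qed

lemma riemann_antisym2: "metric_germ g x \<Longrightarrow> riemann g x r s n m = - riemann g x r s m n"
  by (simp add: riemann_lowered)

lemma riemann_antisym1:
  assumes G: "metric_germ g x"
  shows "riemann g x s r m n = - riemann g x r s m n"
proof -
  have c: "partial a (partial b (\<lambda>y. g y $ i $ j)) x = partial b (partial a (\<lambda>y. g y $ i $ j)) x"
    for a b i j using G by (auto simp: metric_germ_def intro: twice_diff_sym)
  show ?thesis
    unfolding riemann_second_order[OF G]
    using christoffel_square_sym[OF G] metric_germ_symE(4)[OF G]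
    by (simp add: c field_simps)
qed

lemma riemann_bianchi:
  assumes G: "metric_germ g x"
  shows "riemann g x r s m n + riemann g x r m n s + riemann g x r n s m = 0"
proof -
  have c: "partial a (partial b (\<lambda>y. g y $ i $ j)) x = partial b (partial a (\<lambda>y. g y $ i $ j)) x"
    for a b i j using G by (auto simp: metric_germ_def intro: twice_diff_sym)
  show ?thesis
    unfolding riemann_second_order[OF G]
    using christoffel_square_sym[OF G] metric_germ_symE(4)[OF G]
    by (simp add: c field_simps)
qed

text \<open>The octahedron argument: the claim is a linear combination of four cyclically shifted
  Bianchi identities, modulo the two antisymmetries.\<close>

lemma riemann_pair_sym:
  assumes G: "metric_germ g x"
  shows "riemann g x m n r s = riemann g x r s m n"
  using riemann_bianchi[OF G, of r s m n] riemann_bianchi[OF G, of s m n r]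
    riemann_bianchi[OF G, of m n r s] riemann_bianchi[OF G, of n r s m]
    riemann_antisym1[OF G] riemann_antisym2[OF G]
  by smt

lemma riemann_up_eq:
  fixes g :: "real^'n::finite \<Rightarrow> real^'n^'n"
  shows "invertible (g x) \<Longrightarrow> riemann_up g x r s m n = (\<Sum>l\<in>UNIV. ginv g x r l * riemann g x l s m n)"
  unfolding riemann_def using raise_lowered[of g x r "\<lambda>l. riemann_up g x l s m n"] by simp

lemma ricci_eq:
  fixes g :: "real^'n::finite \<Rightarrow> real^'n^'n"
  shows "invertible (g x) \<Longrightarrow>
    ricci g x s n = (\<Sum>m\<in>UNIV. \<Sum>l\<in>UNIV. ginv g x m l * riemann g x l s m n)"
  unfolding ricci_def by (simp add: riemann_up_eq)

section \<open>Warped products\<close>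

lemma block_diag_nth [simp]:
  "block_diag A B $ Inl a $ Inl a' = A $ a $ a'"
  "block_diag A B $ Inr b $ Inr b' = B $ b $ b'"
  "block_diag A B $ Inl a $ Inr b = 0"
  "block_diag A B $ Inr b $ Inl a = 0"
  by (simp_all add: block_diag_def)

lemma sum_UNIV_Plus:
  fixes F :: "'a::finite + 'b::finite \<Rightarrow> 'c::comm_monoid_add"
  shows "(\<Sum>p\<in>UNIV. F p) = (\<Sum>a\<in>UNIV. F (Inl a)) + (\<Sum>b\<in>UNIV. F (Inr b))"
  by (simp add: sum.Plus flip: UNIV_Plus_UNIV)

lemma contract_ginv_metric:
  assumes "invertible (g x)" "\<And>i j. g x $ i $ j = g x $ j $ i"
  shows "(\<Sum>p\<in>UNIV. \<Sum>q\<in>UNIV. ginv g x p q * g x $ p $ j * F q) = F j"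
proof -
  have "(\<Sum>p\<in>UNIV. \<Sum>q\<in>UNIV. ginv g x p q * g x $ p $ j * F q)
      = (\<Sum>p\<in>UNIV. g x $ j $ p * (\<Sum>q\<in>UNIV. ginv g x p q * F q))"
    by (simp add: sum_distrib_left assms(2)[of _ j] mult_ac)
  then show ?thesis by (simp add: lower_raised[of g x, OF assms(1)])
qed

text \<open>The warping factor is \<open>u\<close> itself instead of the square of a function, so no
  root is taken and \<open>u\<close> may have either sign. All assumptions are about the single
  point \<open>x\<close>.\<close>

locale warped_product =
  fixes h :: "real^'a::finite \<Rightarrow> real^'a^'a" and \<gamma> :: "real^'b::finite \<Rightarrow> real^'b^'b"
    and u :: "real^'a \<Rightarrow> real" and x :: "real^('a + 'b)"
  assumes h: "metric_germ h (lpart x)" and \<gamma>: "metric_germ \<gamma> (rpart x)"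
    and u: "twice_diff u (lpart x)" and u0: "u (lpart x) \<noteq> 0"
begin

definition W :: "real^('a + 'b) \<Rightarrow> real^('a + 'b)^('a + 'b)" where
  "W y = block_diag (h (lpart y)) (u (lpart y) *\<^sub>R \<gamma> (rpart y))"

abbreviation (input) "hx \<equiv> h (lpart x)"
abbreviation (input) "gx \<equiv> \<gamma> (rpart x)"
abbreviation (input) "ux \<equiv> u (lpart x)"
abbreviation (input) "du \<equiv> \<lambda>A. partial A u (lpart x)"

lemma W_nth:
  "W y $ Inl a $ Inl b = h (lpart y) $ a $ b"
  "W y $ Inr i $ Inr j = u (lpart y) * \<gamma> (rpart y) $ i $ j"
  "W y $ Inl a $ Inr j = 0" "W y $ Inr i $ Inl b = 0"
  by (simp_all add: W_def)

lemma h_td: "twice_diff (\<lambda>y. h y $ a $ b) (lpart x)" and \<gamma>_td: "twice_diff (\<lambda>y. \<gamma> y $ i $ j) (rpart x)"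
  using h \<gamma> by (simp_all add: metric_germ_def)

lemmas td = twice_diff_lpart(1)[OF h_td] twice_diff_lpart(1)[OF u] twice_diff_rpart(1)[OF \<gamma>_td]

lemma partial_W:
  "partial (Inl c) (\<lambda>y. W y $ Inl a $ Inl b) x = partial c (\<lambda>y. h y $ a $ b) (lpart x)"
  "partial (Inr k) (\<lambda>y. W y $ Inl a $ Inl b) x = 0"
  "partial (Inl c) (\<lambda>y. W y $ Inr i $ Inr j) x = du c * gx $ i $ j"
  "partial (Inr k) (\<lambda>y. W y $ Inr i $ Inr j) x = ux * partial k (\<lambda>y. \<gamma> y $ i $ j) (rpart x)"
  "partial l (\<lambda>y. W y $ Inl a $ Inr j) x = 0"
  "partial l (\<lambda>y. W y $ Inr i $ Inl b) x = 0"
  by (simp_all add: W_nth partial_mult td[THEN twice_diff_at]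
      partial_lpart[OF twice_diff_at[OF h_td]] partial_lpart[OF twice_diff_at[OF u]]
      partial_rpart[where f = "\<lambda>y. \<gamma> y $ _ $ _", OF twice_diff_at[OF \<gamma>_td]])

lemma partial2_W:
  "partial (Inl c) (partial (Inl d) (\<lambda>y. W y $ Inl a $ Inl b)) x
    = partial c (partial d (\<lambda>y. h y $ a $ b)) (lpart x)"
  "partial (Inr k) (partial q (\<lambda>y. W y $ Inl a $ Inl b)) x = 0"
  "partial q (partial (Inr k) (\<lambda>y. W y $ Inl a $ Inl b)) x = 0"
  "partial (Inl c) (partial (Inl d) (\<lambda>y. W y $ Inr i $ Inr j)) x
    = partial c (partial d u) (lpart x) * gx $ i $ j"
  "partial (Inl c) (partial (Inr k) (\<lambda>y. W y $ Inr i $ Inr j)) x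
    = du c * partial k (\<lambda>y. \<gamma> y $ i $ j) (rpart x)"
  "partial (Inr k) (partial (Inl c) (\<lambda>y. W y $ Inr i $ Inr j)) x
    = du c * partial k (\<lambda>y. \<gamma> y $ i $ j) (rpart x)"
  "partial (Inr k) (partial (Inr l) (\<lambda>y. W y $ Inr i $ Inr j)) x
    = ux * partial k (partial l (\<lambda>y. \<gamma> y $ i $ j)) (rpart x)"
  "partial q (partial r (\<lambda>y. W y $ Inl a $ Inr j)) x = 0"
  "partial q (partial r (\<lambda>y. W y $ Inr i $ Inl b)) x = 0"
  by (simp_all add: W_nth partial2_mult td partial_const[abs_def]
      twice_diff_lpart[OF h_td] twice_diff_lpart[OF u] 
      twice_diff_rpart[where f = "\<lambda>y. \<gamma> y $ _ $ _", OF \<gamma>_td]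
      partial_lpart[OF twice_diff_at[OF h_td]] partial_lpart[OF twice_diff_at[OF u]]
      partial_rpart[where f = "\<lambda>y. \<gamma> y $ _ $ _", OF twice_diff_at[OF \<gamma>_td]])

lemma ginv_W:
  "invertible (W x)"
  "ginv W x (Inl a) (Inl b) = ginv h (lpart x) a b"
  "ginv W x (Inr i) (Inr j) = ginv \<gamma> (rpart x) i j / ux"
  "ginv W x (Inl a) (Inr j) = 0" "ginv W x (Inr i) (Inl b) = 0"
proof -
  define B where "B p q = (case (p, q) of (Inl a, Inl b) \<Rightarrow> ginv h (lpart x) a b
    | (Inr i, Inr j) \<Rightarrow> ginv \<gamma> (rpart x) i j / ux | _ \<Rightarrow> 0)" for p q
  have "invertible hx" "invertible gx" using h \<gamma> by (simp_all add: metric_germ_def)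
  then have *: "(\<Sum>m\<in>UNIV. B p m * W x $ m $ q) = (if p = q then 1 else 0)" for p q
    using u0
    by (cases p; cases q)
       (simp_all add: B_def sum_UNIV_Plus W_nth ginv_left[of h "lpart x"] ginv_left[of \<gamma> "rpart x"])
  show "invertible (W x)" by (rule ginv_unique(1)[where g = W and x = x, OF *])
  show "ginv W x (Inl a) (Inl b) = ginv h (lpart x) a b"
    "ginv W x (Inr i) (Inr j) = ginv \<gamma> (rpart x) i j / ux"
    "ginv W x (Inl a) (Inr j) = 0" "ginv W x (Inr i) (Inl b) = 0"
    by (simp_all add: ginv_unique(2)[where g = W and x = x, OF *] B_def)
qed

lemma metric_germ_W: "metric_germ W x"
proof -
  have "twice_diff (\<lambda>y. W y $ p $ q) x" for p q
    by (cases p; cases q)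
       (simp_all add: W_nth td twice_diff_mult[OF td(2,3)] twice_diff_const)
  moreover have "\<forall>\<^sub>F y in nhds x. transpose (W y) = W y"
  proof -
    have "\<forall>\<^sub>F y in nhds x. transpose (h (lpart y)) = h (lpart y)"
      using h tendsto_lpart[of x] unfolding metric_germ_def filterlim_iff by blast
    moreover have "\<forall>\<^sub>F y in nhds x. transpose (\<gamma> (rpart y)) = \<gamma> (rpart y)"
      using \<gamma> tendsto_rpart[of x] unfolding metric_germ_def filterlim_iff by blast
    ultimately show ?thesis
    proof eventually_elim
      case (elim y)
      have "h (lpart y) $ a $ b = h (lpart y) $ b $ a" "\<gamma> (rpart y) $ i $ j = \<gamma> (rpart y) $ j $ i"
        for a b i j
        using elim by (auto intro: symmetric_nth)
      then have "W y $ p $ q = W y $ q $ p" for p q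
        by (cases p; cases q) (simp_all add: W_nth)
      then show ?case by (simp add: transpose_def vec_eq_iff)
    qed
  qed
  ultimately show ?thesis using ginv_W(1) by (simp add: metric_germ_def)
qed

section \<open>Blocks of the Christoffel symbols and of the Riemann tensor\<close>

lemma chris_low_W:
  "chris_low W (Inl a) (Inl b) (Inl c) x = chris_low h a b c (lpart x)"
  "chris_low W (Inl a) (Inl b) (Inr j) x = 0"
  "chris_low W (Inl a) (Inr j) (Inl b) x = 0"
  "chris_low W (Inr j) (Inl a) (Inl b) x = 0"
  "chris_low W (Inl a) (Inr i) (Inr j) x = - (1/2) * du a * gx $ i $ j"
  "chris_low W (Inr i) (Inl a) (Inr j) x = (1/2) * du a * gx $ i $ j"
  "chris_low W (Inr i) (Inr j) (Inl a) x = (1/2) * du a * gx $ i $ j"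
  "chris_low W (Inr i) (Inr j) (Inr k) x = ux * chris_low \<gamma> i j k (rpart x)"
  by (simp_all add: chris_low_def partial_W algebra_simps)

definition grad_u :: "'a \<Rightarrow> real" where
  "grad_u a = (\<Sum>b\<in>UNIV. ginv h (lpart x) a b * du b)"

text \<open>For \<open>u = w\<^sup>2\<close> the form \<open>warp_hessian\<close> is $-w\nabla_a\nabla_b w$ and \<open>warp_norm\<close> is
  $w^2|\nabla w|^2$.\<close>

definition warp_hessian :: "'a \<Rightarrow> 'a \<Rightarrow> real" where
  "warp_hessian a b = - (1/2) * (partial a (partial b u) (lpart x)
     - (\<Sum>p\<in>UNIV. chris_low h p a b (lpart x) * grad_u p) - du a * du b / (2 * ux))"

definition warp_norm :: real where
  "warp_norm = (1/4) * (\<Sum>p\<in>UNIV. du p * grad_u p)"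

lemma sq_W_LL:
  "christoffel_square W x (Inl a) (Inl b) (Inl c) (Inl d) = christoffel_square h (lpart x) a b c d"
  "christoffel_square W x (Inl a) (Inl b) (Inr j) (Inl c) = 0"
  "christoffel_square W x (Inr j) (Inl b) (Inl a) (Inl c) = 0"
  "christoffel_square W x (Inl a) (Inl b) (Inr i) (Inr j)
    = - (1/2) * (\<Sum>p\<in>UNIV. chris_low h p a b (lpart x) * grad_u p) * gx $ i $ j"
proof -
  have "christoffel_square W x (Inl a) (Inl b) (Inr i) (Inr j)
    = (\<Sum>p\<in>UNIV. \<Sum>q\<in>UNIV. (chris_low h p a b (lpart x) * (ginv h (lpart x) p q * du q))
        * (- (1/2) * gx $ i $ j))"
    unfolding christoffel_square_def sum_UNIV_Plus ginv_W chris_low_W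
    by (simp add: mult.assoc mult.left_commute)
  also have "\<dots> = (\<Sum>p\<in>UNIV. chris_low h p a b (lpart x) * grad_u p) * (- (1/2) * gx $ i $ j)"
    unfolding grad_u_def by (simp only: sum_distrib_left sum_distrib_right)
  finally show "christoffel_square W x (Inl a) (Inl b) (Inr i) (Inr j)
    = - (1/2) * (\<Sum>p\<in>UNIV. chris_low h p a b (lpart x) * grad_u p) * gx $ i $ j" by simp
qed (simp_all add: christoffel_square_def sum_UNIV_Plus ginv_W chris_low_W)

lemma gx_sym: "gx $ i $ j = gx $ j $ i" by (rule metric_germ_symE(1)[OF \<gamma>])

lemma gx_inv: "invertible gx" using \<gamma> by (simp add: metric_germ_def)

lemma sq_W_mixed:
  "christoffel_square W x (Inr i) (Inl a) (Inr j) (Inl b) = du a * du b / (4 * ux) * gx $ i $ j"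
  "christoffel_square W x (Inr i) (Inl a) (Inl b) (Inr j) = du a * du b / (4 * ux) * gx $ i $ j"
  "christoffel_square W x (Inr i) (Inl a) (Inr j) (Inr k)
    = (1/2) * du a * chris_low \<gamma> i j k (rpart x)"
proof -
  have "(\<Sum>p\<in>UNIV. \<Sum>q\<in>UNIV. ginv \<gamma> (rpart x) p q * gx $ p $ i * F q) = F i" for F
    using contract_ginv_metric[of \<gamma> "rpart x", OF gx_inv gx_sym] .
  note c = this
  have "christoffel_square W x (Inr i) (Inl a) (Inr j) (Inl b)
    = (\<Sum>p\<in>UNIV. \<Sum>q\<in>UNIV. ginv \<gamma> (rpart x) p q * gx $ p $ i * (du a * du b / (4 * ux) * gx $ q $ j))"
    by (simp add: christoffel_square_def sum_UNIV_Plus ginv_W chris_low_W mult_ac)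
  then show *: "christoffel_square W x (Inr i) (Inl a) (Inr j) (Inl b)
      = du a * du b / (4 * ux) * gx $ i $ j" unfolding c .
  show "christoffel_square W x (Inr i) (Inl a) (Inl b) (Inr j) = du a * du b / (4 * ux) * gx $ i $ j"
    using * christoffel_square_sym(2)[OF metric_germ_W] by metis
  have "christoffel_square W x (Inr i) (Inl a) (Inr j) (Inr k)
    = (\<Sum>p\<in>UNIV. \<Sum>q\<in>UNIV. ginv \<gamma> (rpart x) p q * gx $ p $ i
        * ((1/2) * du a * chris_low \<gamma> q j k (rpart x)))"
    using u0 by (simp add: christoffel_square_def sum_UNIV_Plus ginv_W chris_low_W mult_ac)
  then show "christoffel_square W x (Inr i) (Inl a) (Inr j) (Inr k)
    = (1/2) * du a * chris_low \<gamma> i j k (rpart x)" unfolding c .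
qed

lemma sq_W_RR:
  "christoffel_square W x (Inr i) (Inr j) (Inr k) (Inr l)
    = ux * christoffel_square \<gamma> (rpart x) i j k l + warp_norm * gx $ i $ j * gx $ k $ l"
proof -
  have "christoffel_square W x (Inr i) (Inr j) (Inr k) (Inr l)
    = (\<Sum>p\<in>UNIV. \<Sum>q\<in>UNIV. (du p * (ginv h (lpart x) p q * du q)) * ((1/4) * gx $ i $ j * gx $ k $ l))
    + (\<Sum>p\<in>UNIV. \<Sum>q\<in>UNIV. ux * (ginv \<gamma> (rpart x) p q * chris_low \<gamma> p i j (rpart x)
          * chris_low \<gamma> q k l (rpart x)))"
    using u0 unfolding christoffel_square_def sum_UNIV_Plus ginv_W chris_low_W
    by (simp add: mult.assoc mult.left_commute)
  also have "\<dots> = (\<Sum>p\<in>UNIV. du p * grad_u p) * ((1/4) * gx $ i $ j * gx $ k $ l)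
      + ux * christoffel_square \<gamma> (rpart x) i j k l"
    unfolding grad_u_def christoffel_square_def by (simp only: sum_distrib_left sum_distrib_right)
  finally show ?thesis by (simp add: warp_norm_def)
qed

lemma riemann_W_LLLL:
  "riemann W x (Inl a) (Inl b) (Inl c) (Inl d) = riemann h (lpart x) a b c d"
  by (simp add: riemann_second_order[OF metric_germ_W] riemann_second_order[OF h] partial2_W sq_W_LL)

text \<open>The Gauss equation of the fibre through \<open>x\<close>, which is umbilic:
  \<open>warp_norm\<close> is the contribution of its second fundamental form and comes from the
  base indices contracted in \<open>sq_W_RR\<close>.\<close>

lemma riemann_W_RRRR:
  "riemann W x (Inr i) (Inr j) (Inr k) (Inr l) = ux * riemann \<gamma> (rpart x) i j k l
     - warp_norm * (gx $ i $ k * gx $ j $ l - gx $ i $ l * gx $ j $ k)"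
  by (simp add: riemann_second_order[OF metric_germ_W] riemann_second_order[OF \<gamma>] partial2_W sq_W_RR
      gx_sym[of k] gx_sym[of l] algebra_simps)

lemma riemann_W_LRLR:
  "riemann W x (Inl a) (Inr i) (Inl b) (Inr j) = warp_hessian b a * gx $ i $ j"
  by (simp add: riemann_second_order[OF metric_germ_W] partial2_W sq_W_LL sq_W_mixed warp_hessian_def
      gx_sym[of j i] algebra_simps)

lemma riemann_W_zero:
  "riemann W x (Inl a) (Inl b) (Inl c) (Inr i) = 0"
  "riemann W x (Inl a) (Inl b) (Inr i) (Inr j) = 0"
  "riemann W x (Inl a) (Inr i) (Inr j) (Inr k) = 0"
proof -
  show "riemann W x (Inl a) (Inl b) (Inl c) (Inr i) = 0"
    by (simp add: riemann_second_order[OF metric_germ_W] partial2_W sq_W_LL)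
  show "riemann W x (Inl a) (Inl b) (Inr i) (Inr j) = 0"
    by (simp add: riemann_second_order[OF metric_germ_W] partial2_W sq_W_mixed gx_sym[of j i])
  \<comment> \<open>First partials of the fibre metric survive here; they cancel against the
    first-kind symbols of the fibre because \<open>\<gamma>\<close> is symmetric near the
    point.\<close>
  show "riemann W x (Inl a) (Inr i) (Inr j) (Inr k) = 0"
    using metric_germ_symE(3)[OF \<gamma>, of k j i] metric_germ_symE(3)[OF \<gamma>, of j k i]
      metric_germ_symE(3)[OF \<gamma>, of i k j]
    by (simp add: riemann_second_order[OF metric_germ_W] partial2_W sq_W_mixed chris_low_def
        algebra_simps)
qed

lemma warp_hessian_sym: "warp_hessian a b = warp_hessian b a"
  using twice_diff_sym[OF u, of a b] chris_low_sym[OF h, of _ a b] by (simp add: warp_hessian_def)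

lemma riemann_W_sym:
  "riemann W x (Inl a) (Inr i) (Inr j) (Inl b) = - warp_hessian a b * gx $ i $ j"
  "riemann W x (Inr i) (Inl a) (Inl b) (Inr j) = - warp_hessian a b * gx $ i $ j"
  "riemann W x (Inr i) (Inl a) (Inr j) (Inl b) = warp_hessian a b * gx $ i $ j"
  "riemann W x (Inl a) (Inl b) (Inr i) (Inl c) = 0"
  "riemann W x (Inl a) (Inr i) (Inl b) (Inl c) = 0"
  "riemann W x (Inr i) (Inl a) (Inl b) (Inl c) = 0"
  "riemann W x (Inr i) (Inr j) (Inl a) (Inl b) = 0"
  "riemann W x (Inr i) (Inl a) (Inr j) (Inr k) = 0"
  "riemann W x (Inr i) (Inr j) (Inl a) (Inr k) = 0"
  "riemann W x (Inr i) (Inr j) (Inr k) (Inl a) = 0"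
proof -
  note a1 = riemann_antisym1[OF metric_germ_W] and a2 = riemann_antisym2[OF metric_germ_W]
    and ps = riemann_pair_sym[OF metric_germ_W]
  show "riemann W x (Inl a) (Inr i) (Inr j) (Inl b) = - warp_hessian a b * gx $ i $ j"
    using a2[of "Inl a" "Inr i" "Inr j" "Inl b"] by (simp add: riemann_W_LRLR warp_hessian_sym)
  show "riemann W x (Inr i) (Inl a) (Inl b) (Inr j) = - warp_hessian a b * gx $ i $ j"
    using a1[of "Inr i" "Inl a" "Inl b" "Inr j"] by (simp add: riemann_W_LRLR warp_hessian_sym)
  then show "riemann W x (Inr i) (Inl a) (Inr j) (Inl b) = warp_hessian a b * gx $ i $ j"
    using a2[of "Inr i" "Inl a" "Inr j" "Inl b"] by simp
  show "riemann W x (Inl a) (Inl b) (Inr i) (Inl c) = 0"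
    using a2[of "Inl a" "Inl b" "Inr i" "Inl c"] by (simp add: riemann_W_zero)
  show 1: "riemann W x (Inl a) (Inr i) (Inl b) (Inl c) = 0" for a i b c
    using a2[of "Inl b" "Inl c" "Inr i" "Inl a"] ps[of "Inl a" "Inr i" "Inl b" "Inl c"]
    by (simp add: riemann_W_zero)
  show "riemann W x (Inr i) (Inl a) (Inl b) (Inl c) = 0"
    using a1[of "Inr i" "Inl a" "Inl b" "Inl c"] by (simp add: 1)
  show "riemann W x (Inr i) (Inr j) (Inl a) (Inl b) = 0"
    using ps[of "Inr i" "Inr j" "Inl a" "Inl b"] by (simp add: riemann_W_zero)
  show "riemann W x (Inr i) (Inl a) (Inr j) (Inr k) = 0"
    using a1[of "Inr i" "Inl a" "Inr j" "Inr k"] by (simp add: riemann_W_zero)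
  show 2: "riemann W x (Inr i) (Inr j) (Inl a) (Inr k) = 0"
    using ps[of "Inr i" "Inr j" "Inl a" "Inr k"] by (simp add: riemann_W_zero)
  show "riemann W x (Inr i) (Inr j) (Inr k) (Inl a) = 0"
    using a2[of "Inr i" "Inr j" "Inr k" "Inl a"] by (simp add: 2)
qed

end

section \<open>Constant sectional curvature\<close>

definition quad_form ::
  "('n \<Rightarrow> 'n \<Rightarrow> 'n \<Rightarrow> 'n \<Rightarrow> real) \<Rightarrow> real^'n::finite \<Rightarrow> real^'n \<Rightarrow> real^'n \<Rightarrow> real^'n \<Rightarrow> real" where
  "quad_form R u v w z =
     (\<Sum>a\<in>UNIV. \<Sum>b\<in>UNIV. \<Sum>c\<in>UNIV. \<Sum>d\<in>UNIV. R a b c d * u $ a * v $ b * w $ c * z $ d)"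

lemma quad_form_add:
  "quad_form R (u + u') v w z = quad_form R u v w z + quad_form R u' v w z"
  "quad_form R u (v + v') w z = quad_form R u v w z + quad_form R u v' w z"
  "quad_form R u v (w + w') z = quad_form R u v w z + quad_form R u v w' z"
  "quad_form R u v w (z + z') = quad_form R u v w z + quad_form R u v w z'"
  by (simp_all add: quad_form_def ring_distribs sum.distrib)

lemma sum_times_axis: "(\<Sum>a\<in>UNIV. F a * axis b (1::real) $ a) = F b"
  by (simp add: axis_def if_distrib[where f="\<lambda>c. _ * c"] cong: if_cong)

lemma quad_form_axis: "quad_form R (axis a 1) (axis b 1) (axis c 1) (axis d 1) = R a b c d"
  unfolding quad_form_def sum_times_axis by (simp only: sum_distrib_right[symmetric] sum_times_axis)

text \<open>Polarization at sums of two basis vectors makes \<open>R\<close> change sign when its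
  second and fourth indices are exchanged. Together with antisymmetry in the last pair,
  \<open>R\<close> is then invariant under cyclic shifts of the last three indices, and the Bianchi
  identity says that three times \<open>R\<close> is zero.\<close>

lemma algebraic_curvature_zero:
  fixes R :: "'n::finite \<Rightarrow> 'n \<Rightarrow> 'n \<Rightarrow> 'n \<Rightarrow> real"
  assumes a2: "\<And>a b c d. R a b d c = - R a b c d"
    and ps: "\<And>a b c d. R c d a b = R a b c d"
    and bi: "\<And>a b c d. R a b c d + R a c d b + R a d b c = 0"
    and q: "\<And>u v. quad_form R u v u v = 0"
  shows "R a b c d = 0"
proof -
  note s = quad_form_add quad_form_axis
  have 0: "R a b a b = 0" for a b
    using q[of "axis a 1" "axis b 1"] by (simp add: s)
  have 1: "R a b c b = 0" for a b c
    using q[of "axis a 1 + axis c 1" "axis b 1"] ps[of a b c b] by (simp add: s 0)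
  have 2: "R a b a d = 0" for a b d
    using q[of "axis a 1" "axis b 1 + axis d 1"] ps[of a b a d] by (simp add: s 0)
  have 3: "R a b c d = - R a d c b" for a b c d
    using q[of "axis a 1 + axis c 1" "axis b 1 + axis d 1"] ps[of a b c d] ps[of a d c b]
    by (simp add: s 0 1 2)
  have cyc: "R a b c d = R a d b c" for a b c d
    using 3[of a b c d] a2[of a d b c] by simp
  from bi[of a b c d] cyc[of a b c d] cyc[of a d b c] show ?thesis by simp
qed

text \<open>Half the Kulkarni-Nomizu square of \<open>A\<close>; for a metric \<open>A\<close> it is
  the lowered curvature tensor of constant curvature 1.\<close>

definition kulkarni :: "real^'n^'n \<Rightarrow> 'n \<Rightarrow> 'n \<Rightarrow> 'n \<Rightarrow> 'n \<Rightarrow> real" where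
  "kulkarni A a b c d = A $ a $ c * A $ b $ d - A $ a $ d * A $ b $ c"

lemma kulkarni_symmetries:
  assumes "\<And>i j. A $ i $ j = A $ j $ i"
  shows "kulkarni A a b d c = - kulkarni A a b c d"
    and "kulkarni A c d a b = kulkarni A a b c d"
    and "kulkarni A a b c d + kulkarni A a c d b + kulkarni A a d b c = 0"
  using assms[of a c] assms[of b d] assms[of b c] assms[of a d] assms[of c d] 
  by (simp_all add: kulkarni_def algebra_simps)

lemma inner_matrix_vector:
  "u \<bullet> (A *v v) = (\<Sum>a\<in>UNIV. \<Sum>b\<in>UNIV. A $ a $ b * u $ a * v $ b)" for u :: "real^'n::finite"
  by (simp add: inner_vec_def matrix_vector_mult_def sum_distrib_left mult_ac)

lemma plane_form_eq: 
  fixes g :: "real^'n::finite \<Rightarrow> real^'n^'n"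
  assumes "\<And>i j. g x $ i $ j = g x $ j $ i"
  shows "quad_form (kulkarni (g x)) u v u v = plane_form g x u v"
proof -
  let ?A = "g x"
  have p1: "(\<Sum>a\<in>UNIV. \<Sum>b\<in>UNIV. \<Sum>c\<in>UNIV. \<Sum>d\<in>UNIV. (?A $ a $ c * u $ a * u $ c) * (?A $ b $ d * v $ b * v $ d))
      = (u \<bullet> (?A *v u)) * (v \<bullet> (?A *v v))"
  proof -
    have "(u \<bullet> (?A *v u)) * (v \<bullet> (?A *v v)) = (\<Sum>a\<in>UNIV. \<Sum>b\<in>UNIV. (\<Sum>c\<in>UNIV. ?A $ a $ c * u $ a * u $ c)
        * (\<Sum>d\<in>UNIV. ?A $ b $ d * v $ b * v $ d))"
      unfolding inner_matrix_vector by (rule sum_product)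
    then show ?thesis by (simp only: sum_product)
  qed
  have p2: "(\<Sum>a\<in>UNIV. \<Sum>b\<in>UNIV. \<Sum>c\<in>UNIV. \<Sum>d\<in>UNIV. (?A $ a $ d * u $ a * v $ d) * (?A $ b $ c * v $ b * u $ c))
      = (u \<bullet> (?A *v v)) * (v \<bullet> (?A *v u))"
  proof -
    have "(u \<bullet> (?A *v v)) * (v \<bullet> (?A *v u)) = (\<Sum>a\<in>UNIV. \<Sum>b\<in>UNIV. (\<Sum>d\<in>UNIV. ?A $ a $ d * u $ a * v $ d)
        * (\<Sum>c\<in>UNIV. ?A $ b $ c * v $ b * u $ c))"
      unfolding inner_matrix_vector by (rule sum_product)
    also have "\<dots> = (\<Sum>a\<in>UNIV. \<Sum>b\<in>UNIV. \<Sum>d\<in>UNIV. \<Sum>c\<in>UNIV. (?A $ a $ d * u $ a * v $ d) * (?A $ b $ c * v $ b * u $ c))"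
      by (simp only: sum_product)
    also have "\<dots> = (\<Sum>a\<in>UNIV. \<Sum>b\<in>UNIV. \<Sum>c\<in>UNIV. \<Sum>d\<in>UNIV. (?A $ a $ d * u $ a * v $ d) * (?A $ b $ c * v $ b * u $ c))"
      by (intro sum.cong refl sum.swap)
    finally show ?thesis by simp
  qed
  have sy: "v \<bullet> (?A *v u) = u \<bullet> (?A *v v)"
    unfolding inner_matrix_vector by (subst sum.swap) (simp add: assms mult_ac)
  have "quad_form (kulkarni ?A) u v u v =
     (\<Sum>a\<in>UNIV. \<Sum>b\<in>UNIV. \<Sum>c\<in>UNIV. \<Sum>d\<in>UNIV. (?A $ a $ c * u $ a * u $ c) * (?A $ b $ d * v $ b * v $ d))
   - (\<Sum>a\<in>UNIV. \<Sum>b\<in>UNIV. \<Sum>c\<in>UNIV. \<Sum>d\<in>UNIV. (?A $ a $ d * u $ a * v $ d) * (?A $ b $ c * v $ b * u $ c))"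
    unfolding quad_form_def kulkarni_def sum_subtractf[symmetric]
    by (intro sum.cong refl) (simp add: algebra_simps)
  then show ?thesis
    unfolding p1 p2 sy by (simp add: plane_form_def power2_eq_square)
qed

lemma plane_form_line_zeros_finite:
  fixes g :: "real^'n::finite \<Rightarrow> real^'n^'n"
  assumes "plane_form g x u0 v0 \<noteq> 0"
  shows "finite {t. plane_form g x (u + t *\<^sub>R u0) (v + t *\<^sub>R v0) = 0}"
proof -
  define b where "b u v = u \<bullet> (g x *v v)" for u v
  define P where "P = [:b u u, b u u0 + b u0 u, b u0 u0:] * [:b v v, b v v0 + b v0 v, b v0 v0:]
    - [:b u v, b u v0 + b u0 v, b u0 v0:] * [:b u v, b u v0 + b u0 v, b u0 v0:]"
  have bb: "b (u + t *\<^sub>R u0) (v + t *\<^sub>R v0) = b u v + t * (b u v0 + b u0 v + t * b u0 v0)" for u v u0 v0 t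
    by (simp add: b_def inner_add_left inner_add_right matrix_vector_right_distrib
        matrix_vector_mult_scaleR algebra_simps)
  have "poly P t = plane_form g x (u + t *\<^sub>R u0) (v + t *\<^sub>R v0)" for t
    unfolding P_def plane_form_def b_def[symmetric] bb by (simp add: power2_eq_square algebra_simps)
  moreover have "coeff P 4 = plane_form g x u0 v0"
    unfolding P_def plane_form_def b_def[symmetric]
    by (simp add: power2_eq_square numeral_eq_Suc)
  then have "P \<noteq> 0" using assms by auto
  ultimately show ?thesis using poly_roots_finite[of P] by simp
qed

text \<open>If the plane form vanished identically, polarization would give vanishing
  \<open>kulkarni (g x)\<close>. Contracting two indices with the inverse metric then gives (d - 1)
  g = 0 in dimension d, which is impossible for d at least 2.\<close>

lemma nondegenerate_plane_exists:
  fixes g :: "real^'n::finite \<Rightarrow> real^'n^'n"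
  assumes inv: "invertible (g x)" and sym: "\<And>i j. g x $ i $ j = g x $ j $ i"
    and card: "CARD('n) \<ge> 2"
  shows "\<exists>u v. plane_form g x u v \<noteq> 0"
proof (rule ccontr)
  assume "\<not> ?thesis"
  then have q: "quad_form (kulkarni (g x)) u v u v = 0" for u v
    by (simp add: plane_form_eq sym)
  have K: "kulkarni (g x) a b c d = 0" for a b c d
    by (rule algebraic_curvature_zero[OF kulkarni_symmetries q]) (rule sym)+
  have "g x $ b $ d = 0" for b d
  proof -
    have "(\<Sum>c\<in>UNIV. \<Sum>a\<in>UNIV. ginv g x c a * (g x $ a $ c * g x $ b $ d))
      = (\<Sum>c\<in>UNIV. \<Sum>a\<in>UNIV. ginv g x c a * (g x $ a $ d * g x $ b $ c))"
      using K by (simp add: kulkarni_def)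
    moreover have "(\<Sum>c\<in>UNIV. \<Sum>a\<in>UNIV. ginv g x c a * (g x $ a $ c * g x $ b $ d))
        = real CARD('n) * g x $ b $ d"
      unfolding mult.assoc[symmetric] sum_distrib_right[symmetric] ginv_left[of g x, OF inv] by simp
    moreover have "(\<Sum>c\<in>UNIV. \<Sum>a\<in>UNIV. ginv g x c a * (g x $ a $ d * g x $ b $ c)) = g x $ b $ d"
      unfolding mult.assoc[symmetric] sum_distrib_right[symmetric] ginv_left[of g x, OF inv]
      by (rule sum_mult_delta)
    ultimately have "(real CARD('n) - 1) * g x $ b $ d = 0" by (simp add: algebra_simps)
    moreover have "real CARD('n) - 1 \<noteq> 0" using card by simp
    ultimately show ?thesis by simp
  qed
  \<comment> \<open>Any diagonal entry of the identity serves; \<open>undefined\<close> is an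
    arbitrary index.\<close>
  with ginv_left[of g x, OF inv, of undefined undefined] show False by simp
qed

text \<open>
  Only nondegenerate planes are controlled.  Along a line of pairs \<open>(u + t u0, v + t v0)\<close> through a
  nondegenerate \<open>(u0, v0)\<close> the plane form is a quartic in \<open>t\<close> with nonzero leading coefficient, so
  degenerate planes are limits of nondegenerate ones.
\<close>

lemma riemann_constant_curvature:
  fixes g :: "real^'n::finite \<Rightarrow> real^'n^'n"
  assumes G: "metric_germ g x" and card: "CARD('n) \<ge> 2"
    and k: "\<And>u v. plane_form g x u v \<noteq> 0 \<Longrightarrow> sectional_curvature g x u v = k"
  shows "riemann g x a b c d = k * kulkarni (g x) a b c d"
proof -
  note sym = metric_germ_symE(1)[OF G]
  \<comment> \<open>The defect \<open>D\<close> has the algebraic symmetries of a curvature tensor,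
    so it vanishes as soon as all its sectional values do.\<close>
  define D where "D a b c d = riemann g x a b c d - k * kulkarni (g x) a b c d" for a b c d
  have Dq: "quad_form D u v u v = quad_form (riemann g x) u v u v - k * plane_form g x u v" for u v
    unfolding plane_form_eq[of g x, OF sym, symmetric]
    by (simp add: quad_form_def D_def sum_subtractf sum_distrib_left algebra_simps)
  have D0: "quad_form D u v u v = 0" if "plane_form g x u v \<noteq> 0" for u v
  proof -
    have "quad_form (riemann g x) u v u v / plane_form g x u v = k"
      using k[OF that] by (simp add: sectional_curvature_def quad_form_def)
    then show ?thesis using that by (simp add: Dq field_simps)
  qed
  obtain u0 v0 where uv0: "plane_form g x u0 v0 \<noteq> 0"
    using nondegenerate_plane_exists[of g x, OF _ sym card] G by (auto simp: metric_germ_def)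
  have q: "quad_form D u v u v = 0" for u v
  proof -
    define E where "E t = quad_form D (u + t *\<^sub>R u0) (v + t *\<^sub>R v0) (u + t *\<^sub>R u0) (v + t *\<^sub>R v0)" for t
    define F where "F = {t. plane_form g x (u + t *\<^sub>R u0) (v + t *\<^sub>R v0) = 0}"
    have "finite F" unfolding F_def by (rule plane_form_line_zeros_finite[OF uv0])
    then have "\<forall>\<^sub>F t in at 0. t \<notin> F"
      using islimpt_finite islimpt_iff_eventually by blast
    then have "\<forall>\<^sub>F t in at 0. E t = 0"
      by eventually_elim (simp add: E_def F_def D0)
    then have "(E \<longlongrightarrow> 0) (at 0)" by (rule tendsto_eventually)
    moreover have "isCont E 0"
      unfolding E_def quad_form_def by (intro continuous_intros)
    ultimately have "E 0 = 0"
      unfolding isCont_def using tendsto_unique[OF at_neq_bot] by blast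
    then show ?thesis by (simp add: E_def)
  qed
  have "D a b c d = 0"
  proof (rule algebraic_curvature_zero[OF _ _ _ q])
    note K = kulkarni_symmetries[of "g x", OF sym]
    fix a b c d
    show "D a b d c = - D a b c d"
      using riemann_antisym2[OF G, of a b d c] K(1)[of a b d c] by (simp add: D_def algebra_simps)
    show "D c d a b = D a b c d"
      using riemann_pair_sym[OF G, of c d a b] K(2)[of c d a b] by (simp add: D_def)
    have "k * (kulkarni (g x) a b c d + kulkarni (g x) a c d b + kulkarni (g x) a d b c) = 0"
      by (simp only: K(3) mult_zero_right)
    then show "D a b c d + D a c d b + D a d b c = 0"
      using riemann_bianchi[OF G, of a b c d] by (simp add: D_def algebra_simps)
  qed
  then show ?thesis by (simp add: D_def)
qed

section \<open>The unit sphere\<close>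

lemma partial_inner:
  fixes f g :: "real^'n::finite \<Rightarrow> 'b::real_inner"
  assumes "f differentiable (at x)" "g differentiable (at x)"
  shows "partial i (\<lambda>y. f y \<bullet> g y) x = f x \<bullet> partial i g x + partial i f x \<bullet> g x"
proof -
  note d = assms[unfolded frechet_derivative_works]
  show ?thesis
    by (subst partial_has_derivative[OF has_derivative_inner[OF d]]) (simp add: partial_def)
qed

text \<open>\<open>S\<close> is the inverse Gram matrix of the tangent vectors, so \<open>P\<close>
  is the normal part plus the tangential projection of \<open>A\<close>, and \<open>A - P\<close> is
  orthogonal to a frame of the whole space. With second derivatives of a parametrization for
  \<open>A\<close> and \<open>B\<close>, the tangential part is a
  \<open>christoffel_square\<close>.\<close>

lemma inner_frame_expansion:
  fixes e :: "2 \<Rightarrow> real^3" and \<nu> A B :: "real^3" and S :: "2 \<Rightarrow> 2 \<Rightarrow> real"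
  assumes \<nu>: "\<nu> \<bullet> \<nu> = 1" "\<And>i. e i \<bullet> \<nu> = 0"
    and ind: "\<And>c::real^2. (\<Sum>i\<in>UNIV. c $ i *\<^sub>R e i) = 0 \<Longrightarrow> c = 0"
    and S: "\<And>i j. (\<Sum>p\<in>UNIV. S i p * (e p \<bullet> e j)) = (if i = j then 1 else 0)" "\<And>i j. S i j = S j i"
  shows "A \<bullet> B = (A \<bullet> \<nu>) * (B \<bullet> \<nu>) + (\<Sum>p\<in>UNIV. \<Sum>q\<in>UNIV. S p q * (e p \<bullet> A) * (e q \<bullet> B))"
proof -
  define P where "P = (A \<bullet> \<nu>) *\<^sub>R \<nu> + (\<Sum>q\<in>UNIV. (\<Sum>p\<in>UNIV. S p q * (e p \<bullet> A)) *\<^sub>R e q)"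
  \<comment> \<open>The rows of \<open>M\<close> are the frame. An injective transpose expresses
    their linear independence, which makes the square matrix \<open>M\<close> injective too.\<close>
  define M :: "real^3^3" where "M = vector [e 1, e 2, \<nu>]"
  have "P \<bullet> \<nu> = A \<bullet> \<nu>"
    by (simp add: P_def inner_add_left inner_sum_left \<nu>)
  then have "\<nu> \<bullet> (A - P) = 0"
    by (simp add: inner_diff_right inner_commute)
  moreover have "e r \<bullet> (A - P) = 0" for r
  proof -
    have "P \<bullet> e r = (\<Sum>q\<in>UNIV. \<Sum>p\<in>UNIV. (S p q * (e q \<bullet> e r)) * (e p \<bullet> A))"
      using \<nu>(2)[of r] by (simp add: P_def inner_add_left inner_sum_left inner_commute[of \<nu>]
          sum_distrib_left sum_distrib_right mult_ac)
    also have "\<dots> = (\<Sum>p\<in>UNIV. (\<Sum>q\<in>UNIV. S p q * (e q \<bullet> e r)) * (e p \<bullet> A))"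
      by (subst sum.swap) (simp add: sum_distrib_right)
    also have "\<dots> = e r \<bullet> A" by (simp only: S sum_mult_delta)
    finally show ?thesis by (simp add: inner_diff_right inner_commute)
  qed
  ultimately have MW: "M *v (A - P) = 0"
    by (simp add: vec_eq_iff forall_3 matrix_vector_mul_component M_def)
  have "c = 0" if "transpose M *v c = 0" for c
  proof -
    have c: "c $ 1 *\<^sub>R e 1 + c $ 2 *\<^sub>R e 2 + c $ 3 *\<^sub>R \<nu> = 0"
      using that by (simp add: vec_eq_iff matrix_vector_mult_def transpose_def sum_3 M_def mult.commute)
    from arg_cong[OF this, of "\<lambda>w. w \<bullet> \<nu>"] have c3: "c $ 3 = 0"
      by (simp add: inner_add_left \<nu>)
    have "(\<Sum>i\<in>UNIV. (vector [c $ 1, c $ 2] :: real^2) $ i *\<^sub>R e i) = 0"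
      using c c3 by (simp add: sum_2)
    from ind[OF this] have "c $ 1 = 0" "c $ 2 = 0" by (metis vector_2 zero_index)+
    with c3 show ?thesis by (simp add: vec_eq_iff forall_3)
  qed
  then have "invertible (transpose M)"
    using matrix_left_invertible_ker invertible_left_inverse by blast
  then have "invertible M" by (simp add: invertible_det_nz)
  then have "A - P = 0"
    using MW matrix_left_invertible_ker invertible_left_inverse by blast
  then have "A \<bullet> B = P \<bullet> B" by simp
  also have "\<dots> = (A \<bullet> \<nu>) * (B \<bullet> \<nu>) + (\<Sum>q\<in>UNIV. \<Sum>p\<in>UNIV. S p q * (e p \<bullet> A) * (e q \<bullet> B))"
    by (simp add: P_def inner_add_left inner_sum_left inner_commute[of \<nu>] sum_distrib_right)
  also have "\<dots> = (A \<bullet> \<nu>) * (B \<bullet> \<nu>) + (\<Sum>p\<in>UNIV. \<Sum>q\<in>UNIV. S p q * (e p \<bullet> A) * (e q \<bullet> B))"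
    by (subst sum.swap) simp
  finally show ?thesis .
qed

text \<open>The Gauss equation, with second fundamental form $X \cdot \partial_i\partial_j X = -\sigma_{ij}$.\<close>

lemma induced_metric_sphere:
  assumes S: "sphere_parametrization V X" and z: "z \<in> V"
  shows "metric_germ (induced_metric X) z"
    and "riemann (induced_metric X) z r s m n =
      induced_metric X z $ r $ m * induced_metric X z $ s $ n
      - induced_metric X z $ r $ n * induced_metric X z $ s $ m"
proof -
  let ?\<sigma> = "induced_metric X"
  have V: "open V" and X: "smooth_on V X" and n1: "\<And>z. z \<in> V \<Longrightarrow> X z \<bullet> X z = 1"
    and im: "\<And>c::real^2. (\<Sum>i\<in>UNIV. c $ i *\<^sub>R partial i X z) = 0 \<Longrightarrow> c = 0"
    using S z by (auto simp: sphere_parametrization_def dot_square_norm)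
  have X1: "smooth_on V (partial i X)" for i by (rule smooth_on_partial[OF X])
  have X2: "smooth_on V (partial i (partial j X))" for i j by (rule smooth_on_partial[OF X1])
  note D = smooth_on_differentiable[OF X] smooth_on_differentiable[OF X1] smooth_on_differentiable[OF X2]
  have evV: "\<forall>\<^sub>F y in nhds z. y \<in> V" using V z by (rule eventually_nhds_in_open)
  have comm: "partial i (partial j f) y = partial j (partial i f) y"
    if f: "smooth_on V f" and y: "y \<in> V" for i j y and f :: "real^2 \<Rightarrow> real^3"
  proof -
    have "partial i (partial j f) y $ k = partial j (partial i f) y $ k" for k
      using twice_diff_sym[OF smooth_on_linear_twice_diff(1)[OF V y f bounded_linear_vec_nth[of k]], of i j]
        smooth_on_linear_twice_diff(2)[OF V y f bounded_linear_vec_nth[of k]] by simp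
    then show ?thesis by (simp add: vec_eq_iff)
  qed
  have \<sigma>: "?\<sigma> y $ i $ j = partial i X y \<bullet> partial j X y" for y i j
    by (simp add: induced_metric_def)
  have orth: "partial i X y \<bullet> X y = 0" if "y \<in> V" for i y
  proof -
    have "\<forall>\<^sub>F w in nhds y. X w \<bullet> X w = 1"
      using eventually_nhds_in_open[OF V that] by eventually_elim (rule n1)
    from partial_cong_ev[OF this, of i] show ?thesis
      by (simp add: partial_inner D that inner_commute)
  qed
  have normal: "partial i (partial j X) z \<bullet> X z = - (partial i X z \<bullet> partial j X z)" for i j
  proof -
    have "\<forall>\<^sub>F w in nhds z. partial j X w \<bullet> X w = 0"
      using evV by eventually_elim (rule orth)
    from partial_cong_ev[OF this, of i] show ?thesis
      by (simp add: partial_inner D z inner_commute)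
  qed
  have inv: "invertible (?\<sigma> z)"
  proof -
    \<comment> \<open>The induced metric is a Gram matrix: a kernel vector yields a tangent vector
      of length zero, to which the immersion property applies.\<close>
    have "c = 0" if "?\<sigma> z *v c = 0" for c
    proof (rule im)
      let ?w = "\<Sum>i\<in>UNIV. c $ i *\<^sub>R partial i X z"
      have "?w \<bullet> ?w = c \<bullet> (?\<sigma> z *v c)"
        unfolding inner_matrix_vector \<sigma> inner_sum_left inner_sum_right
        by (subst sum.swap) (simp add: mult_ac)
      then show "?w = 0" using that by simp
    qed
    then show ?thesis using matrix_left_invertible_ker invertible_left_inverse by blast
  qed
  have "twice_diff (\<lambda>y. ?\<sigma> y $ i $ j) z" for i j
    unfolding \<sigma> inner_vec_def inner_real_def
    by (intro twice_diff_sum twice_diff_mult smooth_on_linear_twice_diff(1)[OF V z X1 bounded_linear_vec_nth])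
       simp
  then show G: "metric_germ ?\<sigma> z"
    using inv by (simp add: metric_germ_def transpose_def vec_eq_iff \<sigma> inner_commute)
  have chr: "chris_low ?\<sigma> r i j y = partial r X y \<bullet> partial i (partial j X) y" if "y \<in> V" for r i j y
    using comm[OF X that, of r i] comm[OF X that, of r j] comm[OF X that, of i j]
    by (simp add: chris_low_def \<sigma> partial_inner D that inner_commute)
  have dchr: "partial m (chris_low ?\<sigma> r i j) z = partial m (partial r X) z \<bullet> partial i (partial j X) z
      + partial r X z \<bullet> partial m (partial i (partial j X)) z" for m r i j
  proof -
    have "\<forall>\<^sub>F y in nhds z. chris_low ?\<sigma> r i j y = partial r X y \<bullet> partial i (partial j X) y"
      using evV by eventually_elim (rule chr)
    from partial_cong_ev[OF this, of m] show ?thesis by (simp add: partial_inner D z)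
  qed
  \<comment> \<open>\<open>christoffel_square\<close> is the tangential part of the inner product of
    the two second derivatives; what is left is the product of normal components, given by
    \<open>normal\<close>.\<close>
  have dec: "partial i (partial j X) z \<bullet> partial k (partial l X) z
      - christoffel_square ?\<sigma> z i j k l = ?\<sigma> z $ i $ j * ?\<sigma> z $ k $ l" for i j k l
  proof -
    have g: "(\<Sum>p\<in>UNIV. ginv ?\<sigma> z i p * (partial p X z \<bullet> partial j X z)) = (if i = j then 1 else 0)" for i j
      using ginv_left[of ?\<sigma> z, OF inv] unfolding \<sigma> .
    note inner_frame_expansion[where e = "\<lambda>i. partial i X z" and S = "ginv ?\<sigma> z", OF n1[OF z] orth[OF z] im g
        metric_germ_symE(5)[OF G], of "partial i (partial j X) z" "partial k (partial l X) z"]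
    then show ?thesis
      unfolding christoffel_square_def chr[OF z] \<sigma> normal by simp
  qed
  \<comment> \<open>The third derivatives of \<open>X\<close> in \<open>dchr\<close> cancel by
    \<open>comm\<close>; two instances of \<open>dec\<close> account for all other terms.\<close>
  show "riemann ?\<sigma> z r s m n = ?\<sigma> z $ r $ m * ?\<sigma> z $ s $ n - ?\<sigma> z $ r $ n * ?\<sigma> z $ s $ m"
    unfolding riemann_lowered[OF G] dchr
    using dec[of m r n s] dec[of n r m s] comm[OF X1 z, of m n s] metric_germ_symE(1)[OF G]
    by (simp add: algebra_simps)
qed

section \<open>Contractions for a fibre of constant curvature\<close>

lemma sum3_factor:
  fixes A :: "'j::finite \<Rightarrow> real" and B :: "'i::finite \<Rightarrow> 'k::finite \<Rightarrow> real"
  shows "(\<Sum>i\<in>UNIV. \<Sum>j\<in>UNIV. \<Sum>k\<in>UNIV. A j * B i k) = (\<Sum>j\<in>UNIV. A j) * (\<Sum>i\<in>UNIV. \<Sum>k\<in>UNIV. B i k)"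
    and "(\<Sum>i\<in>UNIV. \<Sum>k\<in>UNIV. \<Sum>j\<in>UNIV. A j * B i k) = (\<Sum>j\<in>UNIV. A j) * (\<Sum>i\<in>UNIV. \<Sum>k\<in>UNIV. B i k)"
  by (subst sum.swap, simp only: sum_distrib_left[symmetric] sum_distrib_right[symmetric])
     (simp only: sum_distrib_left[symmetric] sum_distrib_right[symmetric])

text \<open>Contractions of the constant curvature tensor are pure algebra, so they are done without
  a point or derivatives and then applied to the fibre metric and its inverse.\<close>

locale metric_pair =
  fixes g gi :: "'b::finite \<Rightarrow> 'b \<Rightarrow> real"
  assumes inv: "(\<Sum>j\<in>UNIV. gi i j * g j k) = (if i = k then 1 else 0)"
    and g_sym: "g i j = g j i" and gi_sym: "gi i j = gi j i"
begin

definition K :: "'b \<Rightarrow> 'b \<Rightarrow> 'b \<Rightarrow> 'b \<Rightarrow> real" where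
  "K a b c d = g a c * g b d - g a d * g b c"

lemma contract1: "(\<Sum>j\<in>UNIV. gi i j * g k j) = (if i = k then 1 else 0)"
  using inv[of i k] by (simp add: g_sym)

lemma contract2: "(\<Sum>i\<in>UNIV. \<Sum>k\<in>UNIV. gi a i * gi c k * g i k) = gi a c"
  unfolding mult.assoc sum_distrib_left[symmetric] contract1 by (rule sum_mult_delta)

lemma contract3: "(\<Sum>a\<in>UNIV. \<Sum>c\<in>UNIV. gi a c * g l c * g a m) = g l m"
  unfolding sum_distrib_right[symmetric] contract1 by (rule sum_mult_delta)

lemma trace: "(\<Sum>a\<in>UNIV. \<Sum>c\<in>UNIV. gi a c * g a c) = real CARD('b)"
  unfolding contract1 by simp

lemma raise_K:
  "(\<Sum>i\<in>UNIV. \<Sum>j\<in>UNIV. \<Sum>k\<in>UNIV. gi a i * gi b j * gi c k * K m i j k)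
    = (if b = m then 1 else 0) * gi a c - (if c = m then 1 else 0) * gi a b"
proof -
  have "(\<Sum>i\<in>UNIV. \<Sum>j\<in>UNIV. \<Sum>k\<in>UNIV. gi a i * gi b j * gi c k * K m i j k)
    = (\<Sum>i\<in>UNIV. \<Sum>j\<in>UNIV. \<Sum>k\<in>UNIV. (gi b j * g m j) * (gi a i * gi c k * g i k))
    - (\<Sum>i\<in>UNIV. \<Sum>j\<in>UNIV. \<Sum>k\<in>UNIV. (gi c k * g m k) * (gi a i * gi b j * g i j))"
    unfolding sum_subtractf[symmetric] by (intro sum.cong refl) (simp add: K_def algebra_simps)
  then show ?thesis unfolding sum3_factor contract1 contract2 .
qed

lemma ricci_K: "(\<Sum>m\<in>UNIV. \<Sum>l\<in>UNIV. gi m l * K l s m n) = (real CARD('b) - 1) * g s n"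
proof -
  have "(\<Sum>m\<in>UNIV. \<Sum>l\<in>UNIV. gi m l * K l s m n)
    = (\<Sum>m\<in>UNIV. \<Sum>l\<in>UNIV. gi m l * g m l) * g s n - (\<Sum>m\<in>UNIV. \<Sum>l\<in>UNIV. gi m l * g n l * g m s)"
    unfolding sum_distrib_right sum_subtractf[symmetric]
    by (intro sum.cong refl) (simp add: K_def g_sym algebra_simps)
  then show ?thesis unfolding trace contract3 by (simp add: g_sym algebra_simps)
qed

lemma ricci_K': "(\<Sum>a\<in>UNIV. \<Sum>b\<in>UNIV. gi a b * K m a n b) = (real CARD('b) - 1) * g m n"
proof -
  have "(\<Sum>a\<in>UNIV. \<Sum>b\<in>UNIV. gi a b * K m a n b) = (\<Sum>b\<in>UNIV. \<Sum>a\<in>UNIV. gi b a * K a m b n)"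
    by (subst sum.swap, intro sum.cong refl) (simp add: K_def g_sym gi_sym algebra_simps)
  then show ?thesis by (simp only: ricci_K)
qed

text \<open>The left factor is \<open>K\<close> with its last three indices raised, by
  \<open>raise_K\<close>. Each of its two deltas leaves a trace of \<open>K\<close>, and
  antisymmetry of \<open>K\<close> in the last pair makes the two traces add up.\<close>

lemma square_K:
  "(\<Sum>a\<in>UNIV. \<Sum>b\<in>UNIV. \<Sum>c\<in>UNIV.
     ((if b = m then 1 else 0) * gi a c - (if c = m then 1 else 0) * gi a b) * K l a b c)
    = 2 * (real CARD('b) - 1) * g l m"
proof -
  let ?d = "\<lambda>b::'b. if b = m then 1 else 0 :: real"
  have 1: "(\<Sum>a\<in>UNIV. \<Sum>b\<in>UNIV. \<Sum>c\<in>UNIV. ?d b * (gi a c * K l a b c)) = (real CARD('b) - 1) * g l m"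
  proof -
    have "(\<Sum>a\<in>UNIV. \<Sum>b\<in>UNIV. \<Sum>c\<in>UNIV. ?d b * (gi a c * K l a b c)) = (\<Sum>a\<in>UNIV. \<Sum>c\<in>UNIV. gi a c * K l a m c)"
      unfolding sum_distrib_left[symmetric] by (simp only: sum_mult_delta)
    then show ?thesis by (simp only: ricci_K')
  qed
  have 2: "(\<Sum>a\<in>UNIV. \<Sum>b\<in>UNIV. \<Sum>c\<in>UNIV. ?d c * (gi a b * K l a b c)) = - ((real CARD('b) - 1) * g l m)"
  proof -
    have "(\<Sum>a\<in>UNIV. \<Sum>b\<in>UNIV. \<Sum>c\<in>UNIV. ?d c * (gi a b * K l a b c)) = (\<Sum>a\<in>UNIV. \<Sum>b\<in>UNIV. gi a b * K l a b m)"
      by (simp only: sum_mult_delta)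
    also have "\<dots> = - (\<Sum>a\<in>UNIV. \<Sum>b\<in>UNIV. gi a b * K l a m b)"
      unfolding sum_negf[symmetric] by (intro sum.cong refl) (simp add: K_def algebra_simps)
    finally show ?thesis by (simp only: ricci_K')
  qed
  have "(\<Sum>a\<in>UNIV. \<Sum>b\<in>UNIV. \<Sum>c\<in>UNIV. (?d b * gi a c - ?d c * gi a b) * K l a b c)
     = (\<Sum>a\<in>UNIV. \<Sum>b\<in>UNIV. \<Sum>c\<in>UNIV. ?d b * (gi a c * K l a b c))
      - (\<Sum>a\<in>UNIV. \<Sum>b\<in>UNIV. \<Sum>c\<in>UNIV. ?d c * (gi a b * K l a b c))"
    unfolding sum_subtractf[symmetric] by (intro sum.cong refl) (simp only: left_diff_distrib mult.assoc)
  then show ?thesis unfolding 1 2 by simp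
qed

end

lemma metric_germ_pair: "metric_germ g x \<Longrightarrow> metric_pair (\<lambda>i j. g x $ i $ j) (ginv g x)"
proof
  assume G: "metric_germ g x"
  fix i j k
  show "(\<Sum>j\<in>UNIV. ginv g x i j * g x $ j $ k) = (if i = k then 1 else 0)"
    using G by (intro ginv_left) (simp add: metric_germ_def)
  show "g x $ i $ j = g x $ j $ i" "ginv g x i j = ginv g x j i"
    by (rule metric_germ_symE[OF G])+
qed

text \<open>These rules move every factor into the innermost sum and sort it, so that nested
  contractions can be compared term by term.\<close>

lemmas sum_push = sum_distrib_left sum_distrib_right sum_divide_distrib sum_negf mult_ac

definition ricci_square :: "(real^'n::finite \<Rightarrow> real^'n^'n) \<Rightarrow> real^'n \<Rightarrow> real" where
  "ricci_square g x = (\<Sum>i\<in>UNIV. \<Sum>j\<in>UNIV. ricci g x i j * ricci_up2 g x i j)"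

definition riemann_square :: "(real^'n::finite \<Rightarrow> real^'n^'n) \<Rightarrow> real^'n \<Rightarrow> real" where
  "riemann_square g x = (\<Sum>m\<in>UNIV. \<Sum>l\<in>UNIV. \<Sum>a\<in>UNIV. \<Sum>b\<in>UNIV. \<Sum>c\<in>UNIV.
     ginv g x m l * riemann_up3 g x m a b c * riemann g x l a b c)"

lemma gauss_bonnet_eq:
  "gauss_bonnet g x = (ricci_scalar g x)\<^sup>2 - 4 * ricci_square g x + riemann_square g x"
  by (simp add: gauss_bonnet_def ricci_square_def riemann_square_def)

locale warped_constant_curvature = warped_product h \<gamma> u x
  for h :: "real^'a::finite \<Rightarrow> real^'a^'a" and \<gamma> :: "real^'b::finite \<Rightarrow> real^'b^'b"
    and u :: "real^'a \<Rightarrow> real" and x :: "real^('a + 'b)" +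
  fixes c :: real
  assumes fiber: "riemann \<gamma> (rpart x) i j k l = c * kulkarni gx i j k l"
begin

sublocale fib: metric_pair "\<lambda>i j. gx $ i $ j" "ginv \<gamma> (rpart x)"
  by (rule metric_germ_pair[OF \<gamma>])

abbreviation (input) "hi \<equiv> ginv h (lpart x)"
abbreviation (input) "gi \<equiv> ginv \<gamma> (rpart x)"

text \<open>The actual metric on the fibre is \<open>ux\<close> times \<open>gx\<close>, so fibre
  planes have sectional curvature \<kappa> / ux^2. This is the source of the powers of
  \<open>ux\<close> in the scalar formulas below.\<close>

definition \<kappa> :: real where "\<kappa> = ux * c - warp_norm"

definition N :: real where "N = real CARD('b)"

lemma riemann_RRRR: "riemann W x (Inr i) (Inr j) (Inr k) (Inr l) = \<kappa> * fib.K i j k l"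
  by (simp add: riemann_W_RRRR fiber kulkarni_def fib.K_def \<kappa>_def algebra_simps)

lemmas riemann_blocks = riemann_W_LLLL riemann_RRRR riemann_W_LRLR riemann_W_zero riemann_W_sym

definition trP :: real where
  "trP = (\<Sum>a\<in>UNIV. \<Sum>b\<in>UNIV. hi a b * warp_hessian a b)"

definition \<rho> :: real where "\<rho> = trP + \<kappa> * (N - 1) / ux"

definition base_ricci :: "'a \<Rightarrow> 'a \<Rightarrow> real" where
  "base_ricci a b = ricci h (lpart x) a b + N / ux * warp_hessian a b"

section \<open>Ricci tensor and quadratic invariants of the warped product\<close>

lemma ricci_W:
  "ricci W x (Inl a) (Inl b) = base_ricci a b"
  "ricci W x (Inr i) (Inr j) = \<rho> * gx $ i $ j"
  "ricci W x (Inl a) (Inr j) = 0"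
  "ricci W x (Inr i) (Inl b) = 0"
proof -
  have hinv: "invertible hx" using h by (simp add: metric_germ_def)
  have "ricci W x (Inl a) (Inl b) = ricci h (lpart x) a b
      + (\<Sum>m\<in>UNIV. \<Sum>l\<in>UNIV. gi m l * gx $ m $ l) * (warp_hessian a b / ux)"
    by (simp add: ricci_eq[of W x, OF ginv_W(1)] ricci_eq[of h, OF hinv] sum_UNIV_Plus ginv_W riemann_blocks
        sum_push gx_sym)
  then show "ricci W x (Inl a) (Inl b) = base_ricci a b"
    by (simp add: fib.trace base_ricci_def N_def)
  have "ricci W x (Inr i) (Inr j) = trP * gx $ i $ j
      + (\<Sum>m\<in>UNIV. \<Sum>l\<in>UNIV. gi m l * fib.K l i m j) * (\<kappa> / ux)"
    by (simp add: ricci_eq[of W x, OF ginv_W(1)] sum_UNIV_Plus ginv_W riemann_blocks trP_def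
        sum_push warp_hessian_sym)
  then show "ricci W x (Inr i) (Inr j) = \<rho> * gx $ i $ j"
    by (simp add: fib.ricci_K \<rho>_def N_def algebra_simps diff_divide_distrib)
  show "ricci W x (Inl a) (Inr j) = 0" "ricci W x (Inr i) (Inl b) = 0"
    by (simp_all add: ricci_eq[of W x, OF ginv_W(1)] sum_UNIV_Plus ginv_W riemann_blocks)
qed

lemma ricci_scalar_W:
  "ricci_scalar W x = ricci_scalar h (lpart x) + 2 * N * trP / ux + \<kappa> * N * (N - 1) / ux\<^sup>2"
proof -
  have "ricci_scalar W x = ricci_scalar h (lpart x) + trP * (N / ux)
      + (\<Sum>i\<in>UNIV. \<Sum>j\<in>UNIV. gi i j * gx $ i $ j) * (\<rho> / ux)"
    by (simp add: ricci_scalar_def sum_UNIV_Plus ginv_W ricci_W base_ricci_def trP_def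
        sum_push sum.distrib add_divide_distrib distrib_left)
  then show ?thesis
    using u0 by (simp add: fib.trace \<rho>_def N_def field_simps power2_eq_square)
qed

lemma ricci_up2_W:
  "ricci_up2 W x (Inl a) (Inl b) = (\<Sum>i\<in>UNIV. \<Sum>j\<in>UNIV. hi a i * hi b j * base_ricci i j)"
  "ricci_up2 W x (Inr i) (Inr j) = \<rho> / ux\<^sup>2 * gi i j"
  "ricci_up2 W x (Inl a) (Inr j) = 0"
  "ricci_up2 W x (Inr i) (Inl b) = 0"
proof -
  have "ricci_up2 W x (Inr i) (Inr j)
      = (\<Sum>k\<in>UNIV. \<Sum>l\<in>UNIV. gi i k * gi j l * gx $ k $ l) * (\<rho> / ux\<^sup>2)"
    by (simp add: ricci_up2_def sum_UNIV_Plus ginv_W ricci_W sum_push power2_eq_square)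
  then show "ricci_up2 W x (Inr i) (Inr j) = \<rho> / ux\<^sup>2 * gi i j"
    by (simp add: fib.contract2)
qed (simp_all add: ricci_up2_def sum_UNIV_Plus ginv_W ricci_W)

lemma ricci_square_W:
  "ricci_square W x = (\<Sum>a\<in>UNIV. \<Sum>b\<in>UNIV. base_ricci a b
      * (\<Sum>i\<in>UNIV. \<Sum>j\<in>UNIV. hi a i * hi b j * base_ricci i j)) + N * (\<rho> / ux)\<^sup>2"
proof -
  have "ricci_square W x = (\<Sum>a\<in>UNIV. \<Sum>b\<in>UNIV. base_ricci a b
      * (\<Sum>i\<in>UNIV. \<Sum>j\<in>UNIV. hi a i * hi b j * base_ricci i j))
      + (\<Sum>i\<in>UNIV. \<Sum>j\<in>UNIV. gi i j * gx $ i $ j) * (\<rho> / ux)\<^sup>2"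
    by (simp add: ricci_square_def sum_UNIV_Plus ricci_up2_W ricci_W
        sum_push power2_eq_square)
  then show ?thesis by (simp add: fib.trace N_def)
qed

definition P_up :: "'a \<Rightarrow> 'a \<Rightarrow> real" where
  "P_up m b = (\<Sum>j\<in>UNIV. hi b j * warp_hessian m j)"

lemma riemann_up3_W:
  "riemann_up3 W x (Inl m) (Inl a) (Inl b) (Inl d) = riemann_up3 h (lpart x) m a b d"
  "riemann_up3 W x (Inl m) (Inr i) (Inl b) (Inr k) = gi i k * P_up m b / ux\<^sup>2"
  "riemann_up3 W x (Inl m) (Inr i) (Inr k) (Inl b) = - gi i k * P_up m b / ux\<^sup>2"
  "riemann_up3 W x (Inr m') (Inl a) (Inl b) (Inr k)
     = - (if k = m' then 1 else 0) * (\<Sum>i\<in>UNIV. hi a i * P_up i b) / ux"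
  "riemann_up3 W x (Inr m') (Inl a) (Inr k) (Inl b)
     = (if k = m' then 1 else 0) * (\<Sum>i\<in>UNIV. hi a i * P_up i b) / ux"
  "riemann_up3 W x (Inr m') (Inr i) (Inr j) (Inr k)
     = \<kappa> / ux ^ 3 * ((if j = m' then 1 else 0) * gi i k - (if k = m' then 1 else 0) * gi i j)"
proof -
  show "riemann_up3 W x (Inl m) (Inl a) (Inl b) (Inl d) = riemann_up3 h (lpart x) m a b d"
    by (simp add: riemann_up3_def sum_UNIV_Plus ginv_W riemann_blocks)
  have r1: "riemann_up3 W x (Inl m) (Inr i) (Inl b) (Inr k)
     = (\<Sum>i'\<in>UNIV. \<Sum>j\<in>UNIV. \<Sum>k'\<in>UNIV. (hi b j * warp_hessian m j) * (gi i i' * gi k k' * gx $ i' $ k')) / ux\<^sup>2"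
    by (simp add: riemann_up3_def sum_UNIV_Plus ginv_W riemann_blocks warp_hessian_sym
       sum_push power2_eq_square)
  show "riemann_up3 W x (Inl m) (Inr i) (Inl b) (Inr k) = gi i k * P_up m b / ux\<^sup>2"
    unfolding r1 sum3_factor fib.contract2 P_up_def by simp
  have r2: "riemann_up3 W x (Inl m) (Inr i) (Inr k) (Inl b)
     = - (\<Sum>i'\<in>UNIV. \<Sum>k'\<in>UNIV. \<Sum>j\<in>UNIV. (hi b j * warp_hessian m j) * (gi i i' * gi k k' * gx $ i' $ k')) / ux\<^sup>2"
    by (simp add: riemann_up3_def sum_UNIV_Plus ginv_W riemann_blocks warp_hessian_sym
       sum_push power2_eq_square)
  show "riemann_up3 W x (Inl m) (Inr i) (Inr k) (Inl b) = - gi i k * P_up m b / ux\<^sup>2"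
    unfolding r2 sum3_factor fib.contract2 P_up_def by simp
  have PP: "(\<Sum>i\<in>UNIV. \<Sum>j\<in>UNIV. hi a i * hi b j * warp_hessian i j) = (\<Sum>i\<in>UNIV. hi a i * P_up i b)" for a b
    by (simp add: P_up_def sum_push)
  have r3: "riemann_up3 W x (Inr m') (Inl a) (Inl b) (Inr k)
     = - (\<Sum>i\<in>UNIV. \<Sum>j\<in>UNIV. \<Sum>k'\<in>UNIV. (gi k k' * gx $ m' $ k') * (hi a i * hi b j * warp_hessian i j)) / ux"
    by (simp add: riemann_up3_def sum_UNIV_Plus ginv_W riemann_blocks sum_push)
  show "riemann_up3 W x (Inr m') (Inl a) (Inl b) (Inr k)
     = - (if k = m' then 1 else 0) * (\<Sum>i\<in>UNIV. hi a i * P_up i b) / ux"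
    unfolding r3 sum3_factor fib.contract1 PP by simp
  have r4: "riemann_up3 W x (Inr m') (Inl a) (Inr k) (Inl b)
     = (\<Sum>i\<in>UNIV. \<Sum>k'\<in>UNIV. \<Sum>j\<in>UNIV. (gi k k' * gx $ m' $ k') * (hi a i * hi b j * warp_hessian i j)) / ux"
    by (simp add: riemann_up3_def sum_UNIV_Plus ginv_W riemann_blocks sum_push)
  show "riemann_up3 W x (Inr m') (Inl a) (Inr k) (Inl b)
     = (if k = m' then 1 else 0) * (\<Sum>i\<in>UNIV. hi a i * P_up i b) / ux"
    unfolding r4 sum3_factor fib.contract1 PP by simp
  have r5: "riemann_up3 W x (Inr m') (Inr i) (Inr j) (Inr k)
     = \<kappa> / ux ^ 3 * (\<Sum>i'\<in>UNIV. \<Sum>j'\<in>UNIV. \<Sum>k'\<in>UNIV. gi i i' * gi j j' * gi k k' * fib.K m' i' j' k')"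
    by (simp add: riemann_up3_def sum_UNIV_Plus ginv_W riemann_blocks sum_push power3_eq_cube)
  show "riemann_up3 W x (Inr m') (Inr i) (Inr j) (Inr k)
     = \<kappa> / ux ^ 3 * ((if j = m' then 1 else 0) * gi i k - (if k = m' then 1 else 0) * gi i j)"
    unfolding r5 fib.raise_K ..
qed

text \<open>The squared norm of \<open>warp_hessian\<close> with respect to the base metric.\<close>

definition P_square :: real where
  "P_square = (\<Sum>a\<in>UNIV. \<Sum>b\<in>UNIV. (\<Sum>i\<in>UNIV. hi a i * P_up i b) * warp_hessian a b)"

text \<open>The mixed terms come with a factor 2 because the last antisymmetric index pair then
  holds one base and one fibre index, in either order.\<close>

lemma riemann_contracted_W:
  "(\<Sum>p\<in>UNIV. \<Sum>q\<in>UNIV. \<Sum>r\<in>UNIV. riemann_up3 W x (Inl m) p q r * riemann W x (Inl l) p q r)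
    = (\<Sum>p\<in>UNIV. \<Sum>q\<in>UNIV. \<Sum>r\<in>UNIV. riemann_up3 h (lpart x) m p q r * riemann h (lpart x) l p q r)
      + 2 * N / ux\<^sup>2 * (\<Sum>b\<in>UNIV. P_up m b * warp_hessian l b)"
  "(\<Sum>p\<in>UNIV. \<Sum>q\<in>UNIV. \<Sum>r\<in>UNIV. riemann_up3 W x (Inr m') p q r * riemann W x (Inr l') p q r)
    = (2 / ux * P_square + 2 * (N - 1) * \<kappa>\<^sup>2 / ux ^ 3) * gx $ l' $ m'"
proof -
  have s1: "(\<Sum>i\<in>UNIV. \<Sum>b\<in>UNIV. \<Sum>k\<in>UNIV. (P_up m b * warp_hessian l b) * (gi i k * gx $ i $ k))
      = N * (\<Sum>b\<in>UNIV. P_up m b * warp_hessian l b)"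
    "(\<Sum>i\<in>UNIV. \<Sum>k\<in>UNIV. \<Sum>b\<in>UNIV. (P_up m b * warp_hessian l b) * (gi i k * gx $ i $ k))
      = N * (\<Sum>b\<in>UNIV. P_up m b * warp_hessian l b)"
    unfolding sum3_factor fib.trace N_def by simp_all
  have "(\<Sum>p\<in>UNIV. \<Sum>q\<in>UNIV. \<Sum>r\<in>UNIV. riemann_up3 W x (Inl m) p q r * riemann W x (Inl l) p q r)
    = (\<Sum>p\<in>UNIV. \<Sum>q\<in>UNIV. \<Sum>r\<in>UNIV. riemann_up3 h (lpart x) m p q r * riemann h (lpart x) l p q r)
      + (\<Sum>i\<in>UNIV. \<Sum>b\<in>UNIV. \<Sum>k\<in>UNIV. (P_up m b * warp_hessian l b) * (gi i k * gx $ i $ k)) / ux\<^sup>2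
      + (\<Sum>i\<in>UNIV. \<Sum>k\<in>UNIV. \<Sum>b\<in>UNIV. (P_up m b * warp_hessian l b) * (gi i k * gx $ i $ k)) / ux\<^sup>2"
    by (simp add: sum_UNIV_Plus riemann_up3_W riemann_blocks sum.distrib warp_hessian_sym sum_push)
  then show "(\<Sum>p\<in>UNIV. \<Sum>q\<in>UNIV. \<Sum>r\<in>UNIV. riemann_up3 W x (Inl m) p q r * riemann W x (Inl l) p q r)
    = (\<Sum>p\<in>UNIV. \<Sum>q\<in>UNIV. \<Sum>r\<in>UNIV. riemann_up3 h (lpart x) m p q r * riemann h (lpart x) l p q r)
      + 2 * N / ux\<^sup>2 * (\<Sum>b\<in>UNIV. P_up m b * warp_hessian l b)"
    unfolding s1 by (simp add: field_simps)
  let ?PP = "\<lambda>a b. (\<Sum>i\<in>UNIV. hi a i * P_up i b) * warp_hessian a b"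
  have s2: "(\<Sum>a\<in>UNIV. \<Sum>b\<in>UNIV. \<Sum>k\<in>UNIV. ((if k = m' then 1 else 0) * gx $ l' $ k) * ?PP a b)
      = gx $ l' $ m' * P_square"
    "(\<Sum>a\<in>UNIV. \<Sum>k\<in>UNIV. \<Sum>b\<in>UNIV. ((if k = m' then 1 else 0) * gx $ l' $ k) * ?PP a b)
      = gx $ l' $ m' * P_square"
    unfolding sum3_factor sum_mult_delta P_square_def by (rule refl)+
  have "(\<Sum>p\<in>UNIV. \<Sum>q\<in>UNIV. \<Sum>r\<in>UNIV. riemann_up3 W x (Inr m') p q r * riemann W x (Inr l') p q r)
    = (\<Sum>a\<in>UNIV. \<Sum>b\<in>UNIV. \<Sum>k\<in>UNIV. ((if k = m' then 1 else 0) * gx $ l' $ k) * ?PP a b) / ux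
    + (\<Sum>a\<in>UNIV. \<Sum>k\<in>UNIV. \<Sum>b\<in>UNIV. ((if k = m' then 1 else 0) * gx $ l' $ k) * ?PP a b) / ux
    + \<kappa>\<^sup>2 / ux ^ 3 * (\<Sum>i\<in>UNIV. \<Sum>j\<in>UNIV. \<Sum>k\<in>UNIV.
        ((if j = m' then 1 else 0) * gi i k - (if k = m' then 1 else 0) * gi i j) * fib.K l' i j k)"
    unfolding sum_UNIV_Plus riemann_up3_W riemann_blocks sum_divide_distrib sum_distrib_left[of "\<kappa>\<^sup>2 / ux ^ 3"]
    by (simp only: sum.distrib[symmetric] mult_zero_right sum.neutral_const add_0_left add_0_right)
       (simp add: sum.distrib power2_eq_square mult_ac)
  then show "(\<Sum>p\<in>UNIV. \<Sum>q\<in>UNIV. \<Sum>r\<in>UNIV. riemann_up3 W x (Inr m') p q r * riemann W x (Inr l') p q r)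
    = (2 / ux * P_square + 2 * (N - 1) * \<kappa>\<^sup>2 / ux ^ 3) * gx $ l' $ m'"
    unfolding s2 fib.square_K by (simp add: N_def algebra_simps diff_divide_distrib)
qed

lemma P_square_eq: "(\<Sum>m\<in>UNIV. \<Sum>l\<in>UNIV. hi m l * (\<Sum>b\<in>UNIV. P_up m b * warp_hessian l b)) = P_square"
proof -
  have "P_square = (\<Sum>l\<in>UNIV. \<Sum>m\<in>UNIV. \<Sum>b\<in>UNIV. hi l m * P_up m b * warp_hessian l b)"
    unfolding P_square_def sum_distrib_right by (intro sum.cong refl sum.swap)
  also have "\<dots> = (\<Sum>m\<in>UNIV. \<Sum>l\<in>UNIV. \<Sum>b\<in>UNIV. hi m l * P_up m b * warp_hessian l b)"
    by (subst sum.swap) (simp add: metric_germ_symE(5)[OF h])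
  finally show ?thesis by (simp add: sum_push)
qed

text \<open>Of the factor 4 in front of \<open>P_square\<close>, one half comes from a first index
  in the base and one half from a first index in the fibre.\<close>

lemma riemann_square_W:
  "riemann_square W x = riemann_square h (lpart x) + 4 * N * P_square / ux\<^sup>2 + 2 * N * (N - 1) * \<kappa>\<^sup>2 / ux ^ 4"
proof -
  have rs: "riemann_square g y = (\<Sum>m\<in>UNIV. \<Sum>l\<in>UNIV. ginv g y m l
      * (\<Sum>a\<in>UNIV. \<Sum>b\<in>UNIV. \<Sum>c\<in>UNIV. riemann_up3 g y m a b c * riemann g y l a b c))"
    for g :: "real^'n::finite \<Rightarrow> real^'n^'n" and y
    by (simp add: riemann_square_def sum_distrib_left mult.assoc)
  have "riemann_square W x = riemann_square h (lpart x) + 2 * N / ux\<^sup>2 * P_square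
    + (2 / ux * P_square + 2 * (N - 1) * \<kappa>\<^sup>2 / ux ^ 3) / ux * (\<Sum>m\<in>UNIV. \<Sum>l\<in>UNIV. gi m l * gx $ m $ l)"
  proof -
    define Q where "Q p q = (\<Sum>a\<in>UNIV. \<Sum>b\<in>UNIV. \<Sum>c\<in>UNIV. riemann_up3 W x p a b c * riemann W x q a b c)" for p q
    have rQ: "riemann_square W x = (\<Sum>p\<in>UNIV. \<Sum>q\<in>UNIV. ginv W x p q * Q p q)"
      by (simp only: rs Q_def)
    have Q: "Q (Inl m) (Inl l)
        = (\<Sum>p\<in>UNIV. \<Sum>q\<in>UNIV. \<Sum>r\<in>UNIV. riemann_up3 h (lpart x) m p q r * riemann h (lpart x) l p q r)
          + 2 * N / ux\<^sup>2 * (\<Sum>b\<in>UNIV. P_up m b * warp_hessian l b)"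
      "Q (Inr i) (Inr j) = (2 / ux * P_square + 2 * (N - 1) * \<kappa>\<^sup>2 / ux ^ 3) * gx $ i $ j" for m l i j
      unfolding Q_def riemann_contracted_W by (simp_all add: gx_sym)
    have lin: "(\<Sum>m\<in>UNIV. \<Sum>l\<in>UNIV. hi m l * (A m l + k * B m l))
      = (\<Sum>m\<in>UNIV. \<Sum>l\<in>UNIV. hi m l * A m l) + k * (\<Sum>m\<in>UNIV. \<Sum>l\<in>UNIV. hi m l * B m l)" for A B k
      by (simp add: distrib_left sum.distrib sum_distrib_left mult.left_commute)
    have 1: "(\<Sum>m\<in>UNIV. \<Sum>l\<in>UNIV. hi m l * Q (Inl m) (Inl l)) = riemann_square h (lpart x) + 2 * N / ux\<^sup>2 * P_square"
      unfolding Q lin rs P_square_eq ..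
    have 2: "(\<Sum>m\<in>UNIV. \<Sum>l\<in>UNIV. gi m l / ux * Q (Inr m) (Inr l))
      = (2 / ux * P_square + 2 * (N - 1) * \<kappa>\<^sup>2 / ux ^ 3) / ux * (\<Sum>m\<in>UNIV. \<Sum>l\<in>UNIV. gi m l * gx $ m $ l)"
      unfolding Q sum_distrib_left by (intro sum.cong refl) simp
    show ?thesis
      unfolding rQ sum_UNIV_Plus ginv_W 2[symmetric] 1[symmetric] by simp
  qed
  then show ?thesis
    unfolding fib.trace using u0 by (simp add: N_def field_simps eval_nat_numeral)
qed

text \<open>Each lowered term along the fibre is a multiple of \<open>gx\<close>, and raising an
  index turns \<open>gx\<close> into the Kronecker delta divided by \<open>ux\<close>. A vanishing
  \<open>warp_hessian\<close>, as for constant \<open>u\<close>, removes all terms that mix base and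
  fibre indices.\<close>

lemma EGB_fiber:
  assumes P0: "\<And>a b. warp_hessian a b = 0"
  shows "EGB \<alpha> \<Lambda> W x (Inr i) (Inr j) = (if i = j then 1 else 0) *
    (\<rho> / ux - ricci_scalar W x / 2 + \<alpha> * (2 * (ricci_scalar W x * \<rho> / ux - 2 * \<rho>\<^sup>2 / ux\<^sup>2
       - 2 * \<rho> * \<kappa> * (N - 1) / ux ^ 3 + 2 * (N - 1) * \<kappa>\<^sup>2 / ux ^ 4) - gauss_bonnet W x / 2) + \<Lambda>)"
proof -
  let ?R = "ricci_scalar W x" and ?GB = "gauss_bonnet W x"
  \<comment> \<open>\<open>E\<close> and \<open>H\<close> are coefficients relative to
    \<open>gx\<close> and not to the full block \<open>ux * gx\<close>, hence the later division by
    \<open>ux\<close>.\<close>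
  define E where "E = \<rho> - ux * ?R / 2"
  define H where "H = 2 * (?R * \<rho> - 2 * \<rho>\<^sup>2 / ux - 2 * \<rho> * \<kappa> * (N - 1) / ux\<^sup>2 + 2 * (N - 1) * \<kappa>\<^sup>2 / ux ^ 3)
      - ux * ?GB / 2"
  have PS: "P_square = 0" by (simp add: P_square_def P0)
  have up1: "ricci_up1 W x (Inr a) (Inr n) = \<rho> / ux * (if a = n then 1 else 0)" for a n
  proof -
    have "ricci_up1 W x (Inr a) (Inr n) = \<rho> / ux * (\<Sum>k\<in>UNIV. gi a k * gx $ k $ n)"
      by (simp add: ricci_up1_def sum_UNIV_Plus ginv_W ricci_W sum_push)
    then show ?thesis by (simp only: fib.inv)
  qed
  have t1: "(\<Sum>p\<in>UNIV. ricci W x (Inr m) p * ricci_up1 W x p (Inr n)) = \<rho>\<^sup>2 / ux * gx $ m $ n" for m n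
  proof -
    have "(\<Sum>p\<in>UNIV. ricci W x (Inr m) p * ricci_up1 W x p (Inr n))
      = (\<Sum>a\<in>UNIV. (\<rho>\<^sup>2 / ux * gx $ m $ a) * (if a = n then 1 else 0))"
      unfolding sum_UNIV_Plus ricci_W up1 by (simp add: power2_eq_square mult_ac)
    then show ?thesis by (simp only: sum_mult_delta)
  qed
  have t2: "(\<Sum>p\<in>UNIV. \<Sum>q\<in>UNIV. ricci_up2 W x p q * riemann W x (Inr m) p (Inr n) q)
      = \<rho> * \<kappa> * (N - 1) / ux\<^sup>2 * gx $ m $ n" for m n
  proof -
    have "(\<Sum>p\<in>UNIV. \<Sum>q\<in>UNIV. ricci_up2 W x p q * riemann W x (Inr m) p (Inr n) q)
      = \<rho> * \<kappa> / ux\<^sup>2 * (\<Sum>a\<in>UNIV. \<Sum>b\<in>UNIV. gi a b * fib.K m a n b)"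
      unfolding sum_UNIV_Plus ricci_up2_W riemann_blocks P0 by (simp add: sum_push)
    then show ?thesis by (simp add: fib.ricci_K' N_def)
  qed
  have H: "H_tensor W x (Inr m) (Inr n) = H * gx $ m $ n" for m n
    unfolding H_tensor_def ricci_W t1 t2 riemann_contracted_W PS W_nth
    by (simp add: H_def gx_sym algebra_simps)
  have E: "einstein W x (Inr m) (Inr n) = E * gx $ m $ n" for m n
    unfolding einstein_def ricci_W W_nth by (simp add: E_def algebra_simps)
  have "EGB \<alpha> \<Lambda> W x (Inr i) (Inr j) = (E + \<alpha> * H) / ux * (\<Sum>k\<in>UNIV. gi i k * gx $ k $ j)
      + \<Lambda> * (if i = j then 1 else 0)"
    unfolding EGB_def sum_UNIV_Plus ginv_W H E
    by (simp add: sum_distrib_left sum_divide_distrib add_divide_distrib distrib_left distrib_right sum.distrib mult_ac)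
  also have "\<dots> = (if i = j then 1 else 0) * ((E + \<alpha> * H) / ux + \<Lambda>)"
    by (simp add: fib.inv)
  also have "(E + \<alpha> * H) / ux = \<rho> / ux - ?R / 2 + \<alpha> * (2 * (?R * \<rho> / ux - 2 * \<rho>\<^sup>2 / ux\<^sup>2
       - 2 * \<rho> * \<kappa> * (N - 1) / ux ^ 3 + 2 * (N - 1) * \<kappa>\<^sup>2 / ux ^ 4) - ?GB / 2)"
    using u0 by (simp add: E_def H_def field_simps eval_nat_numeral)
  finally show ?thesis by (simp only: add.assoc)
qed

end

section \<open>The four-dimensional metric\<close>

definition vr_metric :: "(real^2 \<Rightarrow> real) \<Rightarrow> real^2 \<Rightarrow> real^2^2" where
  "vr_metric F p = vector [vector [- F p, 1], vector [1, 0]]"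

lemma vr_metric_nth [simp]:
  "vr_metric F p $ 1 $ 1 = - F p" "vr_metric F p $ 1 $ 2 = 1"
  "vr_metric F p $ 2 $ 1 = 1" "vr_metric F p $ 2 $ 2 = 0"
  by (simp_all add: vr_metric_def)

lemma partial_uminus: "f differentiable (at x) \<Longrightarrow> partial i (\<lambda>y. - f y) x = - partial i f x"
  using partial_diff[of "\<lambda>_. 0" x f i] by simp

lemma twice_diff_uminus:
  assumes "twice_diff f x"
  shows "twice_diff (\<lambda>y. - f y) x"
    and "partial j (partial i (\<lambda>y. - f y)) x = - partial j (partial i f) x"
  using twice_diff_diff[OF twice_diff_const assms, of 0] partial2_diff[OF twice_diff_const assms, of j i 0]
  by (simp_all add: partial_const[abs_def])

context
  fixes F :: "real^2 \<Rightarrow> real" and p :: "real^2"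
  assumes F: "twice_diff F p"
begin

abbreviation "F1 \<equiv> partial 1 F p"
abbreviation "F2 \<equiv> partial 2 F p"
abbreviation "F22 \<equiv> partial 2 (partial 2 F) p"

lemma vr_ginv:
  "invertible (vr_metric F p)"
  "ginv (vr_metric F) p 1 1 = 0" "ginv (vr_metric F) p 1 2 = 1"
  "ginv (vr_metric F) p 2 1 = 1" "ginv (vr_metric F) p 2 2 = F p"
proof -
  define B :: "2 \<Rightarrow> 2 \<Rightarrow> real" where
    "B i j = (if i = 1 then (if j = 1 then 0 else 1) else if j = 1 then 1 else F p)" for i j
  have *: "(\<Sum>m\<in>UNIV. B i m * vr_metric F p $ m $ j) = (if i = j then 1 else 0)" for i j
    using exhaust_2[of i] exhaust_2[of j] by (auto simp: sum_2 B_def)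
  show "invertible (vr_metric F p)"
    by (rule ginv_unique(1)[where g = "vr_metric F" and x = p, OF *])
  show "ginv (vr_metric F) p 1 1 = 0" "ginv (vr_metric F) p 1 2 = 1"
    "ginv (vr_metric F) p 2 1 = 1" "ginv (vr_metric F) p 2 2 = F p"
    by (simp_all add: ginv_unique(2)[where g = "vr_metric F" and x = p, OF *] B_def)
qed

lemma vr_germ: "metric_germ (vr_metric F) p"
proof -
  have "twice_diff (\<lambda>y. vr_metric F y $ i $ j) p" for i j
    using exhaust_2[of i] exhaust_2[of j]
    by (auto simp: twice_diff_uminus[OF F] twice_diff_const)
  moreover have "transpose (vr_metric F y) = vr_metric F y" for y
    by (simp add: transpose_def vec_eq_iff forall_2)
  ultimately show ?thesis using vr_ginv(1) by (simp add: metric_germ_def)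
qed

lemma vr_chris_low:
  "chris_low (vr_metric F) 1 1 1 p = - F1 / 2"
  "chris_low (vr_metric F) 2 1 1 p = F2 / 2"
  "chris_low (vr_metric F) 1 1 2 p = - F2 / 2"
  "chris_low (vr_metric F) 1 2 1 p = - F2 / 2"
  "chris_low (vr_metric F) 2 1 2 p = 0"
  "chris_low (vr_metric F) 2 2 1 p = 0"
  "chris_low (vr_metric F) 1 2 2 p = 0"
  "chris_low (vr_metric F) 2 2 2 p = 0"
  by (simp_all add: chris_low_def partial_uminus[OF twice_diff_at[OF F]])

text \<open>In dimension two the component with indices 1 2 1 2 determines the tensor, and there
  \<open>kulkarni\<close> is the determinant of the metric, which is -1.\<close>

lemma vr_riemann: "riemann (vr_metric F) p a b c d = - (F22 / 2) * kulkarni (vr_metric F p) a b c d"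
proof -
  let ?R = "riemann (vr_metric F) p"
  have 0: "?R 1 2 1 2 = F22 / 2"
    by (simp add: riemann_second_order[OF vr_germ] christoffel_square_def sum_2 vr_chris_low vr_ginv
        twice_diff_uminus[OF F] partial_const[abs_def])
  have a: "?R i i k l = 0" "?R i j k k = 0" for i j k l
    using riemann_antisym1[OF vr_germ, of i i k l] riemann_antisym2[OF vr_germ, of i j k k] by simp_all
  have 1: "?R 1 2 2 1 = - (F22 / 2)" "?R 2 1 1 2 = - (F22 / 2)" "?R 2 1 2 1 = F22 / 2"
    using riemann_antisym1[OF vr_germ, of 2 1 1 2] riemann_antisym2[OF vr_germ, of 1 2 2 1]
      riemann_antisym1[OF vr_germ, of 2 1 2 1] 0 by simp_all
  show ?thesis
    using exhaust_2[of a] exhaust_2[of b] exhaust_2[of c] exhaust_2[of d]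
    by (elim disjE) (simp_all add: a 0 1 kulkarni_def)
qed

lemma vr_ricci: "ricci (vr_metric F) p a b = - (F22 / 2) * vr_metric F p $ a $ b"
  using exhaust_2[of a] exhaust_2[of b]
  by (elim disjE) (simp_all add: ricci_eq[of "vr_metric F", OF vr_ginv(1)] sum_2 vr_ginv vr_riemann
      kulkarni_def)

lemma vr_ricci_scalar: "ricci_scalar (vr_metric F) p = - F22"
  by (simp add: ricci_scalar_def sum_2 vr_ginv vr_ricci)

lemma vr_riemann_square: "riemann_square (vr_metric F) p = F22\<^sup>2"
proof -
  have "riemann_up3 (vr_metric F) p m a b c
      = - (F22 / 2) * ((if b = m then 1 else 0) * ginv (vr_metric F) p a c
          - (if c = m then 1 else 0) * ginv (vr_metric F) p a b)" for m a b c
    using exhaust_2[of a] exhaust_2[of b] exhaust_2[of c] exhaust_2[of m]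
    by (elim disjE) (simp_all add: riemann_up3_def sum_2 vr_ginv vr_riemann kulkarni_def)
  then show ?thesis
    by (simp add: riemann_square_def sum_2 vr_ginv vr_riemann kulkarni_def power2_eq_square)
qed

end

section \<open>The four-dimensional metric as a warped product over the (v, r)-plane\<close>

lemma radius_partials:
  "partial 1 (\<lambda>y. (y $ 2)\<^sup>2) (p::real^2) = 0"
  "partial 2 (\<lambda>y. (y $ 2)\<^sup>2) (p::real^2) = 2 * p $ 2"
  "partial i (partial 1 (\<lambda>y. (y $ 2)\<^sup>2)) (p::real^2) = 0"
  "partial 1 (partial i (\<lambda>y. (y $ 2)\<^sup>2)) (p::real^2) = 0"
  "partial 2 (partial 2 (\<lambda>y. (y $ 2)\<^sup>2)) (p::real^2) = 2"
proof -
  note d = twice_diff_at[OF twice_diff_coord[of 2]]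
  have 1: "partial 1 (\<lambda>y. (y $ 2)\<^sup>2) = (\<lambda>p::real^2. 0)"
    and 2: "partial 2 (\<lambda>y. (y $ 2)\<^sup>2) = (\<lambda>p::real^2. 2 * p $ 2)"
    unfolding power2_eq_square by (auto simp: fun_eq_iff partial_mult d partial_coord)
  show "partial 1 (\<lambda>y. (y $ 2)\<^sup>2) p = 0"
    "partial 2 (\<lambda>y. (y $ 2)\<^sup>2) p = 2 * p $ 2"
    "partial i (partial 1 (\<lambda>y. (y $ 2)\<^sup>2)) p = 0"
    "partial 2 (partial 2 (\<lambda>y. (y $ 2)\<^sup>2)) p = 2"
    by (simp_all add: 1 2 partial_mult d partial_coord)
  show "partial 1 (partial i (\<lambda>y. (y $ 2)\<^sup>2)) p = 0"
    using exhaust_2[of i] by (auto simp: 1 2 partial_mult d partial_coord)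
qed

text \<open>The v-derivative of \<open>F\<close> occurs only in the (1,1) components of
  \<open>warp_hessian\<close> and \<open>base_ricci\<close>. It drops out of every scalar because
  the (1,1) entry of the inverse metric and the (2,2) components of both tensors are zero, which is
  why only r-derivatives remain.\<close>

lemma metric4_curvature:
  fixes f :: "real \<Rightarrow> real \<Rightarrow> real" and y :: "real^(2 + 2)"
  defines "F \<equiv> \<lambda>p::real^2. f (p $ 1) (p $ 2)" and "p \<equiv> lpart y" and "r \<equiv> lpart y $ 2"
  assumes F: "twice_diff F p" and S: "sphere_parametrization V X" "rpart y \<in> V" and r: "r \<noteq> 0"
  shows "metric_germ (metric4 f (induced_metric X)) y"
    and "ricci_scalar (metric4 f (induced_metric X)) y
      = - partial 2 (partial 2 F) p - 4 * partial 2 F p / r - 2 * (F p - 1) / r\<^sup>2"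
    and "gauss_bonnet (metric4 f (induced_metric X)) y
      = 4 / r\<^sup>2 * ((partial 2 F p)\<^sup>2 + (F p - 1) * partial 2 (partial 2 F) p)"
proof -
  interpret warped_constant_curvature "vr_metric F" "induced_metric X" "\<lambda>p. (p $ 2)\<^sup>2" y 1
  proof unfold_locales
    show "metric_germ (vr_metric F) (lpart y)" using vr_germ[OF F] by (simp add: p_def)
    show "metric_germ (induced_metric X) (rpart y)" by (rule induced_metric_sphere(1)[OF S])
    show "twice_diff (\<lambda>p::real^2. (p $ 2)\<^sup>2) (lpart y)" by (intro twice_diff_power twice_diff_coord)
    show "(lpart y $ 2)\<^sup>2 \<noteq> 0" using r by (simp add: r_def)
    show "riemann (induced_metric X) (rpart y) i j k l = 1 * kulkarni (induced_metric X (rpart y)) i j k l"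
      for i j k l by (simp add: induced_metric_sphere(2)[OF S] kulkarni_def)
  qed
  have W: "metric4 f (induced_metric X) = W"
    by (rule ext, subst W_def) (simp add: metric4_def Let_def vr_metric_def F_def)
  note fold = p_def[symmetric] r_def[symmetric]
  note vr = vr_ginv[OF F] vr_chris_low[OF F]
  have gu: "grad_u 1 = 2 * r" "grad_u 2 = 2 * r * F p"
    unfolding grad_u_def fold by (simp_all add: sum_2 vr radius_partials fold) (simp_all add: p_def r_def)
  have pr: "p $ 2 = r" by (simp add: p_def r_def)
  have P: "warp_hessian 1 1 = (r * F p * partial 2 F p - r * partial 1 F p) / 2"
    "warp_hessian 1 2 = - r * partial 2 F p / 2" "warp_hessian 2 1 = - r * partial 2 F p / 2"
    "warp_hessian 2 2 = 0"
    using r unfolding warp_hessian_def fold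
    by (simp_all add: sum_2 vr radius_partials gu pr) (simp_all add: field_simps power2_eq_square)
  have wn: "warp_norm = r\<^sup>2 * F p"
    unfolding warp_norm_def fold by (simp add: sum_2 radius_partials gu pr) (simp add: power2_eq_square)
  have k: "\<kappa> = r\<^sup>2 * (1 - F p)"
    unfolding \<kappa>_def fold wn pr by (simp add: algebra_simps)
  have N: "N = 2" by (simp add: N_def)
  have tr: "trP = - r * partial 2 F p"
    unfolding trP_def fold pr by (simp add: sum_2 vr P)
  have rho: "\<rho> = 1 - F p - r * partial 2 F p"
    unfolding \<rho>_def fold pr using r by (simp add: tr k N)
  show "metric_germ (metric4 f (induced_metric X)) y" unfolding W by (rule metric_germ_W)
  show R: "ricci_scalar (metric4 f (induced_metric X)) y
      = - partial 2 (partial 2 F) p - 4 * partial 2 F p / r - 2 * (F p - 1) / r\<^sup>2"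
    unfolding W ricci_scalar_W fold pr vr_ricci_scalar[OF F] tr k N
    using r by (simp add: field_simps power2_eq_square)
  \<comment> \<open>The base block of the Ricci tensor is \<open>A\<close> times the metric, apart
    from a v-derivative in its (1,1) entry.\<close>
  define A where "A = - partial 2 (partial 2 F) p / 2 - partial 2 F p / r"
  have br: "base_ricci 1 1 = - F p * A - partial 1 F p / r" "base_ricci 1 2 = A" "base_ricci 2 1 = A"
    "base_ricci 2 2 = 0"
    unfolding base_ricci_def fold pr vr_ricci[OF F]
    using r by (simp_all add: P N A_def) (simp_all add: field_simps power2_eq_square)
  have rs: "ricci_square W y = 2 * A\<^sup>2 + 2 * (\<rho> / r\<^sup>2)\<^sup>2"
    unfolding ricci_square_W fold pr by (simp add: sum_2 vr br N) (simp add: algebra_simps power2_eq_square)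
  have ps: "P_square = r\<^sup>2 * (partial 2 F p)\<^sup>2 / 2"
    unfolding P_square_def P_up_def fold pr by (simp add: sum_2 vr P) (simp add: algebra_simps power2_eq_square)
  have rms: "riemann_square W y = (partial 2 (partial 2 F) p)\<^sup>2 + 4 * (partial 2 F p)\<^sup>2 / r\<^sup>2
      + 4 * (1 - F p)\<^sup>2 / r ^ 4"
    unfolding riemann_square_W fold pr vr_riemann_square[OF F] ps k N
    using r by (simp add: field_simps eval_nat_numeral)
  show "gauss_bonnet (metric4 f (induced_metric X)) y
      = 4 / r\<^sup>2 * ((partial 2 F p)\<^sup>2 + (F p - 1) * partial 2 (partial 2 F) p)"
    unfolding gauss_bonnet_eq R unfolding W rs rms rho A_def
    using r by (simp add: field_simps) (simp add: algebra_simps eval_nat_numeral)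
qed

section \<open>The equation satisfied by $\tilde f$\<close>

lemma smooth_real_derivatives:
  fixes M :: "real \<Rightarrow> real"
  assumes "smooth_on UNIV M"
  obtains M1 M2 where "\<And>t. (M has_real_derivative M1 t) (at t)" "\<And>t. (M1 has_real_derivative M2 t) (at t)"
proof -
  have *: "(f has_real_derivative frechet_derivative f (at t) 1) (at t)"
    if "f differentiable (at t)" for f :: "real \<Rightarrow> real" and t
  proof -
    have "frechet_derivative f (at t) h = frechet_derivative f (at t) 1 * h" for h
      using linear_cmul[OF linear_frechet_derivative[OF that], of h 1] by simp
    then have "frechet_derivative f (at t) = (*) (frechet_derivative f (at t) 1)"
      by (rule ext)
    from this[symmetric] show ?thesis
      using that[unfolded frechet_derivative_works] unfolding has_field_derivative_def by (simp only:)
  qed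
  \<comment> \<open>The only basis vector of the reals is 1, so two levels of \<open>Ck_on\<close>
    give two ordinary derivatives.\<close>
  have "Ck_on (Suc (Suc 0)) UNIV M" using assms unfolding smooth_on_def by blast
  then have "M differentiable (at t)" "(\<lambda>t. frechet_derivative M (at t) 1) differentiable (at t)" for t
    by simp_all
  from that[OF *[OF this(1)] *[OF this(2)]] show thesis .
qed

lemma twice_diff_smooth_compose:
  fixes M :: "real \<Rightarrow> real"
  assumes "smooth_on UNIV M" "twice_diff f x"
  shows "twice_diff (\<lambda>y. M (f y)) x"
proof -
  obtain M1 M2 where M: "\<And>t. (M has_real_derivative M1 t) (at t)" "\<And>t. (M1 has_real_derivative M2 t) (at t)"
    using smooth_real_derivatives[OF assms(1)] by blast
  show ?thesis
    by (rule twice_diff_compose[OF assms(2) always_eventually M(2)]) (simp add: M(1))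
qed

lemma twice_diff_inverse:
  assumes "twice_diff f x" "f x \<noteq> 0"
  shows "twice_diff (\<lambda>y. inverse (f y)) x"
proof (rule twice_diff_compose[OF assms(1)])
  have "\<forall>\<^sub>F t in nhds (f x). t \<noteq> 0"
    using t1_space_nhds[OF assms(2)] by simp
  then show "\<forall>\<^sub>F t in nhds (f x). (inverse has_real_derivative - (inverse t * inverse t)) (at t)"
    by eventually_elim (auto intro!: derivative_eq_intros simp: power2_eq_square)
  show "((\<lambda>t. - (inverse t * inverse t)) has_real_derivative 2 * inverse (f x) ^ 3) (at (f x))"
    using assms(2) by (auto intro!: derivative_eq_intros simp: field_simps eval_nat_numeral)
qed

lemma twice_diff_divide:
  assumes "twice_diff f x" "twice_diff g x" "g x \<noteq> 0"
  shows "twice_diff (\<lambda>y. f y / g y) x"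
  unfolding divide_inverse using assms by (intro twice_diff_mult twice_diff_inverse)

lemma twice_diff_sqrt:
  assumes "twice_diff f x" "f x > 0"
  shows "twice_diff (\<lambda>y. sqrt (f y)) x"
proof (rule twice_diff_compose[OF assms(1)])
  have "\<forall>\<^sub>F t in nhds (f x). t > 0"
    using eventually_nhds_in_open[of "{0<..}" "f x"] assms(2) by simp
  then show "\<forall>\<^sub>F t in nhds (f x). (sqrt has_real_derivative inverse (sqrt t) / 2) (at t)"
    by eventually_elim (rule DERIV_real_sqrt)
  show "((\<lambda>t. inverse (sqrt t) / 2) has_real_derivative
      - (inverse (sqrt (f x)) * (inverse (sqrt (f x)) / 2) * inverse (sqrt (f x))) / 2) (at (f x))"
    using assms(2) by (auto intro!: derivative_eq_intros DERIV_real_sqrt)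
qed

text \<open>
  Eliminating the square root from $\tilde f$ gives the hypothesis on \<open>h\<close> with \<open>a = 2 (n - 4) \<alpha>\<close>, where
  \<open>m\<close> and \<open>q\<close> depend on $v$ only; applying $\partial_r^2$ kills them without differentiating the root.
\<close>

lemma partial_square_cross:
  fixes h R :: "real^2 \<Rightarrow> real"
  assumes h: "twice_diff h p" and m: "twice_diff m p" and q: "twice_diff q p"
    and m2: "partial 2 m = (\<lambda>y. 0)" and q2: "partial 2 q = (\<lambda>y. 0)"
    and eq: "\<forall>\<^sub>F y in nhds p. a * a * (h y * h y) - 2 * a * (y $ 2 * y $ 2 * h y)
       = m y * y $ 2 - q y - c * (y $ 2 * y $ 2 * (y $ 2 * y $ 2))"
  shows "a\<^sup>2 * ((partial 2 h p)\<^sup>2 + h p * partial 2 (partial 2 h) p)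
      - a * (2 * h p + 4 * p $ 2 * partial 2 h p + (p $ 2)\<^sup>2 * partial 2 (partial 2 h) p)
    = - 6 * c * (p $ 2)\<^sup>2"
proof -
  note td = twice_diff_const twice_diff_mult twice_diff_diff twice_diff_coord[of 2] h m q
  have c2: "partial 2 (\<lambda>y::real^2. y $ 2) = (\<lambda>y. 1)"
    by (simp add: fun_eq_iff partial_coord)
  note p1 = partial_mult[OF twice_diff_at twice_diff_at] partial_diff[OF twice_diff_at twice_diff_at]
  note p2 = partial2_mult partial2_diff
  have "partial 2 (partial 2 (\<lambda>y. a * a * (h y * h y) - 2 * a * (y $ 2 * y $ 2 * h y))) p
      = partial 2 (partial 2 (\<lambda>y. m y * y $ 2 - q y - c * (y $ 2 * y $ 2 * (y $ 2 * y $ 2)))) p"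
    by (rule partial_cong_ev[OF partial_cong_eventually[OF eq]])
  \<comment> \<open>Both second derivatives carry a factor 2; cancelling it turns the 12 from
    differentiating r^4 twice into the 6 of the claim.\<close>
  then show ?thesis
    by (simp add: p1 p2 td c2 m2 q2 partial_const[abs_def]) (simp add: algebra_simps power2_eq_square)
qed

lemma partial_2_fst:
  fixes M :: "real \<Rightarrow> real"
  assumes "smooth_on UNIV M"
  shows "partial 2 (\<lambda>y::real^2. k * M (y $ 1)) = (\<lambda>y. 0)"
proof
  fix y :: "real^2"
  obtain M1 M2 where M: "\<And>t. (M has_real_derivative M1 t) (at t)" "\<And>t. (M1 has_real_derivative M2 t) (at t)"
    using smooth_real_derivatives[OF assms] by blast
  show "partial 2 (\<lambda>y::real^2. k * M (y $ 1)) y = 0"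
    by (subst partial_chain[where \<phi> = "\<lambda>t. k * M t" and d = "k * M1 (y $ 1)"])
       (auto simp: partial_coord intro!: twice_diff_at[OF twice_diff_coord] DERIV_cmult M)
qed

lemma ftilde_twice_diff:
  assumes "smooth_on UNIV M" "smooth_on UNIV q" "(p::real^2) $ 2 > 0"
    and "braces n \<alpha> M q (p $ 1) (p $ 2) > 0"
  shows "twice_diff (\<lambda>y::real^2. braces n \<alpha> M q (y $ 1) (y $ 2)) p"
    and "twice_diff (\<lambda>y::real^2. ftilde s n \<alpha> M q (y $ 1) (y $ 2)) p"
proof -
  show B: "twice_diff (\<lambda>y::real^2. braces n \<alpha> M q (y $ 1) (y $ 2)) p"
    unfolding braces_def
    by (intro twice_diff_add twice_diff_diff twice_diff_const twice_diff_divide twice_diff_mult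
        twice_diff_power twice_diff_smooth_compose[OF assms(1)] twice_diff_smooth_compose[OF assms(2)]
        twice_diff_coord) (use assms(3) in simp_all)
  have d: "twice_diff (\<lambda>y::real^2. (y $ 2)\<^sup>2 / (2 * (n - 4) * \<alpha>)) p"
    unfolding divide_inverse by (intro twice_diff_mult twice_diff_const twice_diff_power twice_diff_coord)
  show "twice_diff (\<lambda>y::real^2. ftilde s n \<alpha> M q (y $ 1) (y $ 2)) p"
    unfolding ftilde_def
    by (intro twice_diff_add twice_diff_diff twice_diff_const twice_diff_mult d twice_diff_sqrt[OF B] assms(4))
qed

lemma ftilde_equation:
  fixes n \<alpha> s :: real and p :: "real^2" and M q :: "real \<Rightarrow> real"
  defines "F \<equiv> \<lambda>y::real^2. ftilde s n \<alpha> M q (y $ 1) (y $ 2)" and "a \<equiv> 2 * (n - 4) * \<alpha>"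
  assumes M: "smooth_on UNIV M" and q: "smooth_on UNIV q" and p: "p $ 2 > 0"
    and B: "braces n \<alpha> M q (p $ 1) (p $ 2) > 0"
    and s: "s = 1 \<or> s = -1" and n: "n > 5" and \<alpha>: "\<alpha> > 0"
  shows "a\<^sup>2 * ((partial 2 F p)\<^sup>2 + (F p - 1) * partial 2 (partial 2 F) p)
      - a * (2 * (F p - 1) + 4 * p $ 2 * partial 2 F p + (p $ 2)\<^sup>2 * partial 2 (partial 2 F) p)
    = - 2 * (2 * n - 11) / (n - 5) * (p $ 2)\<^sup>2"
proof -
  have F: "twice_diff F p" unfolding F_def by (rule ftilde_twice_diff(2)[OF M q p B])
  define h where "h y = F y - 1" for y
  have h: "twice_diff h p" unfolding h_def by (intro twice_diff_diff F twice_diff_const)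
  have h1: "\<forall>\<^sub>F y in nhds p. partial 2 h y = partial 2 F y"
    using partial_diff_ev[OF F twice_diff_const[of 1], of 2] unfolding h_def by simp
  have hp: "partial 2 h p = partial 2 F p" by (rule eventually_nhds_x_imp_x[OF h1])
  have hpp: "partial 2 (partial 2 h) p = partial 2 (partial 2 F) p"
    by (rule partial_cong_ev[OF h1])
  define m where "m y = (4 * (n - 4)\<^sup>2 * \<alpha> powr (3/2)) * M (y $ 1)" for y :: "real^2"
  define k where "k y = (4 * (n - 4)\<^sup>2 * \<alpha>\<^sup>2) * q (y $ 1)" for y :: "real^2"
  define c where "c = 2 * (n - 5) * (2 * n - 11) / (6 * (n - 5)\<^sup>2)"
  have a: "a > 0" using n \<alpha> by (simp add: a_def)
  \<comment> \<open>The quadratic relation is going to be differentiated twice, so both positivity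
    conditions have to be spread from \<open>p\<close> to a neighbourhood.\<close>
  have "(\<lambda>y::real^2. y $ 2) \<midarrow>p\<rightarrow> p $ 2"
    by (intro tendsto_intros)
  then have "\<forall>\<^sub>F y in at p. y $ 2 > 0" by (rule order_tendstoD(1)[OF _ p])
  then have ev1: "\<forall>\<^sub>F y in nhds p. y $ 2 > 0"
    using p by (simp add: eventually_nhds_conv_at)
  have "isCont (\<lambda>y::real^2. braces n \<alpha> M q (y $ 1) (y $ 2)) p"
    using twice_diff_at[OF ftilde_twice_diff(1)[OF M q p B]] by (rule differentiable_imp_continuous_within)
  then have "\<forall>\<^sub>F y in at p. braces n \<alpha> M q (y $ 1) (y $ 2) > 0"
    unfolding isCont_def using order_tendstoD(1)[OF _ B] by blast
  then have ev2: "\<forall>\<^sub>F y in nhds p. braces n \<alpha> M q (y $ 1) (y $ 2) > 0"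
    using B by (simp add: eventually_nhds_conv_at)
  have "\<forall>\<^sub>F y in nhds p. a * a * (h y * h y) - 2 * a * (y $ 2 * y $ 2 * h y)
       = m y * y $ 2 - k y - c * (y $ 2 * y $ 2 * (y $ 2 * y $ 2))"
    using ev1 ev2
  proof eventually_elim
    case (elim y)
    let ?r = "y $ 2" and ?B = "braces n \<alpha> M q (y $ 1) (y $ 2)"
    have ah: "a * h y = ?r\<^sup>2 * (1 - s * sqrt ?B)"
      using n \<alpha> by (simp add: h_def F_def ftilde_def a_def)
    \<comment> \<open>Completing the square: \<open>a * h y\<close> minus r^2 is -r^2 times
      \<open>s * sqrt ?B\<close>, so squaring removes both the root and the choice of sign.\<close>
    have "a * a * (h y * h y) - 2 * a * (?r * ?r * h y) = (a * h y)\<^sup>2 - 2 * ?r\<^sup>2 * (a * h y)"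
      by (simp add: power2_eq_square)
    also have "\<dots> = ?r ^ 4 * ((s * sqrt ?B)\<^sup>2 - 1)"
      unfolding ah by (simp add: algebra_simps power2_eq_square eval_nat_numeral)
    also have "(s * sqrt ?B)\<^sup>2 = ?B"
      using s elim(2) by (auto simp: power_mult_distrib)
    \<comment> \<open>The factor r^4 clears the denominators of \<open>braces\<close>, leaving a
      part affine in r and a multiple of r^4.\<close>
    also have "?r ^ 4 * (?B - 1) = m y * ?r - k y - c * (?r * ?r * (?r * ?r))"
      using elim(1) unfolding braces_def m_def k_def c_def[symmetric]
      by (simp add: field_simps eval_nat_numeral)
    finally show ?case .
  qed
  from partial_square_cross[OF h _ _ _ _ this]
  have "a\<^sup>2 * ((partial 2 h p)\<^sup>2 + h p * partial 2 (partial 2 h) p)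
      - a * (2 * h p + 4 * p $ 2 * partial 2 h p + (p $ 2)\<^sup>2 * partial 2 (partial 2 h) p)
    = - 6 * c * (p $ 2)\<^sup>2"
    unfolding m_def k_def
    by (simp add: partial_2_fst[OF M] partial_2_fst[OF q] twice_diff_mult twice_diff_const twice_diff_coord
        twice_diff_smooth_compose[OF M] twice_diff_smooth_compose[OF q])
  moreover have "- 6 * c = - 2 * (2 * n - 11) / (n - 5)"
  proof -
    \<comment> \<open>With \<open>t\<close> as an atom, n - 5 cancels against its square in the
      denominator of \<open>c\<close>.\<close>
    define t where "t = n - 5"
    have "t \<noteq> 0" "n = t + 5" using n by (simp_all add: t_def)
    then show ?thesis by (simp add: c_def field_simps power2_eq_square)
  qed
  ultimately show ?thesis by (simp only: hp hpp h_def)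
qed

section \<open>The constraint equation\<close>

text \<open>The left side is the scalar of \<open>EGB_fiber\<close> for \<kappa> = -u, where
  \<open>N\<close> is n - 4 and \<open>u\<close> is the square of the radius. With the given
  \<open>u\<close> and \<Lambda> it reduces to the equation \<open>eq\<close> between the
  four-dimensional scalars.\<close>

lemma scalar_constraint:
  fixes N \<alpha> \<Lambda> u R4 L4 :: real
  assumes N: "N \<ge> 2" and \<alpha>: "\<alpha> > 0" and u: "u = 2 * \<alpha> * N * (N - 1)"
    and \<Lambda>: "\<Lambda> = - ((N + 4)\<^sup>2 - 5 * (N + 4) - 2) / (8 * \<alpha> * N * (N - 1))"
    and eq: "\<alpha> * L4 / 2 + R4 / N = - (2 * N - 3) / (\<alpha> * N\<^sup>2 * (N - 1))"
    and \<rho>: "\<rho> = - (N - 1)" and R: "R = R4 - N * (N - 1) / u"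
    and GB: "GB = L4 - 2 * R4 * N * (N - 1) / u + N * (N - 1) * (N - 2) * (N - 3) / u\<^sup>2"
  shows "\<rho> / u - R / 2 + \<alpha> * (2 * (R * \<rho> / u - 2 * \<rho>\<^sup>2 / u\<^sup>2
       - 2 * \<rho> * (- u) * (N - 1) / u ^ 3 + 2 * (N - 1) * (- u)\<^sup>2 / u ^ 4) - GB / 2) + \<Lambda> = 0"
proof -
  have u0: "u \<noteq> 0" using N \<alpha> by (simp add: u)
  have N0: "N \<noteq> 0" "N - 1 \<noteq> 0" using N by simp_all
  \<comment> \<open>The right side is the known formula for the components of the field equation
    along the fibre, at k = -1 and n = N + 4.\<close>
  have 1: "\<rho> / u - R / 2 + \<alpha> * (2 * (R * \<rho> / u - 2 * \<rho>\<^sup>2 / u\<^sup>2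
       - 2 * \<rho> * (- u) * (N - 1) / u ^ 3 + 2 * (N - 1) * (- u)\<^sup>2 / u ^ 4) - GB / 2) + \<Lambda>
    = - (R4 / 2) + \<Lambda> + (N - 1) * (N - 2) / (2 * u)
      - \<alpha> * (- ((N - 1) * (N - 2) / u * R4) + L4 / 2 + (N - 1) * (N - 2) * (N - 3) * (N - 4) / (2 * u\<^sup>2))"
    unfolding \<rho> R GB using u0 by (simp add: field_simps eval_nat_numeral)
  \<comment> \<open>The value of \<open>u\<close> makes the total coefficient of \<open>R4\<close>
    equal to -1/2 + (N - 2) / (2 N) = -1 / N, the one that occurs in \<open>eq\<close>.\<close>
  have a: "(N - 1) * (N - 2) / (2 * u) = (N - 2) / (4 * \<alpha> * N)"
    "\<alpha> * ((N - 1) * (N - 2) / u) = (N - 2) / (2 * N)"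
    "\<alpha> * ((N - 1) * (N - 2) * (N - 3) * (N - 4) / (2 * u\<^sup>2)) = (N - 2) * (N - 3) * (N - 4) / (8 * \<alpha> * N\<^sup>2 * (N - 1))"
  proof -
    have "D * (N - 2) / (2 * (2 * \<alpha> * N * D)) = (N - 2) / (4 * \<alpha> * N)"
      "\<alpha> * (D * (N - 2) / (2 * \<alpha> * N * D)) = (N - 2) / (2 * N)"
      "\<alpha> * (D * (N - 2) * (N - 3) * (N - 4) / (2 * (2 * \<alpha> * N * D)\<^sup>2))
        = (N - 2) * (N - 3) * (N - 4) / (8 * \<alpha> * N\<^sup>2 * D)" if "D \<noteq> 0" for D
      using that N0(1) \<alpha> by (simp_all add: power2_eq_square mult_ac)
    from this[OF N0(2)] show "(N - 1) * (N - 2) / (2 * u) = (N - 2) / (4 * \<alpha> * N)"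
      "\<alpha> * ((N - 1) * (N - 2) / u) = (N - 2) / (2 * N)"
      "\<alpha> * ((N - 1) * (N - 2) * (N - 3) * (N - 4) / (2 * u\<^sup>2)) = (N - 2) * (N - 3) * (N - 4) / (8 * \<alpha> * N\<^sup>2 * (N - 1))"
      unfolding u by blast+
  qed
  have "- (R4 / 2) + \<Lambda> + (N - 1) * (N - 2) / (2 * u)
      - \<alpha> * (- ((N - 1) * (N - 2) / u * R4) + L4 / 2 + (N - 1) * (N - 2) * (N - 3) * (N - 4) / (2 * u\<^sup>2))
    = - (R4 / 2) + \<Lambda> + (N - 1) * (N - 2) / (2 * u) + \<alpha> * ((N - 1) * (N - 2) / u) * R4 - \<alpha> * L4 / 2
      - \<alpha> * ((N - 1) * (N - 2) * (N - 3) * (N - 4) / (2 * u\<^sup>2))"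
    by (simp add: algebra_simps)
  also have "\<dots> = - (\<alpha> * L4 / 2 + R4 / N) + \<Lambda> + (N - 2) / (4 * \<alpha> * N)
      - (N - 2) * (N - 3) * (N - 4) / (8 * \<alpha> * N\<^sup>2 * (N - 1))"
    unfolding a using N0 by (simp add: field_simps)
  also have "\<dots> = 0"
  proof -
    \<comment> \<open>\<open>K\<close> is the common denominator of the four constant terms that
      remain once \<open>eq\<close> is inserted.\<close>
    define D K where "D = N - 1" and "K = 8 * \<alpha> * N\<^sup>2 * D"
    have D: "D \<noteq> 0" using N0 by (simp add: D_def)
    have *: "- (2 * N - 3) / (\<alpha> * N\<^sup>2 * D) = - 8 * (2 * N - 3) / K"
      "- ((N + 4)\<^sup>2 - 5 * (N + 4) - 2) / (8 * \<alpha> * N * D) = - ((N + 4)\<^sup>2 - 5 * (N + 4) - 2) * N / K"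
      "(N - 2) / (4 * \<alpha> * N) = (N - 2) * (2 * N * D) / K"
      using N0(1) D \<alpha> by (simp_all add: K_def field_simps power2_eq_square)
    \<comment> \<open>The constants cancel through this polynomial identity in \<open>N\<close>,
      which is where the value of \<Lambda> enters.\<close>
    have num: "8 * (2 * N - 3) - ((N + 4)\<^sup>2 - 5 * (N + 4) - 2) * N + (N - 2) * (2 * N * D)
        - (N - 2) * (N - 3) * (N - 4) = 0"
      by (simp add: D_def algebra_simps power2_eq_square)
    have frac: "- (- 8 * a / K) + - b * N / K + c / K - e / K = (8 * a - b * N + c - e) / K" for a b c e
      by (simp add: diff_divide_distrib add_divide_distrib)
    have "- (\<alpha> * L4 / 2 + R4 / N) + \<Lambda> + (N - 2) / (4 * \<alpha> * N)
      - (N - 2) * (N - 3) * (N - 4) / (8 * \<alpha> * N\<^sup>2 * (N - 1))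
      = - (- 8 * (2 * N - 3) / K) + - ((N + 4)\<^sup>2 - 5 * (N + 4) - 2) * N / K + (N - 2) * (2 * N * D) / K
        - (N - 2) * (N - 3) * (N - 4) / K"
      using eq \<Lambda> * unfolding D_def[symmetric] K_def by presburger
    then show ?thesis unfolding frac num by simp
  qed
  finally show ?thesis using 1 by simp
qed

theorem mainTheorem3:
  fixes n :: nat
    and \<alpha> \<Lambda> r0 s :: real
    and M q :: "real \<Rightarrow> real"
    and V :: "(real^2) set" and X :: "real^2 \<Rightarrow> real^3"
    and U :: "(real^'k) set" and \<gamma> :: "real^'k \<Rightarrow> real^'k^'k"
    and x :: "real^((2 + 2) + 'k)"
    and a b :: 'k
  assumes "n \<ge> 6" and "CARD('k) = n - 4"
    and "\<alpha> > 0"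
    and "r0 > 0" and "r0\<^sup>2 = 2 * \<alpha> * (real n - 4) * (real n - 5)"
    and "\<Lambda> = - ((real n)\<^sup>2 - 5 * real n - 2) / (8 * \<alpha> * (real n - 4) * (real n - 5))"
    and "smooth_on UNIV M" and "smooth_on UNIV q"
    and "s = 1 \<or> s = -1"
    and "sphere_parametrization V X"
    and "open U" and "pseudo_riemannian_on U \<gamma>" and "constant_sectional_curvature_on U \<gamma> (-1)"
    and "lpart (lpart x) $ 2 > 0"
    and "braces (real n) \<alpha> M q (lpart (lpart x) $ 1) (lpart (lpart x) $ 2) > 0"
    and "rpart (lpart x) \<in> V"
    and "rpart x \<in> U"
  shows "EGB \<alpha> \<Lambda>
           (product_metric r0 (metric4 (ftilde s (real n) \<alpha> M q) (induced_metric X)) \<gamma>)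
           x (Inr a) (Inr b) = 0"
proof -
  define F where "F = (\<lambda>y::real^2. ftilde s (real n) \<alpha> M q (y $ 1) (y $ 2))"
  define p where "p = lpart (lpart x)"
  define G where "G = metric4 (ftilde s (real n) \<alpha> M q) (induced_metric X)"
  \<comment> \<open>n at least 6 makes the fibre at least two-dimensional, so it contains planes and
    \<open>riemann_constant_curvature\<close> applies.\<close>
  have n: "real n \<ge> 6" and N: "real CARD('k) = real n - 4" and card: "CARD('k) \<ge> 2"
    using assms(1,2) by simp_all
  have r: "p $ 2 > 0" and B: "braces (real n) \<alpha> M q (p $ 1) (p $ 2) > 0"
    using assms(14,15) by (simp_all add: p_def)
  have F: "twice_diff F p"
    unfolding F_def by (rule ftilde_twice_diff(2)[OF assms(7,8) r B])
  have r0: "p $ 2 \<noteq> 0" using r by simp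
  note curv = metric4_curvature[of "ftilde s (real n) \<alpha> M q" "lpart x", folded F_def p_def,
      OF F assms(10,16) r0, folded G_def]
  have \<gamma>: "metric_germ \<gamma> (rpart x)"
  proof -
    have sm: "smooth_on U \<gamma>" and sy: "\<And>y. y \<in> U \<Longrightarrow> transpose (\<gamma> y) = \<gamma> y \<and> invertible (\<gamma> y)"
      using assms(12) by (simp_all add: pseudo_riemannian_on_def)
    have "twice_diff (\<lambda>y. \<gamma> y $ i $ j) (rpart x)" for i j
      by (rule smooth_on_linear_twice_diff(1)[OF assms(11,17) sm, of "\<lambda>A. A $ i $ j"])
         (intro bounded_linear_compose[OF bounded_linear_vec_nth bounded_linear_vec_nth])
    moreover have "\<forall>\<^sub>F y in nhds (rpart x). transpose (\<gamma> y) = \<gamma> y"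
      using eventually_nhds_in_open[OF assms(11,17)] by eventually_elim (simp add: sy)
    ultimately show ?thesis using sy[OF assms(17)] by (simp add: metric_germ_def)
  qed
  have u0: "r0\<^sup>2 \<noteq> 0" using assms(4) by simp
  have sec: "sectional_curvature \<gamma> (rpart x) w z = - 1" if "plane_form \<gamma> (rpart x) w z \<noteq> 0" for w z
    using assms(13,17) that unfolding constant_sectional_curvature_on_def by blast
  \<comment> \<open>The warping factor is constant: \<open>warp_hessian\<close> and
    \<open>warp_norm\<close> vanish, so \<open>EGB_fiber\<close> applies and \<kappa> reduces to
    \<open>ux * c\<close>.\<close>
  interpret warped_constant_curvature G \<gamma> "\<lambda>_. r0\<^sup>2" x "-1"
    by unfold_locales
      (rule curv(1) \<gamma> u0 twice_diff_const riemann_constant_curvature[OF \<gamma> card sec] | assumption)+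
  have W: "product_metric r0 G \<gamma> = W"
    by (rule ext, subst W_def) (simp add: product_metric_def)
  have P0: "warp_hessian i j = 0" for i j
    by (simp add: warp_hessian_def grad_u_def partial_const[abs_def])
  have k: "\<kappa> = - (r0\<^sup>2)"
    by (simp add: \<kappa>_def warp_norm_def)
  have N': "N = real n - 4" by (simp only: N_def N)
  have tr: "trP = 0" by (simp add: trP_def P0)
  have rho: "\<rho> = - (N - 1)"
    using u0 by (simp add: \<rho>_def k tr)
  have R: "ricci_scalar W x = ricci_scalar G (lpart x) - N * (N - 1) / r0\<^sup>2"
    unfolding ricci_scalar_W tr k using u0 by (simp add: power2_eq_square)
  have rsq: "ricci_square W x = ricci_square G (lpart x) + N * ((N - 1) / r0\<^sup>2)\<^sup>2"
    unfolding ricci_square_W rho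
    by (simp add: base_ricci_def P0 ricci_square_def ricci_up2_def power_divide power2_commute[of 1])
  have msq: "riemann_square W x = riemann_square G (lpart x) + 2 * N * (N - 1) / (r0\<^sup>2)\<^sup>2"
    unfolding riemann_square_W k P_square_def P0 using u0
    by (simp add: power2_eq_square eval_nat_numeral)
  have GB: "gauss_bonnet W x = gauss_bonnet G (lpart x)
      - 2 * ricci_scalar G (lpart x) * N * (N - 1) / r0\<^sup>2 + N * (N - 1) * (N - 2) * (N - 3) / (r0\<^sup>2)\<^sup>2"
    unfolding gauss_bonnet_eq R rsq msq using u0 by (simp add: field_simps power2_eq_square)
  have eq: "\<alpha> * gauss_bonnet G (lpart x) / 2 + ricci_scalar G (lpart x) / N
      = - (2 * N - 3) / (\<alpha> * N\<^sup>2 * (N - 1))"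
  proof -
    let ?r = "p $ 2" and ?f2 = "partial 2 F p" and ?f22 = "partial 2 (partial 2 F) p"
    define S where "S = ?f2\<^sup>2 + (F p - 1) * ?f22"
    define T where "T = 2 * (F p - 1) + 4 * ?r * ?f2 + ?r\<^sup>2 * ?f22"
    have Fp: "ftilde s (real n) \<alpha> M q (p $ 1) (p $ 2) = F p" by (simp add: F_def)
    have N0: "N > 0" "N - 1 > 0" using n by (simp_all add: N')
    have R4: "ricci_scalar G (lpart x) = - T / ?r\<^sup>2"
      unfolding curv(2) Fp T_def using r0 by (simp add: field_simps power2_eq_square)
    have L4: "gauss_bonnet G (lpart x) = 4 * S / ?r\<^sup>2"
      unfolding curv(3) Fp S_def by simp
    have "(2 * N * \<alpha>)\<^sup>2 * S - 2 * N * \<alpha> * T = - 2 * (2 * N - 3) / (N - 1) * ?r\<^sup>2"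
      using ftilde_equation[OF assms(7,8) r B assms(9) _ assms(3), folded F_def, unfolded Fp] n
      by (simp add: S_def T_def N' algebra_simps)
    \<comment> \<open>Here 2 N \<alpha> is the \<open>a\<close> of \<open>ftilde_equation\<close>.
      The divisor 2 N^2 \<alpha> r^2 turns the term with \<open>S\<close> into \<alpha>/2 times the
      Gauss-Bonnet scalar and the term with \<open>T\<close> into the Ricci scalar over
      \<open>N\<close>.\<close>
    then have e1: "((2 * N * \<alpha>)\<^sup>2 * S - 2 * N * \<alpha> * T) / (2 * N\<^sup>2 * \<alpha> * ?r\<^sup>2)
        = - 2 * (2 * N - 3) / (N - 1) * ?r\<^sup>2 / (2 * N\<^sup>2 * \<alpha> * ?r\<^sup>2)" by simp
    have e2: "((2 * N * \<alpha>)\<^sup>2 * S - 2 * N * \<alpha> * T) / (2 * N\<^sup>2 * \<alpha> * ?r\<^sup>2)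
        = \<alpha> * (4 * S / ?r\<^sup>2) / 2 + - T / ?r\<^sup>2 / N"
      using N0(1) assms(3) r0 by (simp add: field_simps power2_eq_square)
    have e3: "- 2 * (2 * N - 3) / (N - 1) * ?r\<^sup>2 / (2 * N\<^sup>2 * \<alpha> * ?r\<^sup>2)
        = - (2 * N - 3) / (\<alpha> * N\<^sup>2 * (N - 1))"
    proof -
      have gen: "- 2 * A / D * w / (2 * C * \<alpha> * w) = - A / (\<alpha> * C * D)" if "w \<noteq> 0" for A C D w :: real
        using that by (simp add: mult_ac)
      show ?thesis by (rule gen) (use r0 in simp)
    qed
    show ?thesis unfolding R4 L4 by (rule trans[OF trans[OF e2[symmetric] e1] e3])
  qed
  have u: "r0\<^sup>2 = 2 * \<alpha> * N * (N - 1)"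
    unfolding assms(5) N' by simp
  have L: "\<Lambda> = - ((N + 4)\<^sup>2 - 5 * (N + 4) - 2) / (8 * \<alpha> * N * (N - 1))"
    unfolding assms(6) N' by simp
  have "N \<ge> 2" using n by (simp add: N')
  from scalar_constraint[OF this assms(3) u L eq rho R GB]
  show ?thesis
    unfolding G_def[symmetric] W EGB_fiber[OF P0] k by (simp only: mult_zero_right)
qed

end
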